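(* Let $(G\rightrightarrows M,\eta,\sigma)$ be a contact groupoid. Let $G\times\mathbb{R}\rightrightarrows M\times\mathbb{R}$ be the Lie groupoid with structural functions $$\alpha_\sigma(g,t)=(\alpha(g),\sigma(g)+t),\quad \beta_\sigma(h,s)=(\beta(h),s),\quad m_\sigma((g,t),(h,s))=(gh,t)\ \text{ if }\alpha_\sigma(g,t)=\beta_\sigma(h,s),\quad \epsilon_\sigma(x,t)=(\epsilon(x),t).$$ Let $\bar\pi_1:G\times\mathbb{R}\to G$ and $\bar\pi_2:G\times\mathbb{R}\to\mathbb{R}$ be the canonical projections, and on $G\times\mathbb{R}$ put $$\Omega=-\big(\bar\pi_1^*(d\eta)+\bar\pi_2^*(dt)\wedge\bar\pi_1^*\eta\big),\quad \omega=-\bar\pi_2^*(dt),\quad \bar\sigma=\sigma\circ\bar\pi_1,\quad \theta=e^{\bar\sigma}(d\bar\sigma-\omega).$$ Let $(\Lambda,E)$ be the Jacobi structure on $G\times\mathbb{R}$ associated with the locally conformal symplectic structure $(\Omega,\omega)$, let $\widetilde{\alpha_\sigma},\widetilde{\beta_\sigma},\widetilde{\epsilon_\sigma}$ be the source, target and identity section of the cotangent groupoid $T^*(G\times\mathbb{R})\rightrightarrows A^*(G\times\mathbb{R})$, and let $\pi_i:(G\times\mathbb{R})^{(2)}\to G\times\mathbb{R}$, $i=1,2$, be the canonical projections. Then: i) $m_\sigma^*\Omega=\pi_1^*\Omega+e^{(\bar\sigma\circ\pi_1)}\pi_2^*\Omega$; ii) $\widetilde{\alpha_\sigma}\circ\omega=0$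 and $\widetilde{\beta_\sigma}\circ\theta=0$; iii) $m_\sigma^*\omega=\pi_1^*\omega$ and $m_\sigma^*\theta=e^{(\bar\sigma\circ\pi_1)}\pi_2^*\theta$; iv) $\Lambda(\omega,\theta)=0$ and $(\theta+\omega-\widetilde{\epsilon_\sigma}\circ\widetilde{\beta_\sigma}\circ\omega)\circ\epsilon_\sigma=0$.
   Context: Everything is smooth; $d$ is the exterior differential. **Lie groupoids.** A Lie groupoid $G\rightrightarrows M$ has source $\alpha:G\to M$, target $\beta:G\to M$, identity section $\epsilon:M\to G$ and partial multiplication $m(g,h)=gh$ defined on $G^{(2)}=\{(g,h)\in G\times G:\alpha(g)=\beta(h)\}$, so $\alpha(gh)=\alpha(h)$, $\beta(gh)=\beta(g)$. Put $G^x=\beta^{-1}(x)$, $G_x=\alpha^{-1}(x)$; left translation is $L_g:G^{\alpha(g)}\to G^{\beta(g)}$, $h\mapsto gh$, and right translation is $R_h:G_{\beta(h)}\to G_{\alpha(h)}$, $g\mapsto gh$. The tangent groupoid $TG\rightrightarrows TM$ has as structural functions the tangent maps of those of $G$: source $\alpha^T$, target $\beta^T$, identity section $\epsilon^T$, and multiplication $X_g\oplus_{TG}Y_h=T_{(g,h)}m(X_g,Y_h)$. The Lie algebroid $AG\to M$ has fibre $A_xG=T_{\epsilon(x)}G^x=\ker\beta^T_{\epsilon(x)}$; $A^*G$ is the dual bundle. **Cotangent groupoid** $T^*G\rightrightarrows A^*G$: source $\tilde\alpha(\mu_g)(X)=\mu_g((L_g)_*X)$ for $X\in A_{\alpha(g)}G$;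 target $\tilde\beta(\nu_h)(X)=\nu_h\big((R_h)_*(X-\epsilon^T\alpha^T X)\big)$ for $X\in A_{\beta(h)}G$; identity section $\tilde\epsilon(\mu_x)(Z)=\mu_x(Z-\epsilon^T\beta^T Z)$ for $\mu_x\in A^*_xG$, $Z\in T_{\epsilon(x)}G$; multiplication $(\mu_g\oplus_{T^*G}\nu_h)(X_g\oplus_{TG}Y_h)=\mu_g(X_g)+\nu_h(Y_h)$ for $(X_g,Y_h)\in T_{(g,h)}G^{(2)}$ when $\tilde\alpha(\mu_g)=\tilde\beta(\nu_h)$. For a 1-form $\omega$ on $G$, viewed as a map $G\to T^*G$, $\tilde\alpha\circ\omega=0$ means $\tilde\alpha(\omega_g)=0\in A^*_{\alpha(g)}G$ for all $g$, and similarly for $\tilde\beta$. These constructions are applied to $G\times\mathbb{R}\rightrightarrows M\times\mathbb{R}$ in the claim. **Contact groupoid.** $(G\rightrightarrows M,\eta,\sigma)$ is a contact groupoid if $G\rightrightarrows M$ is a Lie groupoid, $\eta$ is a contact 1-form on $G$ (i.e. $\dim G=2n+1$ and $\eta\wedge(d\eta)^n$ vanishes nowhere) and $\sigma:G\to\mathbb{R}$ is a function such that $\eta_{gh}(X_g\oplus_{TG}Y_h)=\eta_g(X_g)+e^{\sigma(g)}\eta_h(Y_h)$ for all $(g,h)\in G^{(2)}$, $(X_g,Y_h)\in T_{(g,h)}G^{(2)}$. It follows that $\sigma$ is multiplicative, i.e. $\sigma(gh)=\sigma(g)+\sigma(h)$ for $(g,h)\in G^{(2)}$, which makes the structural functions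 in the claim those of a Lie groupoid. **L.c.s. structures.** A locally conformal symplectic (l.c.s.) structure on a manifold is a pair $(\Omega,\omega)$ with $\Omega$ a non-degenerate 2-form and $\omega$ a closed 1-form with $d\Omega=\omega\wedge\Omega$. With $\flat(X)=i(X)\Omega$, its associated Jacobi structure $(\Lambda,E)$ (a 2-vector and a vector field) is $\Lambda(\mu,\nu)=\Omega(\flat^{-1}(\mu),\flat^{-1}(\nu))$ for 1-forms $\mu,\nu$, and $E=\flat^{-1}(\omega)$. The pair $(\Omega,\omega)$ in the claim is an l.c.s. structure on $G\times\mathbb{R}$. *)

theory Defs
  imports "HOL-Analysis.Analysis"
begin

section \<open>Smooth manifolds\<close>

primrec Ck_on :: "nat \<Rightarrow> 'a::real_normed_vector set \<Rightarrow> ('a \<Rightarrow> 'b::real_normed_vector) \<Rightarrow> bool" where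
  "Ck_on 0 S f \<longleftrightarrow> continuous_on S f"
| "Ck_on (Suc k) S f \<longleftrightarrow>
     (\<forall>x\<in>S. f differentiable (at x)) \<and> (\<forall>v. Ck_on k S (\<lambda>x. frechet_derivative f (at x) v))"

text \<open>Only meant for open \<^term>\<open>S\<close> in a finite-dimensional space.\<close>
definition Cinf_on :: "'a::real_normed_vector set \<Rightarrow> ('a \<Rightarrow> 'b::real_normed_vector) \<Rightarrow> bool" where
  "Cinf_on S f \<longleftrightarrow> (\<forall>k. Ck_on k S f)"

type_synonym ('m, 'e) chart = "'m set \<times> ('m \<Rightarrow> 'e)"

abbreviation cdom :: "('m, 'e) chart \<Rightarrow> 'm set" where "cdom \<equiv> fst"
abbreviation cmap :: "('m, 'e) chart \<Rightarrow> 'm \<Rightarrow> 'e" where "cmap \<equiv> snd"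

definition cinv :: "('m, 'e) chart \<Rightarrow> 'e \<Rightarrow> 'm" where
  "cinv c = inv_into (cdom c) (cmap c)"

text \<open>A manifold is a Hausdorff, second countable type with a smooth atlas covering it.
  The model space is a finite-dimensional normed space rather than a
  \<^class>\<open>euclidean_space\<close>, because the latter excludes dimension 0 and
  the base of a contact groupoid of dimension 1 has dimension 0.\<close>
definition smooth_atlas ::
  "('m::{t2_space,second_countable_topology}, 'e::real_normed_vector) chart set \<Rightarrow> bool" where
  "smooth_atlas A \<longleftrightarrow>
     (\<exists>B::'e set. finite B \<and> span B = UNIV) \<and>
     (\<Union>c\<in>A. cdom c) = UNIV \<and>
     (\<forall>c\<in>A. open (cdom c) \<and> open (cmap c ` cdom c) \<and>
        homeomorphism (cdom c) (cmap c ` cdom c) (cmap c) (cinv c)) \<and>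
     (\<forall>c\<in>A. \<forall>c'\<in>A. Cinf_on (cmap c ` (cdom c \<inter> cdom c')) (cmap c' \<circ> cinv c))"

definition real_atlas :: "(real, real) chart set" where
  "real_atlas = {(UNIV, \<lambda>t. t)}"

definition prod_atlas :: "('m, 'd) chart set \<Rightarrow> ('n, 'e) chart set \<Rightarrow> ('m \<times> 'n, 'd \<times> 'e) chart set" where
  "prod_atlas A B = {(cdom c \<times> cdom c', map_prod (cmap c) (cmap c')) | c c'. c \<in> A \<and> c' \<in> B}"

definition smooth_map_open ::
  "('m::topological_space, 'd::real_normed_vector) chart set \<Rightarrow>
   ('n::topological_space, 'e::real_normed_vector) chart set \<Rightarrow> 'm set \<Rightarrow> ('m \<Rightarrow> 'n) \<Rightarrow> bool" where
  "smooth_map_open A B W f \<longleftrightarrow> open W \<and> continuous_on W f \<and>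
     (\<forall>c\<in>A. \<forall>c'\<in>B. Cinf_on (cmap c ` {p \<in> cdom c \<inter> W. f p \<in> cdom c'}) (cmap c' \<circ> f \<circ> cinv c))"

abbreviation smooth_map where "smooth_map A B f \<equiv> smooth_map_open A B UNIV f"

definition local_extension ::
  "('m::topological_space, 'd::real_normed_vector) chart set \<Rightarrow>
   ('n::topological_space, 'e::real_normed_vector) chart set \<Rightarrow>
   'm set \<Rightarrow> ('m \<Rightarrow> 'n) \<Rightarrow> 'm \<Rightarrow> ('m \<Rightarrow> 'n) \<Rightarrow> bool" where
  "local_extension A B S f p F \<longleftrightarrow>
     (\<exists>W. p \<in> W \<and> smooth_map_open A B W F \<and> (\<forall>q\<in>W \<inter> S. F q = f q))"

text \<open>On an embedded submanifold \<^term>\<open>S\<close> (here: a fibre of a submersion, or the set of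
  composable pairs of a Lie groupoid) a map is smooth iff it has local smooth extensions
  to the ambient manifold.\<close>
definition smooth_on_sub where
  "smooth_on_sub A B S f \<longleftrightarrow> (\<forall>p\<in>S. \<exists>F. local_extension A B S f p F)"

section \<open>Tangent vectors\<close>

text \<open>A tangent vector at \<^term>\<open>p\<close> is the family of its coordinate vectors in all charts
  around \<^term>\<open>p\<close>, related by the derivatives of the transition maps; it is set to 0 on all
  other arguments, so that equality and the vector space operations are pointwise.\<close>
type_synonym ('m, 'e) tvec = "('m, 'e) chart \<Rightarrow> 'e"

definition charts_at :: "('m, 'e) chart set \<Rightarrow> 'm \<Rightarrow> ('m, 'e) chart set" where
  "charts_at A p = {c \<in> A. p \<in> cdom c}"

definition tspace :: "('m, 'e::real_normed_vector) chart set \<Rightarrow> 'm \<Rightarrow> ('m, 'e) tvec set" where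
  "tspace A p = {v. (\<forall>c\<in>charts_at A p. \<forall>c'\<in>charts_at A p.
        v c' = frechet_derivative (cmap c' \<circ> cinv c) (at (cmap c p)) (v c)) \<and>
      (\<forall>c. c \<notin> charts_at A p \<longrightarrow> v c = 0)}"

text \<open>The tangent vector at \<^term>\<open>p\<close> with coordinates \<^term>\<open>u\<close> in the chart \<^term>\<open>c\<close>.\<close>
definition coord_vec ::
  "('m, 'e::real_normed_vector) chart set \<Rightarrow> ('m, 'e) chart \<Rightarrow> 'm \<Rightarrow> 'e \<Rightarrow> ('m, 'e) tvec" where
  "coord_vec A c p u = (\<lambda>c'. if c' \<in> charts_at A p
     then frechet_derivative (cmap c' \<circ> cinv c) (at (cmap c p)) u else 0)"

definition chart_of :: "('m, 'e) chart set \<Rightarrow> 'm \<Rightarrow> ('m, 'e) chart" where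
  "chart_of A p = (SOME c. c \<in> charts_at A p)"

text \<open>By the chain rule the choice of chart around \<^term>\<open>p\<close> is immaterial.\<close>
definition tmap ::
  "('m, 'd::real_normed_vector) chart set \<Rightarrow> ('n, 'e::real_normed_vector) chart set \<Rightarrow>
   ('m \<Rightarrow> 'n) \<Rightarrow> 'm \<Rightarrow> ('m, 'd) tvec \<Rightarrow> ('n, 'e) tvec" where
  "tmap A B f p v = (let c = chart_of A p in
     (\<lambda>c'. if c' \<in> charts_at B (f p)
        then frechet_derivative (cmap c' \<circ> f \<circ> cinv c) (at (cmap c p)) (v c) else 0))"

text \<open>The tangent map of a map on an embedded submanifold \<^term>\<open>S\<close>. It is only applied to
  vectors tangent to \<^term>\<open>S\<close>, where the choice of the extension is immaterial.\<close>
definition tmap_on ::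
  "('m::topological_space, 'd::real_normed_vector) chart set \<Rightarrow>
   ('n::topological_space, 'e::real_normed_vector) chart set \<Rightarrow>
   'm set \<Rightarrow> ('m \<Rightarrow> 'n) \<Rightarrow> 'm \<Rightarrow> ('m, 'd) tvec \<Rightarrow> ('n, 'e) tvec" where
  "tmap_on A B S f p v = tmap A B (SOME F. local_extension A B S f p F) p v"

definition submersion where
  "submersion A B f \<longleftrightarrow> smooth_map A B f \<and> (\<forall>p. tmap A B f p ` tspace A p = tspace B (f p))"

section \<open>Differential forms\<close>

text \<open>A \<open>k\<close>-form is evaluated at a point on a list of \<open>k\<close> tangent vectors at that point; its
  values on other lists are irrelevant. In particular a function \<^term>\<open>f\<close> is the 0-form
  \<^term>\<open>zero_form f\<close>.\<close>
type_synonym ('m, 'e) form = "'m \<Rightarrow> ('m, 'e) tvec list \<Rightarrow> real"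

definition zero_form :: "('m \<Rightarrow> real) \<Rightarrow> ('m, 'e) form" where
  "zero_form f = (\<lambda>p vs. f p)"

definition coord_form ::
  "('m, 'e::real_normed_vector) chart set \<Rightarrow> ('m, 'e) form \<Rightarrow> ('m, 'e) chart \<Rightarrow> 'e \<Rightarrow> 'e list \<Rightarrow> real" where
  "coord_form A \<omega> c x us = \<omega> (cinv c x) (map (coord_vec A c (cinv c x)) us)"

definition smooth_form :: "('m, 'e::real_normed_vector) chart set \<Rightarrow> nat \<Rightarrow> ('m, 'e) form \<Rightarrow> bool" where
  "smooth_form A k \<omega> \<longleftrightarrow> (\<forall>c\<in>A. \<forall>us. length us = k \<longrightarrow>
     Cinf_on (cmap c ` cdom c) (\<lambda>x. coord_form A \<omega> c x us) \<and>
     (\<forall>x\<in>cmap c ` cdom c.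
        (\<forall>i<k. linear (\<lambda>u. coord_form A \<omega> c x (us[i := u]))) \<and>
        (\<forall>i<k. \<forall>j<k. i \<noteq> j \<and> us ! i = us ! j \<longrightarrow> coord_form A \<omega> c x us = 0)))"

text \<open>Normalisation: \<open>(\<alpha> \<and> \<beta>)(X, Y) = \<alpha>(X) \<beta>(Y) - \<alpha>(Y) \<beta>(X)\<close> for 1-forms, and
  \<open>d\<alpha>(X, Y) = X(\<alpha>(Y)) - Y(\<alpha>(X)) - \<alpha>([X, Y])\<close>. The degrees of the factors of a wedge product
  are explicit arguments, and the exterior derivative is computed in an arbitrary chart
  around the point.\<close>
definition wedge :: "nat \<Rightarrow> nat \<Rightarrow> ('m, 'e) form \<Rightarrow> ('m, 'e) form \<Rightarrow> ('m, 'e) form" where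
  "wedge k l \<alpha> \<beta> = (\<lambda>p vs. (\<Sum>\<pi> | \<pi> permutes {..<k + l}.
       of_int (sign \<pi>) * \<alpha> p (map (\<lambda>i. vs ! \<pi> i) [0..<k]) * \<beta> p (map (\<lambda>i. vs ! \<pi> i) [k..<k + l]))
     / (fact k * fact l))"

primrec wedge_power :: "nat \<Rightarrow> ('m, 'e) form \<Rightarrow> nat \<Rightarrow> ('m, 'e) form" where
  "wedge_power k \<alpha> 0 = zero_form (\<lambda>p. 1)"
| "wedge_power k \<alpha> (Suc n) = wedge k (k * n) \<alpha> (wedge_power k \<alpha> n)"

definition ext_deriv :: "('m, 'e::real_normed_vector) chart set \<Rightarrow> ('m, 'e) form \<Rightarrow> ('m, 'e) form" where
  "ext_deriv A \<omega> = (\<lambda>p vs. let c = chart_of A p; us = map (\<lambda>v. v c) vs in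
     \<Sum>i<length us. (-1) ^ i *
       frechet_derivative (\<lambda>x. coord_form A \<omega> c x (take i us @ drop (Suc i) us)) (at (cmap c p)) (us ! i))"

definition pullback ::
  "('m, 'd::real_normed_vector) chart set \<Rightarrow> ('n, 'e::real_normed_vector) chart set \<Rightarrow>
   ('m \<Rightarrow> 'n) \<Rightarrow> ('n, 'e) form \<Rightarrow> ('m, 'd) form" where
  "pullback A B f \<omega> = (\<lambda>p vs. \<omega> (f p) (map (tmap A B f p) vs))"

definition pullback_on ::
  "('m::topological_space, 'd::real_normed_vector) chart set \<Rightarrow>
   ('n::topological_space, 'e::real_normed_vector) chart set \<Rightarrow>
   'm set \<Rightarrow> ('m \<Rightarrow> 'n) \<Rightarrow> ('n, 'e) form \<Rightarrow> ('m, 'd) form" where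
  "pullback_on A B S f \<omega> = (\<lambda>p vs. \<omega> (f p) (map (tmap_on A B S f p) vs))"

definition contact_form :: "('m, 'e::euclidean_space) chart set \<Rightarrow> ('m, 'e) form \<Rightarrow> bool" where
  "contact_form A \<eta> \<longleftrightarrow> smooth_form A 1 \<eta> \<and>
     (\<exists>n. DIM('e) = 2 * n + 1 \<and>
       (\<forall>p. \<exists>vs. length vs = 2 * n + 1 \<and> set vs \<subseteq> tspace A p \<and>
          wedge 1 (2 * n) \<eta> (wedge_power 2 (ext_deriv A \<eta>) n) p vs \<noteq> 0))"

section \<open>The Jacobi structure of an l.c.s. structure\<close>

text \<open>\<^term>\<open>flat_inv A \<Omega> p \<mu>\<close> is the vector \<open>X\<close> at \<open>p\<close> with \<open>i(X)\<Omega> = \<mu>\<close>, for non-degenerate \<open>\<Omega>\<close>.\<close>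
definition flat_inv ::
  "('m, 'e::real_normed_vector) chart set \<Rightarrow> ('m, 'e) form \<Rightarrow> 'm \<Rightarrow>
   (('m, 'e) tvec list \<Rightarrow> real) \<Rightarrow> ('m, 'e) tvec" where
  "flat_inv A \<Omega> p \<mu> = (THE X. X \<in> tspace A p \<and> (\<forall>Y\<in>tspace A p. \<Omega> p [X, Y] = \<mu> [Y]))"

definition lcs_jacobi ::
  "('m, 'e::real_normed_vector) chart set \<Rightarrow> ('m, 'e) form \<Rightarrow> ('m, 'e) form \<Rightarrow>
   (('m, 'e) form \<Rightarrow> ('m, 'e) form \<Rightarrow> 'm \<Rightarrow> real) \<times> ('m \<Rightarrow> ('m, 'e) tvec)" where
  "lcs_jacobi A \<Omega> \<omega> =
     (\<lambda>\<mu> \<nu> p. \<Omega> p [flat_inv A \<Omega> p (\<mu> p), flat_inv A \<Omega> p (\<nu> p)],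
      \<lambda>p. flat_inv A \<Omega> p (\<omega> p))"

section \<open>Lie groupoids\<close>

text \<open>The multiplication is a total function whose values outside the composable pairs are
  irrelevant.\<close>
record ('g, 'd, 'm, 'e) groupoid =
  arr :: "('g, 'd) chart set"
  obj :: "('m, 'e) chart set"
  src :: "'g \<Rightarrow> 'm"
  tgt :: "'g \<Rightarrow> 'm"
  idt :: "'m \<Rightarrow> 'g"
  mul :: "'g \<times> 'g \<Rightarrow> 'g"

definition composable :: "('g, 'd, 'm, 'e) groupoid \<Rightarrow> ('g \<times> 'g) set" where
  "composable G = {(g, h). src G g = tgt G h}"

abbreviation arr2 :: "('g, 'd, 'm, 'e) groupoid \<Rightarrow> ('g \<times> 'g, 'd \<times> 'd) chart set" where
  "arr2 G \<equiv> prod_atlas (arr G) (arr G)"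

definition lie_groupoid ::
  "('g::{t2_space,second_countable_topology}, 'd::real_normed_vector,
    'm::{t2_space,second_countable_topology}, 'e::real_normed_vector) groupoid \<Rightarrow> bool" where
  "lie_groupoid G \<longleftrightarrow>
     smooth_atlas (arr G) \<and> smooth_atlas (obj G) \<and>
     surj (src G) \<and> submersion (arr G) (obj G) (src G) \<and>
     surj (tgt G) \<and> submersion (arr G) (obj G) (tgt G) \<and>
     smooth_map (obj G) (arr G) (idt G) \<and>
     smooth_on_sub (arr2 G) (arr G) (composable G) (mul G) \<and>
     (\<forall>x. src G (idt G x) = x \<and> tgt G (idt G x) = x) \<and>
     (\<forall>(g, h)\<in>composable G. src G (mul G (g, h)) = src G h \<and> tgt G (mul G (g, h)) = tgt G g) \<and>
     (\<forall>g h k. (g, h) \<in> composable G \<and> (h, k) \<in> composable G \<longrightarrow>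
        mul G (mul G (g, h), k) = mul G (g, mul G (h, k))) \<and>
     (\<forall>g. mul G (g, idt G (src G g)) = g \<and> mul G (idt G (tgt G g), g) = g) \<and>
     (\<exists>iv. smooth_map (arr G) (arr G) iv \<and>
        (\<forall>g. src G (iv g) = tgt G g \<and> tgt G (iv g) = src G g \<and>
           mul G (g, iv g) = idt G (tgt G g) \<and> mul G (iv g, g) = idt G (src G g)))"

text \<open>The tangent space to the fibre product of composable pairs at a pair: the pairs of
  tangent vectors that are composable in the tangent groupoid.\<close>
definition tspace_comp ::
  "('g, 'd::real_normed_vector, 'm, 'e::real_normed_vector) groupoid \<Rightarrow> 'g \<times> 'g \<Rightarrow> ('g \<times> 'g, 'd \<times> 'd) tvec set" where
  "tspace_comp G p = {Z \<in> tspace (arr2 G) p.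
     tmap (arr G) (obj G) (src G) (fst p) (tmap (arr2 G) (arr G) fst p Z) =
     tmap (arr G) (obj G) (tgt G) (snd p) (tmap (arr2 G) (arr G) snd p Z)}"

definition form_eq_comp ::
  "('g, 'd::real_normed_vector, 'm, 'e::real_normed_vector) groupoid \<Rightarrow> nat \<Rightarrow>
   ('g \<times> 'g, 'd \<times> 'd) form \<Rightarrow> ('g \<times> 'g, 'd \<times> 'd) form \<Rightarrow> bool" where
  "form_eq_comp G k \<mu> \<nu> \<longleftrightarrow> (\<forall>p\<in>composable G. \<forall>Zs. length Zs = k \<and> set Zs \<subseteq> tspace_comp G p \<longrightarrow>
     \<mu> p Zs = \<nu> p Zs)"

abbreviation mul_pullback where
  "mul_pullback G \<equiv> pullback_on (arr2 G) (arr G) (composable G) (mul G)"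
abbreviation pr1_pullback where
  "pr1_pullback G \<equiv> pullback_on (arr2 G) (arr G) (composable G) fst"
abbreviation pr2_pullback where
  "pr2_pullback G \<equiv> pullback_on (arr2 G) (arr G) (composable G) snd"

definition contact_groupoid ::
  "('g::{t2_space,second_countable_topology}, 'd::euclidean_space,
    'm::{t2_space,second_countable_topology}, 'e::real_normed_vector) groupoid \<Rightarrow>
   ('g, 'd) form \<Rightarrow> ('g \<Rightarrow> real) \<Rightarrow> bool" where
  "contact_groupoid G \<eta> \<sigma> \<longleftrightarrow>
     lie_groupoid G \<and> contact_form (arr G) \<eta> \<and> smooth_map (arr G) real_atlas \<sigma> \<and>
     (\<forall>(g, h)\<in>composable G. \<forall>Z\<in>tspace_comp G (g, h).
        \<eta> (mul G (g, h)) [tmap_on (arr2 G) (arr G) (composable G) (mul G) (g, h) Z] =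
        \<eta> g [tmap (arr2 G) (arr G) fst (g, h) Z] + exp (\<sigma> g) * \<eta> h [tmap (arr2 G) (arr G) snd (g, h) Z])"

definition twisted_product :: "('g, 'd, 'm, 'e) groupoid \<Rightarrow> ('g \<Rightarrow> real) \<Rightarrow>
    ('g \<times> real, 'd \<times> real, 'm \<times> real, 'e \<times> real) groupoid" where
  "twisted_product G \<sigma> = \<lparr>
     arr = prod_atlas (arr G) real_atlas,
     obj = prod_atlas (obj G) real_atlas,
     src = (\<lambda>(g, t). (src G g, \<sigma> g + t)),
     tgt = (\<lambda>(h, s). (tgt G h, s)),
     idt = (\<lambda>(x, t). (idt G x, t)),
     mul = (\<lambda>((g, t), (h, s)). (mul G (g, h), t))\<rparr>"

section \<open>The cotangent groupoid\<close>

definition algebroid_fibre ::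
  "('g, 'd::real_normed_vector, 'm, 'e::real_normed_vector) groupoid \<Rightarrow> 'm \<Rightarrow> ('g, 'd) tvec set" where
  "algebroid_fibre G x = {X \<in> tspace (arr G) (idt G x). tmap (arr G) (obj G) (tgt G) (idt G x) X = (\<lambda>_. 0)}"

text \<open>Elements of \<open>A\<^sup>*\<^sub>xG\<close> and of \<open>T\<^sup>*\<^sub>gG\<close> are functions on tangent vectors (elements of
  \<open>A\<^sub>xG\<close> and of \<open>T\<^sub>gG\<close>), and the base point is a separate argument. Covectors are evaluated on
  one-element lists, as forms are.\<close>
definition cot_src ::
  "('g::topological_space, 'd::real_normed_vector, 'm, 'e) groupoid \<Rightarrow> 'g \<Rightarrow>
   (('g, 'd) tvec list \<Rightarrow> real) \<Rightarrow> ('g, 'd) tvec \<Rightarrow> real" where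
  "cot_src G g \<mu> X = \<mu> [tmap_on (arr G) (arr G) {h. tgt G h = src G g} (\<lambda>h. mul G (g, h)) (idt G (src G g)) X]"

definition cot_tgt ::
  "('g::topological_space, 'd::real_normed_vector, 'm, 'e::real_normed_vector) groupoid \<Rightarrow> 'g \<Rightarrow>
   (('g, 'd) tvec list \<Rightarrow> real) \<Rightarrow> ('g, 'd) tvec \<Rightarrow> real" where
  "cot_tgt G h \<nu> X = (let e = idt G (tgt G h) in
     \<nu> [tmap_on (arr G) (arr G) {g. src G g = tgt G h} (\<lambda>g. mul G (g, h)) e
         (X - tmap (obj G) (arr G) (idt G) (tgt G h) (tmap (arr G) (obj G) (src G) e X))])"

definition cot_idt ::
  "('g, 'd::real_normed_vector, 'm, 'e::real_normed_vector) groupoid \<Rightarrow> 'm \<Rightarrow>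
   (('g, 'd) tvec \<Rightarrow> real) \<Rightarrow> ('g, 'd) tvec list \<Rightarrow> real" where
  "cot_idt G x \<mu> Zs = (let Z = hd Zs in
     \<mu> (Z - tmap (obj G) (arr G) (idt G) x (tmap (arr G) (obj G) (tgt G) (idt G x) Z)))"

end

theory Submission
  imports Defs
begin

text \<open>
  Tangent maps are handled through velocities of curves: a tangent map sends the velocity of a curve
  to the velocity of its image, and by the inverse function theorem every vector tangent to a fibre
  of a submersion, or to the space of composable pairs, is the velocity of a curve inside it. So
  the choice of a local extension does not matter.

  A 1-form that vanishes on the tangent spaces of the level sets of a submersion has an exterior
  derivative that vanishes there too. Applied to the multiplicativity of \<open>\<eta>\<close>, this gives that of
  \<open>d\<eta>\<close> and hence i). For ii), iii) and the second half of iv), \<open>- \<omega>\<close> is the pullback of \<open>dt\<close> on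
  \<open>M \<times> \<real>\<close> along the target map, and \<open>\<theta>\<close> is \<open>e\<^sup>\<sigma>\<close> times its pullback along the source map.

  Let \<open>Z\<close> be the vector with \<open>i(Z)\<Omega> = \<omega>\<close>. By i), the unit vector over \<open>v\<close>, the source of \<open>Z\<close>, is
  \<open>\<Omega>\<close>-orthogonal to the Lie algebroid fibre and to all unit vectors. As \<open>\<Omega>\<close> is non-degenerate,
  \<open>v = 0\<close>, so \<open>\<theta>(Z) = 0\<close>, which is \<open>\<Lambda>(\<omega>, \<theta>) = 0\<close>.
\<close>

section \<open>Calculus of smooth functions\<close>

text \<open>The composable pairs carry no charts of their own, so compatibility of \<open>d\<close>
  with pullback is not directly available there. Instead
  \<open>m^*\<eta> - pr1^*\<eta> - e^\<sigma> pr2^*\<eta>\<close> is formed on an open set of the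
  product, with a local extension of the multiplication. It is known to vanish only on vectors
  tangent to the composable pairs, and its exterior derivative must be controlled from that alone.
  The model space of the base is a bare normed space, so the inverse function theorem is applied on
  the side of the arrows only, to a perturbation of the identity built from a right inverse of the
  derivative. Contactness is given as a nowhere vanishing top form; non-degeneracy of \<Omega> has
  to be extracted from sums over permutations. That \<sigma> is multiplicative is derived from the
  equation for \<eta>; without it the twisted product would not be a groupoid. The orthogonality in
  the last step rests on two products in the tangent groupoid: \<open>Z \<oplus> U = Z\<close> for
  the unit vector \<open>U\<close> over the source of \<open>Z\<close>, and
  \<open>u \<oplus> u = u\<close> for every unit vector \<open>u\<close>.\<close>

lemma Ck_on_subset: "Ck_on k S f \<Longrightarrow> T \<subseteq> S \<Longrightarrow> Ck_on k T f"
  by (induction k arbitrary: f) (auto intro: continuous_on_subset)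

lemma Ck_on_continuous:
  assumes "Ck_on k S f"
  shows "continuous_on S f"
proof (cases k)
  case 0
  then show ?thesis using assms by simp
next
  case (Suc k')
  then have "continuous (at x) f" if "x \<in> S" for x
    using assms that differentiable_imp_continuous_within[of f x UNIV] by simp
  then show ?thesis by (simp add: continuous_at_imp_continuous_on)
qed

lemma Ck_on_Suc_imp: "Ck_on (Suc k) S f \<Longrightarrow> Ck_on k S f"
proof (induction k arbitrary: f)
  case 0
  then show ?case using Ck_on_continuous[of "Suc 0"] by simp
next
  case (Suc k)
  then show ?case by (metis Ck_on.simps(2))
qed

lemma Ck_on_cong:
  assumes "Ck_on k S f" "open S" "\<And>x. x \<in> S \<Longrightarrow> f x = g x"
  shows "Ck_on k S g"
  using assms
proof (induction k arbitrary: f g)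
  case 0
  then show ?case by (metis Ck_on.simps(1) continuous_on_cong)
next
  case (Suc k)
  have d: "f differentiable (at x)" if "x \<in> S" for x
    using Suc that by auto
  have g: "frechet_derivative f (at x) = frechet_derivative g (at x)" if "x \<in> S" for x
    using d[OF that] Suc.prems(2) that Suc.prems(3) by (rule frechet_derivative_transform_within_open)
  have "g differentiable (at x)" if "x \<in> S" for x
    using d[OF that] Suc.prems(2) that Suc.prems(3)
    by (meson differentiable_def has_derivative_transform_within_open)
  moreover have "Ck_on k S (\<lambda>x. frechet_derivative g (at x) v)" for v
    by (rule Suc.IH[of "\<lambda>x. frechet_derivative f (at x) v"]) (use Suc.prems g in auto)
  ultimately show ?case by simp
qed

text \<open>The intermediate chart of a composite of manifold maps depends on the point, so
  smoothness on a whole coordinate domain has to be assembled from neighbourhoods.\<close>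

lemma Ck_on_local:
  assumes "\<And>x. x \<in> S \<Longrightarrow> \<exists>T. open T \<and> x \<in> T \<and> Ck_on k T f"
  shows "Ck_on k S f"
  using assms
proof (induction k arbitrary: f)
  case 0
  have "continuous (at x) f" if x: "x \<in> S" for x
  proof -
    obtain T where "open T" "x \<in> T" "Ck_on 0 T f" using 0 x by blast
    then show ?thesis by (auto simp: continuous_on_eq_continuous_at)
  qed
  then show ?case by (simp add: continuous_at_imp_continuous_on)
next
  case (Suc k)
  have "f differentiable (at x)" if "x \<in> S" for x using Suc.prems[OF that] by auto
  moreover have "Ck_on k S (\<lambda>x. frechet_derivative f (at x) v)" for v
    by (rule Suc.IH) (use Suc.prems in force)
  ultimately show ?case by simp
qed

lemma Ck_on_SucI:
  assumes "open S" "\<And>x. x \<in> S \<Longrightarrow> (f has_derivative f' x) (at x)"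
    and "\<And>v. Ck_on k S (\<lambda>x. f' x v)"
  shows "Ck_on (Suc k) S f"
proof -
  have "f' x = frechet_derivative f (at x)" if "x \<in> S" for x
    using assms(2)[OF that] by (rule frechet_derivative_at)
  then have "Ck_on k S (\<lambda>x. frechet_derivative f (at x) v)" for v
    using Ck_on_cong[OF assms(3)[of v] assms(1)] by auto
  then show ?thesis using assms(2) by (auto simp: differentiable_def)
qed

lemma Ck_on_SucD:
  assumes "Ck_on (Suc k) S f" "x \<in> S"
  shows "(f has_derivative frechet_derivative f (at x)) (at x)"
  using assms by (simp add: frechet_derivative_works[symmetric])

lemma Ck_on_const: "open S \<Longrightarrow> Ck_on k S (\<lambda>x. c)"
proof (induction k arbitrary: c)
  case (Suc k)
  show ?case by (rule Ck_on_SucI[OF Suc.prems, where f' = "\<lambda>x v. 0"]) (use Suc in auto)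
qed simp

lemma Ck_on_bounded_linear:
  assumes "bounded_linear L" "open S"
  shows "Ck_on k S L"
proof (cases k)
  case 0
  then show ?thesis using assms by (simp add: linear_continuous_on)
next
  case (Suc k')
  show ?thesis unfolding Suc
    by (rule Ck_on_SucI[OF assms(2), where f' = "\<lambda>x. L"])
      (use assms in \<open>auto intro: bounded_linear_imp_has_derivative Ck_on_const\<close>)
qed

lemma Ck_on_add:
  assumes "Ck_on k S f" "Ck_on k S g" "open S"
  shows "Ck_on k S (\<lambda>x. f x + g x)"
  using assms
proof (induction k arbitrary: f g)
  case 0
  then show ?case by (auto intro: continuous_on_add)
next
  case (Suc k)
  show ?case
    by (rule Ck_on_SucI[OF Suc.prems(3),
          where f' = "\<lambda>x v. frechet_derivative f (at x) v + frechet_derivative g (at x) v"])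
      (use Suc in \<open>auto intro!: has_derivative_add simp: frechet_derivative_works[symmetric]\<close>)
qed

lemma Ck_on_sum:
  assumes "\<And>i. i \<in> I \<Longrightarrow> Ck_on k S (f i)" "open S"
  shows "Ck_on k S (\<lambda>x. \<Sum>i\<in>I. f i x)"
  using assms
  by (induction I rule: infinite_finite_induct) (auto intro: Ck_on_const Ck_on_add)

text \<open>The derivative is a sum of two products, each with one differentiated factor and one
  whose order is lowered from \<open>Suc k\<close> to \<open>k\<close>; hence both factors vary in
  the induction.\<close>

lemma Ck_on_bilinear:
  assumes "bounded_bilinear pr" "Ck_on k S f" "Ck_on k S g" "open S"
  shows "Ck_on k S (\<lambda>x. pr (f x) (g x))"
  using assms(2-4)
proof (induction k arbitrary: f g)
  case 0
  then show ?case using bounded_bilinear.continuous_on[OF assms(1)] by auto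
next
  case (Suc k)
  show ?case
  proof (rule Ck_on_SucI[OF Suc.prems(3), where f' = "\<lambda>x v. pr (f x) (frechet_derivative g (at x) v)
        + pr (frechet_derivative f (at x) v) (g x)"])
    show "((\<lambda>x. pr (f x) (g x)) has_derivative (\<lambda>v. pr (f x) (frechet_derivative g (at x) v)
        + pr (frechet_derivative f (at x) v) (g x))) (at x)" if "x \<in> S" for x
      by (rule bounded_bilinear.FDERIV[OF assms(1) Ck_on_SucD[OF Suc.prems(1) that]
        Ck_on_SucD[OF Suc.prems(2) that]])
    show "Ck_on k S (\<lambda>x. pr (f x) (frechet_derivative g (at x) v)
        + pr (frechet_derivative f (at x) v) (g x))" for v
      using Suc.prems(1,2) Ck_on_Suc_imp[OF Suc.prems(1)] Ck_on_Suc_imp[OF Suc.prems(2)] Suc.prems(3)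
      by (intro Ck_on_add Suc.IH) simp_all
  qed
qed

lemma Ck_on_Pair:
  assumes "Ck_on k S f" "Ck_on k S g" "open S"
  shows "Ck_on k S (\<lambda>x. (f x, g x))"
  using assms
proof (induction k arbitrary: f g)
  case 0
  then show ?case by (auto intro: continuous_on_Pair)
next
  case (Suc k)
  show ?case
    by (rule Ck_on_SucI[OF Suc.prems(3),
          where f' = "\<lambda>x v. (frechet_derivative f (at x) v, frechet_derivative g (at x) v)"])
      (use Suc in \<open>auto intro!: has_derivative_Pair simp: frechet_derivative_works[symmetric]\<close>)
qed

text \<open>\<open>Ck_on\<close> controls derivatives in fixed directions. Expansion along the basis
  is what passes to moving directions, here and in the level set argument.\<close>

lemma linear_euclidean_expand:
  fixes L :: "'a::euclidean_space \<Rightarrow> 'b::real_vector"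
  assumes "linear L"
  shows "L w = (\<Sum>b\<in>Basis. (w \<bullet> b) *\<^sub>R L b)"
  by (metis (mono_tags, lifting) assms euclidean_representation linear_scale linear_sum sum.cong)

text \<open>The chain rule evaluates the derivative of \<open>g\<close> in a direction that moves
  with \<open>x\<close>, while the induction hypothesis covers fixed directions. The basis expansion
  separates the two, which is why the middle space is Euclidean.\<close>

lemma Ck_on_compose:
  fixes f :: "'a::real_normed_vector \<Rightarrow> 'b::euclidean_space" and g :: "'b \<Rightarrow> 'c::real_normed_vector"
  assumes "Ck_on k S f" "Ck_on k T g" "open S" "f ` S \<subseteq> T"
  shows "Ck_on k S (\<lambda>x. g (f x))"
  using assms
proof (induction k arbitrary: g)
  case 0
  then show ?case by (auto intro: continuous_on_compose2)
next
  case (Suc k)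
  have dg: "(g has_derivative frechet_derivative g (at (f x))) (at (f x))" if "x \<in> S" for x
    using Ck_on_SucD[OF Suc.prems(2)] that Suc.prems(4) by blast
  have exp: "frechet_derivative g (at (f x)) w = (\<Sum>b\<in>Basis. (w \<bullet> b) *\<^sub>R frechet_derivative g (at (f x)) b)"
    if "x \<in> S" for x w
    using linear_euclidean_expand has_derivative_linear[OF dg[OF that]] by blast
  have f: "Ck_on k S (\<lambda>x. frechet_derivative f (at x) v \<bullet> b)" for v b
    by (rule Ck_on_bilinear[OF bounded_bilinear_inner])
      (use Suc.prems in \<open>auto intro: Ck_on_const\<close>)
  have g: "Ck_on k S (\<lambda>x. frechet_derivative g (at (f x)) b)" for b
    by (rule Suc.IH[OF Ck_on_Suc_imp[OF Suc.prems(1)]]) (use Suc.prems in simp_all)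
  show ?case
  proof (rule Ck_on_SucI[OF Suc.prems(3),
        where f' = "\<lambda>x v. frechet_derivative g (at (f x)) (frechet_derivative f (at x) v)"])
    show "((\<lambda>x. g (f x)) has_derivative (\<lambda>v. frechet_derivative g (at (f x)) (frechet_derivative f
      (at x) v))) (at x)"
      if "x \<in> S" for x
      using has_derivative_compose[OF Ck_on_SucD[OF Suc.prems(1) that] dg[OF that]] .
    have "Ck_on k S (\<lambda>x. \<Sum>b\<in>Basis. (frechet_derivative f (at x) v \<bullet> b) *\<^sub>R frechet_derivative g
      (at (f x)) b)" for v
      by (intro Ck_on_sum Ck_on_bilinear[OF bounded_bilinear_scaleR] f g Suc.prems)
    then show "Ck_on k S (\<lambda>x. frechet_derivative g (at (f x)) (frechet_derivative f (at x) v))" for v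
      by (rule Ck_on_cong[OF _ Suc.prems(3)]) (rule exp[symmetric])
  qed
qed

lemma Cinf_onD: "Cinf_on S f \<Longrightarrow> Ck_on k S f"
  by (simp add: Cinf_on_def)

lemma Cinf_on_subset: "Cinf_on S f \<Longrightarrow> T \<subseteq> S \<Longrightarrow> Cinf_on T f"
  unfolding Cinf_on_def by (blast intro: Ck_on_subset)

lemma Cinf_on_cong: "Cinf_on S f \<Longrightarrow> open S \<Longrightarrow> (\<And>x. x \<in> S \<Longrightarrow> f x = g x) \<Longrightarrow> Cinf_on S g"
  unfolding Cinf_on_def by (intro allI Ck_on_cong[of _ S f g]) simp_all

lemma Cinf_on_local:
  "(\<And>x. x \<in> S \<Longrightarrow> \<exists>T. open T \<and> x \<in> T \<and> Cinf_on T f) \<Longrightarrow> Cinf_on S f"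
  unfolding Cinf_on_def by (rule allI, rule Ck_on_local) blast

lemma Cinf_on_bounded_linear: "bounded_linear L \<Longrightarrow> open S \<Longrightarrow> Cinf_on S L"
  by (simp add: Cinf_on_def Ck_on_bounded_linear)

lemma Cinf_on_const: "open S \<Longrightarrow> Cinf_on S (\<lambda>x. c)"
  by (simp add: Cinf_on_def Ck_on_const)

lemma Cinf_on_add: "Cinf_on S f \<Longrightarrow> Cinf_on S g \<Longrightarrow> open S \<Longrightarrow> Cinf_on S (\<lambda>x. f x + g x)"
  by (simp add: Cinf_on_def Ck_on_add)

lemma Cinf_on_Pair: "Cinf_on S f \<Longrightarrow> Cinf_on S g \<Longrightarrow> open S \<Longrightarrow> Cinf_on S (\<lambda>x. (f x, g x))"
  by (simp add: Cinf_on_def Ck_on_Pair)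

lemma Cinf_on_compose:
  fixes f :: "'a::real_normed_vector \<Rightarrow> 'b::euclidean_space"
  shows "Cinf_on S f \<Longrightarrow> Cinf_on T g \<Longrightarrow> open S \<Longrightarrow> f ` S \<subseteq> T \<Longrightarrow> Cinf_on S (\<lambda>x. g (f x))"
  unfolding Cinf_on_def by (intro allI Ck_on_compose[of _ S f T g]) simp_all

lemma Cinf_on_has_derivative:
  "Cinf_on S f \<Longrightarrow> x \<in> S \<Longrightarrow> (f has_derivative frechet_derivative f (at x)) (at x)"
  using Cinf_onD Ck_on_SucD by blast

lemma Cinf_on_frechet: "Cinf_on S f \<Longrightarrow> Cinf_on S (\<lambda>x. frechet_derivative f (at x) v)"
  by (metis Cinf_on_def Ck_on.simps(2))

section \<open>Symmetry of second derivatives\<close>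

text \<open>The mean value inequality is applied in direction \<open>v\<close> to the difference of
  \<open>f\<close> along two parallel segments. This uses the derivative of \<open>f' x v\<close> at
  the single point \<open>p\<close>, so the mixed second difference is \<open>s * s\<close> times
  \<open>D u\<close> up to a smaller error.\<close>

lemma second_difference_estimate:
  fixes f :: "'a::real_normed_vector \<Rightarrow> 'b::real_normed_vector"
  assumes U: "open U" "p \<in> U"
    and f': "\<And>x. x \<in> U \<Longrightarrow> (f has_derivative f' x) (at x)"
    and f'': "((\<lambda>x. f' x v) has_derivative D) (at p)"
    and e: "e > 0"
  shows "\<exists>d>0. \<forall>s. 0 < s \<and> s < d \<longrightarrow>
     norm (f (p + s *\<^sub>R u + s *\<^sub>R v) - f (p + s *\<^sub>R u) - f (p + s *\<^sub>R v) + f p - (s * s) *\<^sub>R D u) \<le> e * (s * s)"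
proof -
  interpret D: bounded_linear D using f'' by (rule has_derivative_bounded_linear)
  \<comment> \<open>All points of the parallelogram spanned by \<open>s u\<close> and
    \<open>s v\<close> lie within \<open>s * K\<close> of \<open>p\<close>; the summand 1 keeps
    \<open>K\<close> positive and the bound strict when \<open>u = v = 0\<close>.\<close>
  define K where "K = 2 * (norm u + norm v) + 1"
  have K: "K > 0" by (simp add: K_def add_nonneg_pos)
  \<comment> \<open>For each \<open>t\<close> this tolerance is used at two points, one on each
    segment; each contributes \<open>e / 2 * s\<close>, together \<open>e * s\<close>.\<close>
  obtain d1 where d1: "d1 > 0" "\<And>y. norm (y - p) < d1 \<Longrightarrow>
      norm (f' y v - f' p v - D (y - p)) \<le> e / (2 * K) * norm (y - p)"
    using f'' e K unfolding has_derivative_at_alt by (metis divide_pos_pos mult_pos_pos zero_less_numeral)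
  obtain d2 where d2: "d2 > 0" "ball p d2 \<subseteq> U" using U by (meson openE)
  define d where "d = min d1 d2 / K"
  have d: "d > 0" using d1 d2 K by (simp add: d_def)
  have "norm (f (p + s *\<^sub>R u + s *\<^sub>R v) - f (p + s *\<^sub>R u) - f (p + s *\<^sub>R v) + f p - (s * s) *\<^sub>R D
    u) \<le> e * (s * s)"
    if s: "0 < s" "s < d" for s
  proof -
    have sK: "s * K < d1" "s * K < d2"
      using s K by (auto simp: d_def min_def field_simps split: if_splits)
    \<comment> \<open>The expected value \<open>D u\<close> is subtracted beforehand, so
      \<open>h 1 - h 0\<close> is the error itself and the derivative of \<open>h\<close> is
      small.\<close>
    define h where "h t = f (p + s *\<^sub>R u + (t * s) *\<^sub>R v) - f (p + (t * s) *\<^sub>R v) - (t * s * s) *\<^sub>R D u" for t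
    have n1: "norm ((a * s) *\<^sub>R u + (t * s) *\<^sub>R v) \<le> s * (norm u + norm v)" if "t \<in> {0..1}" "a \<in> {0..1}" for t a
    proof -
      have "norm ((a * s) *\<^sub>R u + (t * s) *\<^sub>R v) \<le> a * s * norm u + t * s * norm v"
        using s that by (intro norm_triangle_le) auto
      also have "\<dots> \<le> 1 * s * norm u + 1 * s * norm v"
        using that s by (intro add_mono mult_right_mono) auto
      finally show ?thesis by (simp add: algebra_simps)
    qed
    have nK: "s * (norm u + norm v) < s * K" using s by (simp add: K_def add_nonneg_pos)
    have n2: "norm ((a * s) *\<^sub>R u + (t * s) *\<^sub>R v) < s * K" if "t \<in> {0..1}" "a \<in> {0..1}" for t a
      using n1[OF that] nK by linarith
    have inU: "p + (a * s) *\<^sub>R u + (t * s) *\<^sub>R v \<in> U" if "t \<in> {0..1}" "a \<in> {0..1}" for t a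
    proof -
      have "dist p (p + (a * s) *\<^sub>R u + (t * s) *\<^sub>R v) < d2"
        using n2[OF that] sK norm_minus_commute[of p "p + (a * s) *\<^sub>R u + (t * s) *\<^sub>R v"]
        by (simp add: dist_norm algebra_simps)
      then show ?thesis using d2 by auto
    qed
    have est: "norm (f' (p + (a * s) *\<^sub>R u + (t * s) *\<^sub>R v) v - f' p v - D ((a * s) *\<^sub>R u + (t * s) *\<^sub>R v))
       \<le> e / (2 * K) * (s * K)" if "t \<in> {0..1}" "a \<in> {0..1}" for t a
    proof -
      have "norm ((p + (a * s) *\<^sub>R u + (t * s) *\<^sub>R v) - p) < d1"
        using n2[OF that] sK by (simp add: algebra_simps)
      from d1(2)[OF this] have "norm (f' (p + (a * s) *\<^sub>R u + (t * s) *\<^sub>R v) v - f' p v - D ((a *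
        s) *\<^sub>R u + (t * s) *\<^sub>R v))
         \<le> e / (2 * K) * norm ((a * s) *\<^sub>R u + (t * s) *\<^sub>R v)" by (simp add: algebra_simps)
      also have "\<dots> \<le> e / (2 * K) * (s * K)"
        using n2[OF that] e K by (intro mult_left_mono) auto
      finally show ?thesis .
    qed
    have lin: "f' x (r *\<^sub>R v) = r *\<^sub>R f' x v" if "x \<in> U" for x r
      using linear_scale[OF has_derivative_linear[OF f'[OF that]]] .
    have hd: "(h has_derivative (\<lambda>r. r *\<^sub>R (s *\<^sub>R (f' (p + s *\<^sub>R u + (t * s) *\<^sub>R v) v - f' (p + (t
      * s) *\<^sub>R v) v - s *\<^sub>R D u))))
       (at t within {0..1})" if t: "t \<in> {0..1}" for t
    proof -
      have 1: "p + s *\<^sub>R u + (t * s) *\<^sub>R v \<in> U" using inU[OF t, of 1] by simp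
      have 2: "p + (t * s) *\<^sub>R v \<in> U" using inU[OF t, of 0] by simp
      have c1: "((\<lambda>t. f (p + s *\<^sub>R u + (t * s) *\<^sub>R v)) has_derivative (\<lambda>r. f' (p + s *\<^sub>R u + (t *
        s) *\<^sub>R v) ((r * s) *\<^sub>R v))) (at t)"
        by (rule has_derivative_compose[where g = f and f =
          "\<lambda>t. p + s *\<^sub>R u + (t * s) *\<^sub>R v", OF _ f'[OF 1]]) (auto intro!: derivative_eq_intros)
      have c2: "((\<lambda>t. f (p + (t * s) *\<^sub>R v)) has_derivative (\<lambda>r. f' (p + (t * s) *\<^sub>R v) ((r * s)
        *\<^sub>R v))) (at t)"
        by (rule has_derivative_compose[where g = f and f =
          "\<lambda>t. p + (t * s) *\<^sub>R v", OF _ f'[OF 2]]) (auto intro!: derivative_eq_intros)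
      have c3: "((\<lambda>t. (t * s * s) *\<^sub>R D u) has_derivative (\<lambda>r. (r * s * s) *\<^sub>R D u)) (at t)"
        by (auto intro!: derivative_eq_intros)
      have "(h has_derivative (\<lambda>r. f' (p + s *\<^sub>R u + (t * s) *\<^sub>R v) ((r * s) *\<^sub>R v)
          - f' (p + (t * s) *\<^sub>R v) ((r * s) *\<^sub>R v) - (r * s * s) *\<^sub>R D u)) (at t)"
        unfolding h_def by (intro has_derivative_diff c1 c2 c3)
      moreover have "(\<lambda>r. f' (p + s *\<^sub>R u + (t * s) *\<^sub>R v) ((r * s) *\<^sub>R v)
          - f' (p + (t * s) *\<^sub>R v) ((r * s) *\<^sub>R v) - (r * s * s) *\<^sub>R D u)
          = (\<lambda>r. r *\<^sub>R (s *\<^sub>R (f' (p + s *\<^sub>R u + (t * s) *\<^sub>R v) v - f' (p + (t * s) *\<^sub>R v) v - s *\<^sub>R D u)))"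
        by (simp only: lin[OF 1] lin[OF 2]) (simp add: algebra_simps)
      ultimately show ?thesis by (simp add: has_derivative_at_withinI)
    qed
    have "norm (h 1 - h 0) \<le> (e * (s * s)) * norm (1 - 0 :: real)"
    proof (rule differentiable_bound[OF _ hd])
      fix t :: real assume t: "t \<in> {0..1}"
      define X where "X = f' (p + s *\<^sub>R u + (t * s) *\<^sub>R v) v - f' (p + (t * s) *\<^sub>R v) v - s *\<^sub>R D u"
      have "norm X = norm ((f' (p + (1 * s) *\<^sub>R u + (t * s) *\<^sub>R v) v - f' p v - D ((1 * s) *\<^sub>R u +
        (t * s) *\<^sub>R v))
           - (f' (p + (0 * s) *\<^sub>R u + (t * s) *\<^sub>R v) v - f' p v - D ((0 * s) *\<^sub>R u + (t * s) *\<^sub>R v)))"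
        by (simp add: X_def D.add D.scaleR algebra_simps)
      also have "\<dots> \<le> e / (2 * K) * (s * K) + e / (2 * K) * (s * K)"
        by (rule order_trans[OF norm_triangle_ineq4 add_mono]) (rule est[OF t]; simp)+
      also have "\<dots> = e * s" using K by (simp add: field_simps)
      finally have X: "norm X \<le> e * s" .
      show "onorm (\<lambda>r::real. r *\<^sub>R (s *\<^sub>R X)) \<le> e * (s * s)"
        unfolding X_def[symmetric]
      proof (rule onorm_le)
        show "norm (r *\<^sub>R (s *\<^sub>R X)) \<le> e * (s * s) * norm r" for r :: real
          using mult_left_mono[OF X, of "\<bar>r\<bar> * s"] s by (simp add: algebra_simps abs_mult)
      qed
    qed auto
    moreover have "h 1 - h 0 = f (p + s *\<^sub>R u + s *\<^sub>R v) - f (p + s *\<^sub>R u) - f (p + s *\<^sub>R v) + f p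
      - (s * s) *\<^sub>R D u"
      by (simp add: h_def algebra_simps)
    ultimately show ?thesis by simp
  qed
  then show ?thesis using d by blast
qed

text \<open>Exchanging \<open>u\<close> and \<open>v\<close> does not change the second difference,
  which after division by \<open>s * s\<close> is arbitrarily close to both sides.\<close>

lemma second_derivative_symmetric:
  fixes f :: "'a::real_normed_vector \<Rightarrow> 'b::real_normed_vector"
  assumes U: "open U" "p \<in> U"
    and f': "\<And>x. x \<in> U \<Longrightarrow> (f has_derivative f' x) (at x)"
    and Dv: "((\<lambda>x. f' x v) has_derivative Dv) (at p)"
    and Du: "((\<lambda>x. f' x u) has_derivative Du) (at p)"
  shows "Dv u = Du v"
proof -
  have "norm (Dv u - Du v) \<le> e" if "e > 0" for e
  proof -
    obtain d1 where d1: "d1 > 0" "\<And>s. 0 < s \<and> s < d1 \<Longrightarrow>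
       norm (f (p + s *\<^sub>R u + s *\<^sub>R v) - f (p + s *\<^sub>R u) - f (p + s *\<^sub>R v) + f p - (s * s) *\<^sub>R Dv
         u) \<le> e/2 * (s * s)"
      using second_difference_estimate[OF U f' Dv, of "e/2" u] \<open>e > 0\<close> by auto
    obtain d2 where d2: "d2 > 0" "\<And>s. 0 < s \<and> s < d2 \<Longrightarrow>
       norm (f (p + s *\<^sub>R v + s *\<^sub>R u) - f (p + s *\<^sub>R v) - f (p + s *\<^sub>R u) + f p - (s * s) *\<^sub>R Du
         v) \<le> e/2 * (s * s)"
      using second_difference_estimate[OF U f' Du, of "e/2" v] \<open>e > 0\<close> by auto
    obtain s where s: "0 < s" "s < d1" "s < d2"
      using d1 d2 by (metis field_lbound_gt_zero)
    let ?A = "f (p + s *\<^sub>R u + s *\<^sub>R v) - f (p + s *\<^sub>R u) - f (p + s *\<^sub>R v) + f p"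
    have "f (p + s *\<^sub>R v + s *\<^sub>R u) - f (p + s *\<^sub>R v) - f (p + s *\<^sub>R u) + f p = ?A"
      by (simp add: algebra_simps)
    then have "norm (?A - (s * s) *\<^sub>R Du v) \<le> e/2 * (s * s)" using d2(2)[of s] s by metis
    moreover have "norm (?A - (s * s) *\<^sub>R Dv u) \<le> e/2 * (s * s)" using d1(2)[of s] s by simp
    ultimately have "norm ((?A - (s * s) *\<^sub>R Du v) - (?A - (s * s) *\<^sub>R Dv u)) \<le> e/2 * (s * s) + e/2 * (s * s)"
      by (rule order_trans[OF norm_triangle_ineq4 add_mono])
    moreover have "(?A - (s * s) *\<^sub>R Du v) - (?A - (s * s) *\<^sub>R Dv u) = (s * s) *\<^sub>R (Dv u - Du v)"
      by (simp add: algebra_simps)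
    ultimately have "norm ((s * s) *\<^sub>R (Dv u - Du v)) \<le> e/2 * (s * s) + e/2 * (s * s)" by metis
    then have "(s * s) * norm (Dv u - Du v) \<le> (s * s) * e"
      by (simp only: norm_scaleR) (use s in simp)
    then show ?thesis using s by simp
  qed
  then have "norm (Dv u - Du v) \<le> 0" by (rule field_le_epsilon[of _ 0, simplified])
  then show ?thesis by simp
qed

section \<open>Level sets of submersions\<close>

text \<open>Used for a curve whose derivative arises as a limit of difference quotients and not from
  a differentiation rule.\<close>

lemma has_vector_derivative_at_0_iff:
  "(g has_vector_derivative d) (at 0) \<longleftrightarrow> ((\<lambda>s. (g s - g 0) /\<^sub>R s) \<longlongrightarrow> d) (at 0)"
proof -
  have "(g has_vector_derivative d) (at 0) \<longleftrightarrow> ((\<lambda>s. norm (g s - g 0 - s *\<^sub>R d) / norm s) \<longlongrightarrow> 0) (at 0)"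
    unfolding has_vector_derivative_def has_derivative_at by (simp add: bounded_linear_scaleR_left)
  also have "\<dots> \<longleftrightarrow> ((\<lambda>s. norm ((g s - g 0) /\<^sub>R s - d)) \<longlongrightarrow> 0) (at 0)"
  proof (rule filterlim_cong[OF refl refl])
    show "\<forall>\<^sub>F s in at 0. norm (g s - g 0 - s *\<^sub>R d) / norm s = norm ((g s - g 0) /\<^sub>R s - d)"
      unfolding eventually_at_filter
    proof (rule always_eventually, intro allI impI)
      fix s :: real assume s: "s \<noteq> 0"
      have "(g s - g 0) /\<^sub>R s - d = (g s - g 0 - s *\<^sub>R d) /\<^sub>R s"
        using s by (simp add: algebra_simps)
      then show "norm (g s - g 0 - s *\<^sub>R d) / norm s = norm ((g s - g 0) /\<^sub>R s - d)"
        by (simp add: divide_inverse mult.commute)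
    qed
  qed
  also have "\<dots> \<longleftrightarrow> ((\<lambda>s. (g s - g 0) /\<^sub>R s) \<longlongrightarrow> d) (at 0)"
    by (simp add: tendsto_norm_zero_iff LIM_zero_iff)
  finally show ?thesis .
qed

text \<open>A Leibniz rule for a family of linear maps that is known to be differentiable only for
  each fixed argument; the moving argument is expanded along the basis.\<close>

lemma has_derivative_linear_family:
  fixes lam :: "'c::real_normed_vector \<Rightarrow> 'a::euclidean_space \<Rightarrow> 'b::real_normed_vector"
  assumes L: "\<And>w. ((\<lambda>x. lam x w) has_derivative L w) (at x)"
    and W: "(W has_derivative W') (at x)"
    and lin: "open U" "x \<in> U" "\<And>y. y \<in> U \<Longrightarrow> linear (lam y)"
  shows "((\<lambda>y. lam y (W y)) has_derivative (\<lambda>h. lam x (W' h) + L (W x) h)) (at x)"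
proof -
  \<comment> \<open>The hypotheses do not state that \<open>L w\<close> is linear in
    \<open>w\<close>. Differentiating the expansion of \<open>lam y w\<close> and comparing
    derivatives yields it.\<close>
  have "((\<lambda>y. \<Sum>b\<in>Basis. (w \<bullet> b) *\<^sub>R lam y b) has_derivative (\<lambda>h. \<Sum>b\<in>Basis. (w \<bullet> b) *\<^sub>R L b h)) (at x)" for w
    by (intro has_derivative_sum has_derivative_scaleR_right L)
  then have "((\<lambda>y. lam y w) has_derivative (\<lambda>h. \<Sum>b\<in>Basis. (w \<bullet> b) *\<^sub>R L b h)) (at x)" for w
    by (rule has_derivative_transform_within_open[OF _ lin(1,2)])
      (use lin(3) linear_euclidean_expand in metis)
  then have L_eq: "L w = (\<lambda>h. \<Sum>b\<in>Basis. (w \<bullet> b) *\<^sub>R L b h)" for w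
    using L has_derivative_unique by blast
  have "((\<lambda>y. \<Sum>b\<in>Basis. (W y \<bullet> b) *\<^sub>R lam y b) has_derivative
      (\<lambda>h. \<Sum>b\<in>Basis. (W x \<bullet> b) *\<^sub>R L b h + (W' h \<bullet> b) *\<^sub>R lam x b)) (at x)"
    by (intro has_derivative_sum has_derivative_scaleR L has_derivative_inner_left W)
  moreover have "(\<Sum>b\<in>Basis. (W x \<bullet> b) *\<^sub>R L b h + (W' h \<bullet> b) *\<^sub>R lam x b) = lam x (W' h) + L (W x) h" for h
    unfolding sum.distrib linear_euclidean_expand[OF lin(3)[OF lin(2)], of "W' h"]
      fun_cong[OF L_eq[of "W x"], of h] by (rule add.commute)
  ultimately have "((\<lambda>y. \<Sum>b\<in>Basis. (W y \<bullet> b) *\<^sub>R lam y b) has_derivative (\<lambda>h. lam x (W' h) + L (W x) h)) (at x)"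
    by simp
  then show ?thesis
    by (rule has_derivative_transform_within_open[OF _ lin(1,2)])
      (use lin(3) linear_euclidean_expand in metis)
qed

section \<open>Parametrisation of level sets\<close>

text \<open>\<open>D\<close> is inverted on the orthogonal complement \<open>V\<close> of its
  kernel. As the codomain is only a normed space, boundedness of the inverse is proved by hand: on
  the compact unit sphere of \<open>V\<close> the norm of \<open>D z\<close> has a positive
  minimum.\<close>

lemma bounded_linear_right_inverse:
  fixes D :: "'a::euclidean_space \<Rightarrow> 'b::real_normed_vector"
  assumes D: "bounded_linear D" and "surj D"
  shows "\<exists>R. bounded_linear R \<and> (\<forall>y. D (R y) = y)"
proof -
  interpret D: bounded_linear D by fact
  define S where "S = {w. D w = 0}"
  define V where "V = {z. \<forall>w\<in>S. orthogonal z w}"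
  have sS: "subspace S" unfolding S_def by (auto simp: subspace_def D.add D.scaleR D.zero)
  have sV: "subspace V"
    by (auto simp: subspace_def V_def orthogonal_clauses)
  have zero: "z = 0" if "z \<in> V" "D z = 0" for z
    using that by (auto simp: V_def S_def orthogonal_def)
  have inj: "inj_on D V"
  proof (rule inj_onI)
    fix x y assume "x \<in> V" "y \<in> V" "D x = D y"
    then have "x - y \<in> V" "D (x - y) = 0" using sV subspace_diff D.diff by auto
    then show "x = y" using zero[of "x - y"] by simp
  qed
  obtain g where g: "range g \<subseteq> V" "linear g" "\<And>v. v \<in> V \<Longrightarrow> g (D v) = v"
    using linear_exists_left_inverse_on[OF bounded_linear.linear[OF D] sV inj] by auto
  have Dg: "D (g y) = y" for y
  proof -
    obtain x where x: "y = D x" using \<open>surj D\<close> by (metis surjD)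
    obtain a z where az: "a \<in> span S" "\<And>w. w \<in> span S \<Longrightarrow> orthogonal z w" "x = a + z"
      using orthogonal_subspace_decomp_exists by blast
    have "D a = 0" using az sS by (simp add: span_eq_iff[THEN iffD2] S_def)
    moreover have "z \<in> V" using az by (auto simp: V_def span_base)
    ultimately show ?thesis using g(3)[of z] x az by (simp add: D.add)
  qed
  have "\<exists>m>0. \<forall>z\<in>V. m * norm z \<le> norm (D z)"
  proof (cases "V \<inter> sphere 0 1 = {}")
    case True
    have "z = 0" if "z \<in> V" for z
    proof (rule ccontr)
      assume "z \<noteq> 0"
      then have "z /\<^sub>R norm z \<in> V \<inter> sphere 0 1" using that sV by (simp add: subspace_scale)
      then show False using True by auto
    qed
    then show ?thesis by (metis D.zero mult_zero_right norm_zero order_refl zero_less_one)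
  next
    case False
    have "compact (V \<inter> sphere 0 1)"
      using closed_subspace[OF sV] by (simp add: closed_Int_compact)
    moreover have "continuous_on (V \<inter> sphere 0 1) (\<lambda>z. norm (D z))"
      by (intro continuous_on_norm linear_continuous_on D)
    ultimately obtain z0 where z0: "z0 \<in> V \<inter> sphere 0 1"
      "\<And>z. z \<in> V \<inter> sphere 0 1 \<Longrightarrow> norm (D z0) \<le> norm (D z)"
      using continuous_attains_inf[OF _ False] by metis
    have "D z0 \<noteq> 0" using z0(1) zero by fastforce
    moreover have "norm (D z0) * norm z \<le> norm (D z)" if "z \<in> V" for z
    proof (cases "z = 0")
      case False
      then have "z /\<^sub>R norm z \<in> V \<inter> sphere 0 1" using that sV by (simp add: subspace_scale)
      from z0(2)[OF this] show ?thesis using False by (simp add: D.scaleR field_simps)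
    qed simp
    ultimately show ?thesis by (metis zero_less_norm_iff)
  qed
  then obtain m where m: "m > 0" "\<And>z. z \<in> V \<Longrightarrow> m * norm z \<le> norm (D z)" by auto
  have "norm (g y) \<le> norm y * (1 / m)" for y
    using m(2)[of "g y"] g(1) m(1) Dg[of y] by (auto simp: field_simps)
  then have "bounded_linear g"
    by (intro bounded_linear_intro[where K = "1 / m"]) (auto simp: linear_add[OF g(2)] linear_scale[OF g(2)])
  then show ?thesis using Dg by blast
qed

text \<open>The map \<open>F x = x - R (f' p (x - p)) + R (f x - f p)\<close> has the identity as
  derivative at \<open>p\<close> and satisfies \<open>f' p (F x - p) = f x - f p\<close>. Its local
  inverse \<open>g\<close> therefore takes the affine space \<open>p + ker (f' p)\<close> into the
  level set. The last clause is the inverse relation between the derivatives of \<open>F\<close> and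
  \<open>g\<close>, written out so that \<open>F\<close> stays hidden.\<close>

lemma level_set_parametrization:
  fixes f :: "'a::euclidean_space \<Rightarrow> 'b::real_normed_vector"
  assumes U: "open U" "p \<in> U"
    and f': "\<And>x. x \<in> U \<Longrightarrow> (f has_derivative f' x) (at x)"
    and cont: "\<And>v. continuous_on U (\<lambda>x. f' x v)"
    and R: "bounded_linear R" "\<And>y. f' p (R y) = y"
  obtains V g g' where "open V" "p \<in> V" "g p = p" "\<And>y. y \<in> V \<Longrightarrow> g y \<in> U"
    "\<And>y. y \<in> V \<Longrightarrow> (g has_derivative g' y) (at y)"
    "\<And>y. y \<in> V \<Longrightarrow> f' p (y - p) = 0 \<Longrightarrow> f (g y) = f p"
    "\<And>y w. y \<in> V \<Longrightarrow> g' y w - R (f' p (g' y w)) + R (f' (g y) (g' y w)) = w"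
proof -
  interpret R: bounded_linear R by fact
  have bl: "bounded_linear (f' x)" if "x \<in> U" for x using f'[OF that] has_derivative_bounded_linear by blast
  interpret D: bounded_linear "f' p" using bl U by blast
  define F where "F x = x - R (f' p (x - p)) + R (f x - f p)" for x
  \<comment> \<open>The inverse function theorem expects derivatives as bounded linear functions;
    the value 0 outside \<open>U\<close> is a mere default.\<close>
  define F' where "F' x = (if x \<in> U then Blinfun (\<lambda>w. w - R (f' p w) + R (f' x w)) else 0)" for x
  have blF: "bounded_linear (\<lambda>w. w - R (f' p w) + R (f' x w))" if "x \<in> U" for x
    by (intro bounded_linear_add bounded_linear_sub bounded_linear_ident
        bounded_linear_compose[OF R(1)] bl that U)
  have F': "blinfun_apply (F' x) w = w - R (f' p w) + R (f' x w)" if "x \<in> U" for x w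
    using that blF by (simp add: F'_def bounded_linear_Blinfun_apply)
  have "(F has_derivative (\<lambda>w. w - R (f' p w) + R (f' x w))) (at x)" if "x \<in> U" for x
  proof -
    have "((\<lambda>x. x - p) has_derivative (\<lambda>w. w)) (at x)" by (auto intro!: derivative_eq_intros)
    then have a: "((\<lambda>x. R (f' p (x - p))) has_derivative (\<lambda>w. R (f' p w))) (at x)"
      by (intro R.has_derivative D.has_derivative)
    have b: "((\<lambda>x. R (f x - f p)) has_derivative (\<lambda>w. R (f' x w - 0))) (at x)"
      by (intro R.has_derivative has_derivative_diff f'[OF that] has_derivative_const)
    show ?thesis
      using has_derivative_add[OF has_derivative_diff[OF has_derivative_ident a] b] unfolding F_def by simp
  qed
  then have 1: "(F has_derivative blinfun_apply (F' x)) (at x)" if "x \<in> U" for x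
    using F' that by presburger
  have 2: "continuous_on U F'"
  proof (rule continuous_on_blinfun_componentwise)
    fix i :: 'a
    have "continuous_on U (\<lambda>x. i - R (f' p i) + R (f' x i))"
      by (intro continuous_intros R.continuous_on cont)
    then show "continuous_on U (\<lambda>x. blinfun_apply (F' x) i)"
      by (rule continuous_on_eq) (simp add: F')
  qed
  have "blinfun_apply (F' p) w = w" for w using F' U by simp
  then have 3: "id_blinfun o\<^sub>L F' p = id_blinfun" by (intro blinfun_eqI) simp
  obtain U' V g g' where g: "open U'" "U' \<subseteq> U" "p \<in> U'" "open V" "F p \<in> V" "homeomorphism U' V F g"
    "\<And>y. y \<in> V \<Longrightarrow> (g has_derivative (g' y)) (at y)"
    "\<And>y. y \<in> V \<Longrightarrow> g' y = inv (blinfun_apply (F' (g y)))"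
    "\<And>y. y \<in> V \<Longrightarrow> bij (blinfun_apply (F' (g y)))"
    using inverse_function_theorem[OF U(1) 1 2 U(2) 3] by blast
  have Fp: "F p = p" by (simp add: F_def D.zero R.zero)
  have gU: "g y \<in> U'" if "y \<in> V" for y using g(6) that by (auto simp: homeomorphism_def)
  have Fg: "F (g y) = y" if "y \<in> V" for y using g(6) that by (auto simp: homeomorphism_def)
  have gp: "g p = p" using g(6) g(3) Fp unfolding homeomorphism_def by metis
  show thesis
  proof
    show "open V" "p \<in> V" "g p = p" using g Fp gp by auto
    show "(g has_derivative g' y) (at y)" if "y \<in> V" for y using g that by auto
    show "g y \<in> U" if "y \<in> V" for y using gU g that by auto
    show "f (g y) = f p" if y: "y \<in> V" "f' p (y - p) = 0" for y
    proof -
      have "f' p (F (g y) - p) = f (g y) - f p"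
        by (simp add: F_def D.add D.diff R)
      then show ?thesis using y Fg by simp
    qed
    show "g' y w - R (f' p (g' y w)) + R (f' (g y) (g' y w)) = w" if y: "y \<in> V" for y w
    proof -
      have "g y \<in> U" using y gU g(2) by blast
      moreover have "blinfun_apply (F' (g y)) (g' y w) = w"
        using g(8,9)[OF y] by (simp add: bij_is_surj surj_f_inv_f)
      ultimately show ?thesis using F' by simp
    qed
  qed
qed

lemma eventually_line:
  fixes p v :: "'a::real_normed_vector"
  assumes "open V" "p \<in> V"
  shows "\<forall>\<^sub>F s in nhds 0. p + s *\<^sub>R v \<in> V"
proof -
  have "open ((\<lambda>s. p + s *\<^sub>R v) -` V)"
    by (intro open_vimage assms continuous_intros)
  then show ?thesis using assms(2) eventually_nhds_in_open by fastforce
qed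

text \<open>The line \<open>p + s v\<close> lies in \<open>p + ker (f' p)\<close>; \<open>g\<close>
  bends it into the level set and keeps its velocity, as \<open>g' p\<close> is the
  identity.\<close>

lemma level_set_curve:
  fixes f :: "'a::euclidean_space \<Rightarrow> 'b::real_normed_vector"
  assumes U: "open U" "p \<in> U"
    and f': "\<And>x. x \<in> U \<Longrightarrow> (f has_derivative f' x) (at x)"
    and cont: "\<And>v. continuous_on U (\<lambda>x. f' x v)"
    and surj: "surj (f' p)" and v: "f' p v = 0"
  obtains c where "c 0 = p" "(c has_vector_derivative v) (at 0)"
    "\<forall>\<^sub>F s in nhds 0. c s \<in> U \<and> f (c s) = f p"
proof -
  have bl: "bounded_linear (f' p)" using f'[OF U(2)] has_derivative_bounded_linear by blast
  interpret D: bounded_linear "f' p" by fact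
  obtain R where R: "bounded_linear R" "\<And>y. f' p (R y) = y"
    using bounded_linear_right_inverse[OF bl surj] by blast
  interpret R: bounded_linear R by fact
  obtain V g g' where g: "open V" "p \<in> V" "g p = p" "\<And>y. y \<in> V \<Longrightarrow> g y \<in> U"
    "\<And>y. y \<in> V \<Longrightarrow> (g has_derivative g' y) (at y)"
    "\<And>y. y \<in> V \<Longrightarrow> f' p (y - p) = 0 \<Longrightarrow> f (g y) = f p"
    "\<And>y w. y \<in> V \<Longrightarrow> g' y w - R (f' p (g' y w)) + R (f' (g y) (g' y w)) = w"
    using level_set_parametrization[OF U f' cont R] by blast
  have id: "g' p w = w" for w using g(7)[OF g(2), of w] g(3) by simp
  show thesis
  proof
    show "(\<lambda>s. g (p + s *\<^sub>R v)) 0 = p" using g by simp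
    have gd: "(g has_derivative g' p) (at (p + 0 *\<^sub>R v))" using g by simp
    have "((\<lambda>s. g (p + s *\<^sub>R v)) has_derivative (\<lambda>s. g' p (s *\<^sub>R v))) (at 0)"
      by (rule has_derivative_compose[where g = g and f =
        "\<lambda>s. p + s *\<^sub>R v", OF _ gd]) (auto intro!: derivative_eq_intros)
    then show "((\<lambda>s. g (p + s *\<^sub>R v)) has_vector_derivative v) (at 0)"
      by (simp add: has_vector_derivative_def id)
    have "\<forall>\<^sub>F s in nhds 0. p + s *\<^sub>R v \<in> V" by (rule eventually_line[OF g(1,2)])
    then show "\<forall>\<^sub>F s in nhds 0. g (p + s *\<^sub>R v) \<in> U \<and> f (g (p + s *\<^sub>R v)) = f p"
      by eventually_elim (use g v in \<open>simp add: D.scaleR\<close>)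
  qed
qed

text \<open>A vector field extending \<open>v\<close> and tangent to the level set is differentiated along a curve in the
  level set with velocity \<open>u\<close>. The derivative of the field is the second derivative on the right, which
  is symmetric in \<open>u\<close> and \<open>v\<close>.\<close>
lemma derivative_along_level_set:
  fixes f :: "'a::euclidean_space \<Rightarrow> 'b::real_normed_vector" and lam :: "'a \<Rightarrow> 'a \<Rightarrow> real"
  assumes U: "open U" "p \<in> U"
    and f': "\<And>x. x \<in> U \<Longrightarrow> (f has_derivative f' x) (at x)"
    and cont: "\<And>v. continuous_on U (\<lambda>x. f' x v)"
    and R: "bounded_linear R" "\<And>y. f' p (R y) = y"
    and f'': "\<And>w. ((\<lambda>x. f' x w) has_derivative f'' w) (at p)"
    and lam: "\<And>x. x \<in> U \<Longrightarrow> linear (lam x)"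
    and L: "\<And>w. ((\<lambda>x. lam x w) has_derivative L w) (at p)"
    and van: "\<And>x w. x \<in> U \<Longrightarrow> f x = f p \<Longrightarrow> f' x w = 0 \<Longrightarrow> lam x w = 0"
    and uv: "f' p u = 0" "f' p v = 0"
  shows "L v u = lam p (R (f'' v u))"
proof -
  have bl: "bounded_linear (f' x)" if "x \<in> U" for x using f'[OF that] has_derivative_bounded_linear by blast
  interpret D: bounded_linear "f' p" using bl U by blast
  interpret R: bounded_linear R by fact
  obtain V g g' where g: "open V" "p \<in> V" "g p = p" "\<And>y. y \<in> V \<Longrightarrow> g y \<in> U"
    "\<And>y. y \<in> V \<Longrightarrow> (g has_derivative g' y) (at y)"
    "\<And>y. y \<in> V \<Longrightarrow> f' p (y - p) = 0 \<Longrightarrow> f (g y) = f p"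
    "\<And>y w. y \<in> V \<Longrightarrow> g' y w - R (f' p (g' y w)) + R (f' (g y) (g' y w)) = w"
    using level_set_parametrization[OF U f' cont R] by blast
  have id: "g' p w = w" for w using g(7)[OF g(2), of w] g(3) by simp
  define c where "c s = g (p + s *\<^sub>R u)" for s
  \<comment> \<open>The image of the constant field \<open>v\<close> under \<open>g\<close>, hence
    tangent to the level set along \<open>c\<close>. No derivative of \<open>g'\<close> is
    available, so that of \<open>W\<close> is extracted from the equation
    \<open>W s + B s (W s) = v\<close>, in which \<open>B s\<close> tends to 0.\<close>
  define W where "W s = g' (p + s *\<^sub>R u) v" for s
  define B where "B s w = R (f' (c s) w) - R (f' p w)" for s w
  have c0: "c 0 = p" by (simp add: c_def g)
  have gd: "(g has_derivative g' p) (at (p + 0 *\<^sub>R u))" using g by simp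
  have dc: "(c has_derivative (\<lambda>s. s *\<^sub>R u)) (at 0)"
  proof -
    have "((\<lambda>s. g (p + s *\<^sub>R u)) has_derivative (\<lambda>s. g' p (s *\<^sub>R u))) (at 0)"
      by (rule has_derivative_compose[where g = g and f =
        "\<lambda>s. p + s *\<^sub>R u", OF _ gd]) (auto intro!: derivative_eq_intros)
    then show ?thesis unfolding c_def by (simp add: id)
  qed
  have ev: "\<forall>\<^sub>F s in nhds 0. p + s *\<^sub>R u \<in> V" by (rule eventually_line[OF g(1,2)])
  have W_eq: "W s + B s (W s) = v" if "p + s *\<^sub>R u \<in> V" for s
    using g(7)[OF that, of v] unfolding W_def B_def c_def by (simp add: algebra_simps)
  have B_exp: "B s w = (\<Sum>b\<in>Basis. (w \<bullet> b) *\<^sub>R B s b)" if "p + s *\<^sub>R u \<in> V" for s w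
  proof (rule linear_euclidean_expand)
    have "bounded_linear (\<lambda>w. R (f' (c s) w) - R (f' p w))"
      using g(4)[OF that] U(2) by (intro bounded_linear_sub bounded_linear_compose[OF R(1)] bl)
        (auto simp: c_def)
    then show "linear (B s)" unfolding B_def by (rule bounded_linear.linear)
  qed
  have B0: "B 0 w = 0" for w by (simp add: B_def c0)
  have dB: "((\<lambda>s. B s w) has_derivative (\<lambda>s. s *\<^sub>R R (f'' w u))) (at 0)" for w
  proof -
    have 1: "((\<lambda>x. R (f' x w)) has_derivative (\<lambda>h. R (f'' w h))) (at (c 0))"
      unfolding c0 by (rule R.has_derivative[OF f''])
    have "((\<lambda>s. R (f' (c s) w)) has_derivative (\<lambda>s. R (f'' w (s *\<^sub>R u)))) (at 0)"
      by (rule has_derivative_compose[OF dc 1])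
    then have "((\<lambda>s. B s w) has_derivative (\<lambda>s. R (f'' w (s *\<^sub>R u)) - 0)) (at 0)"
      unfolding B_def by (intro has_derivative_diff has_derivative_const)
    then show ?thesis
      using linear_scale[OF has_derivative_linear[OF f'']] by (simp add: R.scaleR)
  qed
  have B_lim: "((\<lambda>s. B s w) \<longlongrightarrow> 0) (at 0)" for w
    using has_derivative_continuous[OF dB[of w]] B0[of w] by (simp add: isCont_def)
  have ev': "\<forall>\<^sub>F s in at 0. p + s *\<^sub>R u \<in> V"
    using ev by (simp add: eventually_at_filter eventually_mono)
  have "((\<lambda>s. \<Sum>b\<in>Basis. norm (B s b)) \<longlongrightarrow> (\<Sum>b::'a\<in>Basis. norm (0::'a))) (at 0)"
    by (intro tendsto_sum tendsto_norm B_lim)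
  then have "\<forall>\<^sub>F s in at 0. (\<Sum>b\<in>Basis. norm (B s b)) < 1/2"
    by (rule order_tendstoD(2)) simp
  \<comment> \<open>A rough bound is needed first: once \<open>B s\<close> has norm below 1/2, the
    equation bounds \<open>W s\<close> by \<open>2 * norm v\<close>. Only then does
    \<open>B s (W s)\<close> tend to 0, and \<open>W s\<close> to \<open>v\<close>.\<close>
  with ev' have bW: "\<forall>\<^sub>F s in at 0. norm (W s) \<le> 2 * norm v"
  proof eventually_elim
    case (elim s)
    have "norm (B s (W s)) \<le> (\<Sum>b\<in>Basis. norm (W s) * norm (B s b))"
      unfolding B_exp[OF elim(1), of "W s"]
      by (rule order_trans[OF norm_sum]) (auto intro!: sum_mono mult_right_mono simp: Basis_le_norm)
    also have "\<dots> = norm (W s) * (\<Sum>b\<in>Basis. norm (B s b))" by (simp add: sum_distrib_left)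
    also have "\<dots> \<le> norm (W s) * (1/2)" using elim by (intro mult_left_mono) auto
    finally have "norm (B s (W s)) \<le> norm (W s) / 2" by simp
    moreover have "norm (W s) \<le> norm v + norm (B s (W s))"
      using norm_triangle_ineq4[of v "B s (W s)"] unfolding W_eq[OF elim(1), symmetric] by simp
    ultimately show ?case by simp
  qed
  have "((\<lambda>s. B s (W s)) \<longlongrightarrow> 0) (at 0)"
  proof (rule Lim_null_comparison)
    show "\<forall>\<^sub>F s in at 0. norm (B s (W s)) \<le> (\<Sum>b\<in>Basis. (2 * norm v) * norm (B s b))"
      using ev' bW
    proof eventually_elim
      case (elim s)
      have "\<bar>W s \<bullet> b\<bar> \<le> 2 * norm v" if "b \<in> Basis" for b
        using Basis_le_norm[OF that, of "W s"] elim by simp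
      then show ?case unfolding B_exp[OF elim(1), of "W s"]
        by (intro order_trans[OF norm_sum] sum_mono) (auto intro!: mult_right_mono)
    qed
    have "((\<lambda>s. \<Sum>b\<in>Basis. (2 * norm v) * norm (B s b)) \<longlongrightarrow> (\<Sum>b::'a\<in>Basis. (2 * norm v) * norm (0::'a))) (at 0)"
      by (intro tendsto_sum tendsto_mult tendsto_const tendsto_norm B_lim)
    then show "((\<lambda>s. \<Sum>b\<in>Basis. (2 * norm v) * norm (B s b)) \<longlongrightarrow> 0) (at 0)" by simp
  qed
  then have "((\<lambda>s. v - B s (W s)) \<longlongrightarrow> v - 0) (at 0)" by (intro tendsto_intros)
  moreover have "\<forall>\<^sub>F s in at 0. v - B s (W s) = W s" using ev'
    by eventually_elim (metis W_eq add_diff_cancel_right')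
  ultimately have W_lim: "(W \<longlongrightarrow> v) (at 0)" by (simp add: tendsto_cong)
  have W0: "W 0 = v" by (simp add: W_def id)
  \<comment> \<open>By the equation the quotient equals \<open>- B s (W s)\<close> divided by
    \<open>s\<close>. Basis vector by basis vector, \<open>B s b\<close> divided by \<open>s\<close>
    tends to \<open>R (f'' b u)\<close>, and the coefficients of \<open>W s\<close> tend to those of
    \<open>v\<close>.\<close>
  have "((\<lambda>s. (W s - W 0) /\<^sub>R s) \<longlongrightarrow> - R (f'' v u)) (at 0)"
  proof -
    have "((\<lambda>s. B s b /\<^sub>R s) \<longlongrightarrow> R (f'' b u)) (at 0)" for b
      using dB[of b] has_vector_derivative_at_0_iff[of "\<lambda>s. B s b" "R (f'' b u)"]
      by (simp add: has_vector_derivative_def B0)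
    then have "((\<lambda>s. - (\<Sum>b\<in>Basis. (W s \<bullet> b) *\<^sub>R (B s b /\<^sub>R s))) \<longlongrightarrow> - (\<Sum>b\<in>Basis. (v \<bullet> b) *\<^sub>R R (f'' b u))) (at 0)"
      by (intro tendsto_minus tendsto_sum tendsto_scaleR tendsto_inner W_lim tendsto_const)
    moreover have "(\<Sum>b\<in>Basis. (v \<bullet> b) *\<^sub>R R (f'' b u)) = R (f'' v u)"
    proof -
      have "((\<lambda>y. \<Sum>b\<in>Basis. (v \<bullet> b) *\<^sub>R f' y b) has_derivative (\<lambda>h. \<Sum>b\<in>Basis. (v \<bullet> b) *\<^sub>R f'' b h)) (at p)"
        by (intro has_derivative_sum has_derivative_scaleR_right f'')
      then have "((\<lambda>y. f' y v) has_derivative (\<lambda>h. \<Sum>b\<in>Basis. (v \<bullet> b) *\<^sub>R f'' b h)) (at p)"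
        by (rule has_derivative_transform_within_open[OF _ U])
          (use linear_euclidean_expand bl bounded_linear.linear in metis)
      then have "f'' v = (\<lambda>h. \<Sum>b\<in>Basis. (v \<bullet> b) *\<^sub>R f'' b h)"
        using f'' has_derivative_unique by blast
      then show ?thesis by (metis (mono_tags, lifting) R.scaleR R.sum sum.cong)
    qed
    moreover have "\<forall>\<^sub>F s in at 0. - (\<Sum>b\<in>Basis. (W s \<bullet> b) *\<^sub>R (B s b /\<^sub>R s)) = (W s - W 0) /\<^sub>R s"
      using ev'
    proof eventually_elim
      case (elim s)
      have "W s - W 0 = - B s (W s)" using W_eq[OF elim, symmetric] W0 by simp
      then have "(W s - W 0) /\<^sub>R s = - (B s (W s) /\<^sub>R s)" by simp
      also have "B s (W s) /\<^sub>R s = (\<Sum>b\<in>Basis. (W s \<bullet> b) *\<^sub>R (B s b /\<^sub>R s))"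
        by (subst B_exp[OF elim]) (simp add: scaleR_sum_right mult.commute)
      finally show ?case by simp
    qed
    ultimately show ?thesis by (simp add: tendsto_cong)
  qed
  then have dW: "(W has_derivative (\<lambda>s. s *\<^sub>R (- R (f'' v u)))) (at 0)"
    using has_vector_derivative_at_0_iff[of W] unfolding has_vector_derivative_def by blast
  have dlam: "((\<lambda>s. lam (c s) w) has_derivative (\<lambda>s. L w (s *\<^sub>R u))) (at 0)" for w
    by (rule has_derivative_compose[OF dc]) (simp add: c0 L)
  obtain N where N: "open N" "0 \<in> N" "\<And>s. s \<in> N \<Longrightarrow> p + s *\<^sub>R u \<in> V"
    using ev by (auto simp: eventually_nhds)
  \<comment> \<open>A form that vanishes on tangent vectors is evaluated on a tangent field along
    \<open>c\<close>: the result is constantly 0, and the Leibniz rule reads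
    \<open>lam p (- R (f'' v u)) + L v u = 0\<close>.\<close>
  have "((\<lambda>s. lam (c s) (W s)) has_derivative (\<lambda>h. lam (c 0) (h *\<^sub>R (- R (f'' v u))) + L (W 0) (h
    *\<^sub>R u))) (at 0)"
    by (rule has_derivative_linear_family[OF dlam dW N(1,2)]) (use N g lam c_def in auto)
  moreover have "lam (c s) (W s) = 0" if "s \<in> N" for s
  proof (rule van)
    have y: "p + s *\<^sub>R u \<in> V" using N that by blast
    then show "c s \<in> U" "f (c s) = f p" using g uv by (auto simp: c_def D.scaleR)
    \<comment> \<open>Since \<open>f' p\<close> undoes \<open>R\<close>, the left side is just
      \<open>f' (c s) (W s)\<close>.\<close>
    have "f' p (W s - R (f' p (W s)) + R (f' (c s) (W s))) = f' p v"
      using g(7)[OF y, of v] by (simp add: c_def W_def)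
    then show "f' (c s) (W s) = 0" using uv by (simp add: D.add D.diff R)
  qed
  then have "((\<lambda>s. lam (c s) (W s)) has_derivative (\<lambda>h. 0)) (at 0)"
    by (intro has_derivative_transform_within_open[OF has_derivative_const[of 0] N(1,2)]) simp
  ultimately have "(\<lambda>h. lam (c 0) (h *\<^sub>R (- R (f'' v u))) + L (W 0) (h *\<^sub>R u)) = (\<lambda>h::real. 0)"
    using has_derivative_unique by blast
  from fun_cong[OF this, of 1] show ?thesis
    using c0 W0 linear_neg[OF lam[OF U(2)]] by simp
qed

text \<open>\<open>L v u - L u v\<close> is the exterior derivative of the 1-form \<open>lam\<close>
  on \<open>(u, v)\<close>. Each term equals a correction caused by extending the vectors to tangent
  fields, and these corrections agree by symmetry of \<open>f''\<close>.\<close>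

lemma closed_on_level_set:
  fixes f :: "'a::euclidean_space \<Rightarrow> 'b::real_normed_vector" and lam :: "'a \<Rightarrow> 'a \<Rightarrow> real"
  assumes U: "open U" "p \<in> U"
    and f': "\<And>x. x \<in> U \<Longrightarrow> (f has_derivative f' x) (at x)"
    and cont: "\<And>v. continuous_on U (\<lambda>x. f' x v)"
    and surj: "surj (f' p)"
    and f'': "\<And>w. ((\<lambda>x. f' x w) has_derivative f'' w) (at p)"
    and lam: "\<And>x. x \<in> U \<Longrightarrow> linear (lam x)"
    and L: "\<And>w. ((\<lambda>x. lam x w) has_derivative L w) (at p)"
    and van: "\<And>x w. x \<in> U \<Longrightarrow> f x = f p \<Longrightarrow> f' x w = 0 \<Longrightarrow> lam x w = 0"
    and uv: "f' p u = 0" "f' p v = 0"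
  shows "L v u = L u v"
proof -
  have "bounded_linear (f' p)" using f'[OF U(2)] has_derivative_bounded_linear by blast
  then obtain R where R: "bounded_linear R" "\<And>y. f' p (R y) = y"
    using bounded_linear_right_inverse surj by blast
  have "f'' v u = f'' u v" by (rule second_derivative_symmetric[OF U f' f'' f''])
  moreover have "L v u = lam p (R (f'' v u))"
    by (rule derivative_along_level_set[OF U f' cont R f'' lam L van uv])
  moreover have "L u v = lam p (R (f'' u v))"
    by (rule derivative_along_level_set[OF U f' cont R f'' lam L van uv(2,1)])
  ultimately show ?thesis by (simp only:)
qed

section \<open>Velocities of curves and tangent maps\<close>

lemma Cinf_on_diff:
  assumes "Cinf_on S f" "Cinf_on S g" "open S"
  shows "Cinf_on S (\<lambda>x. f x - g x)"
proof -
  have "Ck_on k S (\<lambda>x. f x + (- 1) *\<^sub>R g x)" for k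
    using assms by (intro Ck_on_add Ck_on_bilinear[OF bounded_bilinear_scaleR] Ck_on_const) (auto
      dest: Cinf_onD)
  then show ?thesis by (simp add: Cinf_on_def)
qed

text \<open>For a linear inner map the direction \<open>L v\<close> is constant, so no basis is
  involved and the middle space may be any normed space. Products with the base manifold rely on
  this.\<close>

lemma Ck_on_compose_linear:
  assumes "Ck_on k T g" "bounded_linear L" "open S" "L ` S \<subseteq> T"
  shows "Ck_on k S (\<lambda>x. g (L x))"
  using assms
proof (induction k arbitrary: g)
  case 0
  then show ?case by (auto intro: continuous_on_compose2 linear_continuous_on)
next
  case (Suc k)
  show ?case
  proof (rule Ck_on_SucI[OF Suc.prems(3), where f' = "\<lambda>x v. frechet_derivative g (at (L x)) (L v)"])
    show "((\<lambda>x. g (L x)) has_derivative (\<lambda>v. frechet_derivative g (at (L x)) (L v))) (at x)" if "x \<in> S" for x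
      by (rule has_derivative_compose[OF bounded_linear_imp_has_derivative[OF Suc.prems(2)]
          Ck_on_SucD[OF Suc.prems(1)]]) (use that Suc.prems in blast)
    show "Ck_on k S (\<lambda>x. frechet_derivative g (at (L x)) (L v))" for v
      by (rule Suc.IH[where g = "\<lambda>y. frechet_derivative g (at y) (L v)"]) (use Suc.prems in auto)
  qed
qed

lemma Cinf_on_compose_linear:
  assumes "Cinf_on T g" "bounded_linear L" "open S" "L ` S \<subseteq> T"
  shows "Cinf_on S (\<lambda>x. g (L x))"
  unfolding Cinf_on_def by (rule allI) (rule Ck_on_compose_linear[OF Cinf_onD[OF assms(1)] assms(2-4)])

lemma has_vector_derivative_cong_nhds:
  assumes "(f has_vector_derivative d) (at x)" "\<forall>\<^sub>F s in nhds x. f s = g s"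
  shows "(g has_vector_derivative d) (at x)"
proof -
  obtain N where N: "open N" "x \<in> N" "\<And>s. s \<in> N \<Longrightarrow> f s = g s"
    using assms(2) by (auto simp: eventually_nhds)
  show ?thesis
    using assms(1) unfolding has_vector_derivative_def
    by (rule has_derivative_transform_within_open[OF _ N])
qed

lemma has_vector_derivative_compose:
  assumes "(k has_vector_derivative u) (at x)" "(h has_derivative h') (at (k x))"
  shows "((\<lambda>s. h (k s)) has_vector_derivative h' u) (at x)"
proof -
  have "((\<lambda>s. h (k s)) has_derivative (\<lambda>s. h' (s *\<^sub>R u))) (at x)"
    using has_derivative_compose[OF assms(1)[unfolded has_vector_derivative_def] assms(2)] .
  then show ?thesis
    using linear_scale[OF has_derivative_linear[OF assms(2)]] by (simp add: has_vector_derivative_def)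
qed

lemma isCont_eventually_mem:
  assumes "isCont \<gamma> x" "open W" "\<gamma> x \<in> W"
  shows "\<forall>\<^sub>F s in nhds x. \<gamma> s \<in> W"
proof -
  have "(\<gamma> \<longlongrightarrow> \<gamma> x) (nhds x)" using assms(1) by (simp add: isCont_def tendsto_at_iff_tendsto_nhds)
  then show ?thesis using assms(2,3) by (rule topological_tendstoD)
qed

lemma charts_at_atlas: "c \<in> charts_at A p \<Longrightarrow> c \<in> A"
  and charts_at_dom: "c \<in> charts_at A p \<Longrightarrow> p \<in> cdom c"
  by (auto simp: charts_at_def)

section \<open>Charts of an atlas\<close>

context
  fixes A :: "('m::{t2_space,second_countable_topology}, 'd::real_normed_vector) chart set"
  assumes A: "smooth_atlas A"
begin

lemma chart_of_mem: "chart_of A p \<in> charts_at A p"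
proof -
  have "p \<in> (\<Union>c\<in>A. cdom c)" using A by (simp add: smooth_atlas_def)
  then have "\<exists>c. c \<in> charts_at A p" by (auto simp: charts_at_def)
  then show ?thesis unfolding chart_of_def by (rule someI_ex)
qed

lemma chart_open:
  assumes "c \<in> A"
  shows "open (cdom c)" "open (cmap c ` cdom c)"
    "homeomorphism (cdom c) (cmap c ` cdom c) (cmap c) (cinv c)"
proof -
  have "\<forall>c\<in>A. open (cdom c) \<and> open (cmap c ` cdom c) \<and>
      homeomorphism (cdom c) (cmap c ` cdom c) (cmap c) (cinv c)"
    using A unfolding smooth_atlas_def by blast
  then show "open (cdom c)" "open (cmap c ` cdom c)"
    "homeomorphism (cdom c) (cmap c ` cdom c) (cmap c) (cinv c)"
    using assms by blast+
qed

lemma cinv_cmap: "c \<in> A \<Longrightarrow> p \<in> cdom c \<Longrightarrow> cinv c (cmap c p) = p"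
  using chart_open(3)[of c] by (simp add: homeomorphism_def)

lemma cmap_cinv: "c \<in> A \<Longrightarrow> x \<in> cmap c ` cdom c \<Longrightarrow> cmap c (cinv c x) = x"
  using cinv_cmap[of c] by (elim imageE) simp

lemma cinv_mem: "c \<in> A \<Longrightarrow> x \<in> cmap c ` cdom c \<Longrightarrow> cinv c x \<in> cdom c"
  using cinv_cmap[of c] by (elim imageE) simp

lemma chart_image_open:
  assumes "c \<in> A" "open W"
  shows "open (cmap c ` (cdom c \<inter> W))"
proof -
  have "openin (top_of_set (cdom c)) (cdom c \<inter> W)"
    using assms by (simp add: openin_open_Int)
  then have "openin (top_of_set (cmap c ` cdom c)) (cmap c ` (cdom c \<inter> W))"
    using chart_open(3)[OF assms(1)] homeomorphism_imp_open_map by blast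
  then show ?thesis using chart_open(2)[OF assms(1)] by (simp add: openin_open_eq)
qed

lemma cmap_continuous: "c \<in> A \<Longrightarrow> continuous_on (cdom c) (cmap c)"
  using chart_open(3)[of c] unfolding homeomorphism_def by blast

lemma cinv_continuous: "c \<in> A \<Longrightarrow> continuous_on (cmap c ` cdom c) (cinv c)"
  using chart_open(3)[of c] unfolding homeomorphism_def by blast

lemma chart_transition:
  assumes "c \<in> A" "c' \<in> A"
  shows "Cinf_on (cmap c ` (cdom c \<inter> cdom c')) (cmap c' \<circ> cinv c)"
  using A assms unfolding smooth_atlas_def by blast

lemma chart_transition_derivative:
  assumes "c \<in> charts_at A p" "c' \<in> charts_at A p"
  shows "((cmap c' \<circ> cinv c) has_derivative frechet_derivative (cmap c' \<circ> cinv c) (at (cmap c p)))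
    (at (cmap c p))"
  by (rule Cinf_on_has_derivative[OF chart_transition]) (use assms in \<open>auto simp: charts_at_def\<close>)

end

section \<open>Tangent vectors as velocities\<close>

text \<open>Continuity at 0 is demanded separately because \<open>cmap c\<close> is arbitrary
  outside \<open>cdom c\<close>, so differentiable coordinates alone would not keep the curve in the
  chart. The last clause matches the normalisation in \<open>tspace\<close>.\<close>

definition velocity :: "('m::topological_space, 'd::real_normed_vector) chart set \<Rightarrow> (real \<Rightarrow> 'm) \<Rightarrow>
  'm \<Rightarrow> ('m, 'd) tvec \<Rightarrow> bool" where
  "velocity A \<gamma> p v \<longleftrightarrow> \<gamma> 0 = p \<and> isCont \<gamma> 0 \<and>
     (\<forall>c\<in>charts_at A p. ((\<lambda>s. cmap c (\<gamma> s)) has_vector_derivative v c) (at 0)) \<and>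
     (\<forall>c. c \<notin> charts_at A p \<longrightarrow> v c = 0)"

lemma velocityD:
  assumes "velocity A \<gamma> p v"
  shows "\<gamma> 0 = p" "isCont \<gamma> 0"
    "\<And>c. c \<in> charts_at A p \<Longrightarrow> ((\<lambda>s. cmap c (\<gamma> s)) has_vector_derivative v c) (at 0)"
    "\<And>c. c \<notin> charts_at A p \<Longrightarrow> v c = 0"
  using assms by (auto simp: velocity_def)

lemma velocity_cong:
  assumes "velocity A \<gamma> p v" "\<forall>\<^sub>F s in nhds 0. \<gamma> s = \<gamma>' s"
  shows "velocity A \<gamma>' p v"
proof -
  have 0: "\<gamma>' 0 = \<gamma> 0" using eventually_nhds_x_imp_x[OF assms(2)] by simp
  have "isCont \<gamma>' 0" using velocityD(2)[OF assms(1)] assms(2) by (simp add: isCont_cong)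
  moreover have "((\<lambda>s. cmap c (\<gamma>' s)) has_vector_derivative v c) (at 0)" if "c \<in> charts_at A p" for c
    by (rule has_vector_derivative_cong_nhds[OF velocityD(3)[OF assms(1) that]])
      (use assms(2) in eventually_elim, simp)
  ultimately show ?thesis using assms(1) 0 by (auto simp: velocity_def)
qed

text \<open>Only the germ of a curve matters. Identities between tangent vectors are mostly proved
  by exhibiting both sides as velocities of curves that agree near 0.\<close>

lemma velocity_unique:
  assumes "velocity A \<gamma> p v" "velocity A \<gamma>' p w" "\<forall>\<^sub>F s in nhds 0. \<gamma> s = \<gamma>' s"
  shows "v = w"
proof
  fix c
  have *: "velocity A \<gamma>' p v" using assms velocity_cong by blast
  show "v c = w c"
  proof (cases "c \<in> charts_at A p")
    case True
    then show ?thesis using velocityD(3)[OF *] velocityD(3)[OF assms(2)] vector_derivative_unique_at by blast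
  next
    case False
    then show ?thesis using velocityD(4)[OF *] velocityD(4)[OF assms(2)] by simp
  qed
qed

lemma velocity_eq: "velocity A \<gamma> p v \<Longrightarrow> velocity A \<gamma> p w \<Longrightarrow> v = w"
  using velocity_unique by (metis (mono_tags, lifting) always_eventually)

lemma velocity_const: "velocity A (\<lambda>s. p) p (\<lambda>_. 0)"
  by (simp add: velocity_def)

text \<open>One chart suffices, since the chain rule for transition maps provides the coordinates in
  the others.\<close>

lemma velocity_chartI:
  assumes A: "smooth_atlas A" and c: "c \<in> charts_at A p" and \<gamma>: "\<gamma> 0 = p" "isCont \<gamma> 0"
    and d: "((\<lambda>s. cmap c (\<gamma> s)) has_vector_derivative u) (at 0)"
  shows "velocity A \<gamma> p (coord_vec A c p u)"
  unfolding velocity_def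
proof (intro conjI ballI allI impI)
  fix c' assume c': "c' \<in> charts_at A p"
  have "((\<lambda>s. (cmap c' \<circ> cinv c) (cmap c (\<gamma> s))) has_vector_derivative
      frechet_derivative (cmap c' \<circ> cinv c) (at (cmap c p)) u) (at 0)"
    by (rule has_vector_derivative_compose[OF d]) (simp only: \<gamma>(1) chart_transition_derivative[OF A c c'])
  moreover have "\<forall>\<^sub>F s in nhds 0. (cmap c' \<circ> cinv c) (cmap c (\<gamma> s)) = cmap c' (\<gamma> s)"
    using isCont_eventually_mem[OF \<gamma>(2) chart_open(1)[OF A charts_at_atlas[OF c]],
        unfolded \<gamma>(1), OF charts_at_dom[OF c]]
    by eventually_elim (simp add: cinv_cmap[OF A charts_at_atlas[OF c]])
  ultimately have "((\<lambda>s. cmap c' (\<gamma> s)) has_vector_derivative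
      frechet_derivative (cmap c' \<circ> cinv c) (at (cmap c p)) u) (at 0)"
    by (rule has_vector_derivative_cong_nhds)
  then show "((\<lambda>s. cmap c' (\<gamma> s)) has_vector_derivative coord_vec A c p u c') (at 0)"
    using c' by (simp only: coord_vec_def if_True)
qed (use \<gamma> in \<open>auto simp: coord_vec_def\<close>)

lemma velocity_tspace:
  assumes A: "smooth_atlas A" and v: "velocity A \<gamma> p v"
  shows "v \<in> tspace A p"
proof -
  have "v = coord_vec A c p (v c)" if c: "c \<in> charts_at A p" for c
    using velocity_eq[OF v velocity_chartI[OF A c velocityD(1,2)[OF v] velocityD(3)[OF v c]]] .
  then have "v c' = frechet_derivative (cmap c' \<circ> cinv c) (at (cmap c p)) (v c)"
    if "c \<in> charts_at A p" "c' \<in> charts_at A p" for c c'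
    using that by (metis coord_vec_def)
  then show ?thesis using velocityD(4)[OF v] unfolding tspace_def by blast
qed

lemma tspace_outside: "v \<in> tspace A p \<Longrightarrow> c \<notin> charts_at A p \<Longrightarrow> v c = 0"
  unfolding tspace_def by blast

lemma tspace_coord_vec:
  assumes "v \<in> tspace A p" "c \<in> charts_at A p"
  shows "coord_vec A c p (v c) = v"
proof
  fix c'
  show "coord_vec A c p (v c) c' = v c'"
  proof (cases "c' \<in> charts_at A p")
    case True
    then have "v c' = frechet_derivative (cmap c' \<circ> cinv c) (at (cmap c p)) (v c)"
      using assms unfolding tspace_def by blast
    then show ?thesis using True by (simp only: coord_vec_def if_True)
  next
    case False
    then show ?thesis using tspace_outside[OF assms(1)] by (simp add: coord_vec_def)
  qed
qed

lemma velocity_cinv: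
  assumes A: "smooth_atlas A" and c: "c \<in> charts_at A p" and k: "k 0 = cmap c p"
    "(k has_vector_derivative u) (at 0)"
  shows "velocity A (\<lambda>s. cinv c (k s)) p (coord_vec A c p u)"
    and "\<forall>\<^sub>F s in nhds 0. k s \<in> cmap c ` cdom c"
proof -
  note cA = charts_at_atlas[OF c] and pc = charts_at_dom[OF c]
  have ck: "isCont k 0" using k(2) has_vector_derivative_continuous by blast
  show ev: "\<forall>\<^sub>F s in nhds 0. k s \<in> cmap c ` cdom c"
    by (rule isCont_eventually_mem[OF ck chart_open(2)[OF A cA]]) (use k pc in simp)
  have "isCont (cinv c) (k 0)"
    using cinv_continuous[OF A cA] chart_open(2)[OF A cA] k pc by (simp add: continuous_on_eq_continuous_at)
  then have co: "isCont (\<lambda>s. cinv c (k s)) 0" using ck isCont_o2 by blast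
  show "velocity A (\<lambda>s. cinv c (k s)) p (coord_vec A c p u)"
  proof (rule velocity_chartI[OF A c _ co])
    show "cinv c (k 0) = p" using k cinv_cmap[OF A cA pc] by simp
    show "((\<lambda>s. cmap c (cinv c (k s))) has_vector_derivative u) (at 0)"
      by (rule has_vector_derivative_cong_nhds[OF k(2)])
        (use ev in eventually_elim, simp add: cmap_cinv[OF A cA])
  qed
qed

text \<open>The vector is the velocity of a straight line in the chart \<open>c\<close>; its
  compatibility across all pairs of charts is read off this curve.\<close>

lemma coord_vec_self:
  assumes A: "smooth_atlas A" and c: "c \<in> charts_at A p"
  shows "coord_vec A c p u c = u" "coord_vec A c p u \<in> tspace A p"
proof -
  have l: "((\<lambda>s. cmap c p + s *\<^sub>R u) has_vector_derivative u) (at 0)"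
    by (auto intro!: derivative_eq_intros)
  have *: "velocity A (\<lambda>s. cinv c (cmap c p + s *\<^sub>R u)) p (coord_vec A c p u)"
    and ev: "\<forall>\<^sub>F s in nhds 0. cmap c p + s *\<^sub>R u \<in> cmap c ` cdom c"
    using velocity_cinv[OF A c, where k = "\<lambda>s. cmap c p + s *\<^sub>R u", OF _ l] by auto
  show "coord_vec A c p u \<in> tspace A p" by (rule velocity_tspace[OF A *])
  have "((\<lambda>s. cmap c (cinv c (cmap c p + s *\<^sub>R u))) has_vector_derivative u) (at 0)"
    by (rule has_vector_derivative_cong_nhds[OF l])
      (use ev in eventually_elim, simp add: cmap_cinv[OF A charts_at_atlas[OF c]])
  then show "coord_vec A c p u c = u"
    using velocityD(3)[OF * c] vector_derivative_unique_at by blast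
qed

lemma tspace_velocity:
  assumes A: "smooth_atlas A" and v: "v \<in> tspace A p"
  obtains \<gamma> where "velocity A \<gamma> p v"
proof -
  let ?c = "chart_of A p"
  have c: "?c \<in> charts_at A p" by (rule chart_of_mem[OF A])
  have "((\<lambda>s. cmap ?c p + s *\<^sub>R v ?c) has_vector_derivative v ?c) (at 0)"
    by (auto intro!: derivative_eq_intros)
  then have "velocity A (\<lambda>s. cinv ?c (cmap ?c p + s *\<^sub>R v ?c)) p (coord_vec A ?c p (v ?c))"
    by (intro velocity_cinv[OF A c]) auto
  then show ?thesis using tspace_coord_vec[OF v c] that by metis
qed

lemma tspace_eqI:
  assumes "v \<in> tspace A p" "w \<in> tspace A p" "c \<in> charts_at A p" "v c = w c"
  shows "v = w"
  by (metis assms tspace_coord_vec)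

section \<open>Smooth maps on open sets and their tangent maps\<close>

lemma smooth_map_open_continuous: "smooth_map_open A B W f \<Longrightarrow> continuous_on W f"
  and smooth_map_open_open: "smooth_map_open A B W f \<Longrightarrow> open W"
  by (auto simp: smooth_map_open_def)

lemma smooth_map_open_coord:
  assumes A: "smooth_atlas A" and B: "smooth_atlas B" and f: "smooth_map_open A B W f"
    and c: "c \<in> A" "c' \<in> B"
  shows "open {p \<in> W. f p \<in> cdom c'}"
    and "open (cmap c ` {p \<in> cdom c \<inter> W. f p \<in> cdom c'})"
    and "Cinf_on (cmap c ` {p \<in> cdom c \<inter> W. f p \<in> cdom c'}) (cmap c' \<circ> f \<circ> cinv c)"
proof -
  have "open (f -` cdom c' \<inter> W)"
    by (rule continuous_on_open_vimage[THEN iffD1, rule_format])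
      (use f chart_open(1)[OF B c(2)] in \<open>auto simp: smooth_map_open_def\<close>)
  then show o: "open {p \<in> W. f p \<in> cdom c'}" by (simp add: vimage_def Collect_conj_eq Int_commute)
  have "{p \<in> cdom c \<inter> W. f p \<in> cdom c'} = cdom c \<inter> {p \<in> W. f p \<in> cdom c'}" by auto
  then show "open (cmap c ` {p \<in> cdom c \<inter> W. f p \<in> cdom c'})"
    using chart_image_open[OF A c(1) o] by simp
  show "Cinf_on (cmap c ` {p \<in> cdom c \<inter> W. f p \<in> cdom c'}) (cmap c' \<circ> f \<circ> cinv c)"
    using f c by (auto simp: smooth_map_open_def)
qed

lemma smooth_map_open_derivative:
  assumes A: "smooth_atlas A" and B: "smooth_atlas B" and f: "smooth_map_open A B W f" "p \<in> W"
    and c: "c \<in> charts_at A p" "c' \<in> charts_at B (f p)"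
  shows "((cmap c' \<circ> f \<circ> cinv c) has_derivative frechet_derivative (cmap c' \<circ> f \<circ> cinv c) (at
    (cmap c p))) (at (cmap c p))"
  by (rule Cinf_on_has_derivative[OF smooth_map_open_coord(3)[OF A B f(1)]])
    (use c f in \<open>auto simp: charts_at_def\<close>)

lemma smooth_map_open_isCont:
  "smooth_map_open A B W f \<Longrightarrow> p \<in> W \<Longrightarrow> isCont f p"
  by (auto simp: smooth_map_open_def continuous_on_eq_continuous_at)

lemma velocity_map_coord:
  assumes A: "smooth_atlas A" and B: "smooth_atlas B" and f: "smooth_map_open A B W f" "p \<in> W"
    and v: "velocity A \<gamma> p v" and c: "c \<in> charts_at A p" "c' \<in> charts_at B (f p)"
  shows "((\<lambda>s. cmap c' (f (\<gamma> s))) has_vector_derivative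
     frechet_derivative (cmap c' \<circ> f \<circ> cinv c) (at (cmap c p)) (v c)) (at 0)"
proof -
  have "((\<lambda>s. (cmap c' \<circ> f \<circ> cinv c) (cmap c (\<gamma> s))) has_vector_derivative
      frechet_derivative (cmap c' \<circ> f \<circ> cinv c) (at (cmap c p)) (v c)) (at 0)"
    by (rule has_vector_derivative_compose[OF velocityD(3)[OF v c(1)]])
      (simp only: velocityD(1)[OF v] smooth_map_open_derivative[OF A B f c])
  moreover have "\<forall>\<^sub>F s in nhds 0. (cmap c' \<circ> f \<circ> cinv c) (cmap c (\<gamma> s)) = cmap c' (f (\<gamma> s))"
    using isCont_eventually_mem[OF velocityD(2)[OF v] chart_open(1)[OF A charts_at_atlas[OF c(1)]],
        unfolded velocityD(1)[OF v], OF charts_at_dom[OF c(1)]]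
    by eventually_elim (simp add: cinv_cmap[OF A charts_at_atlas[OF c(1)]])
  ultimately show ?thesis by (rule has_vector_derivative_cong_nhds)
qed

text \<open>Characterises \<open>tmap\<close> independently of the chart chosen in its definition.
  Functoriality and the rules for products then follow by moving a curve along.\<close>

lemma velocity_map:
  assumes A: "smooth_atlas A" and B: "smooth_atlas B" and f: "smooth_map_open A B W f" "p \<in> W"
    and v: "velocity A \<gamma> p v"
  shows "velocity B (\<lambda>s. f (\<gamma> s)) (f p) (tmap A B f p v)"
proof -
  have "isCont (\<lambda>s. f (\<gamma> s)) 0"
    using velocityD(1,2)[OF v] smooth_map_open_isCont[OF f] isCont_o2 by blast
  then show ?thesis
    using velocity_map_coord[OF A B f v chart_of_mem[OF A]] velocityD(1)[OF v]
    by (auto simp: velocity_def tmap_def Let_def)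
qed

lemma tmap_tspace:
  assumes A: "smooth_atlas A" and B: "smooth_atlas B" and f: "smooth_map_open A B W f" "p \<in> W"
    and v: "v \<in> tspace A p"
  shows "tmap A B f p v \<in> tspace B (f p)"
  using tspace_velocity[OF A v] velocity_map[OF A B f] velocity_tspace[OF B] by metis

lemma tmap_coord:
  assumes A: "smooth_atlas A" and B: "smooth_atlas B" and f: "smooth_map_open A B W f" "p \<in> W"
    and v: "v \<in> tspace A p" and c: "c \<in> charts_at A p" "c' \<in> charts_at B (f p)"
  shows "tmap A B f p v c' = frechet_derivative (cmap c' \<circ> f \<circ> cinv c) (at (cmap c p)) (v c)"
proof -
  obtain \<gamma> where \<gamma>: "velocity A \<gamma> p v" using tspace_velocity[OF A v] .
  show ?thesis
    using velocityD(3)[OF velocity_map[OF A B f \<gamma>] c(2)] velocity_map_coord[OF A B f \<gamma> c]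
      vector_derivative_unique_at by blast
qed

lemma tspace_zero: 
  assumes A: "smooth_atlas A" shows "(\<lambda>_. 0) \<in> tspace A p"
  using velocity_tspace[OF A velocity_const] .

lemma tspace_diff:
  assumes A: "smooth_atlas A" and v: "v \<in> tspace A p" and w: "w \<in> tspace A p"
  shows "v - w \<in> tspace A p"
proof -
  let ?c = "chart_of A p"
  have c: "?c \<in> charts_at A p" by (rule chart_of_mem[OF A])
  have "v - w = coord_vec A ?c p (v ?c - w ?c)"
  proof
    fix c'
    show "(v - w) c' = coord_vec A ?c p (v ?c - w ?c) c'"
    proof (cases "c' \<in> charts_at A p")
      case True
      note lin = has_derivative_linear[OF chart_transition_derivative[OF A c True]]
      have "v c' = frechet_derivative (cmap c' \<circ> cinv ?c) (at (cmap ?c p)) (v ?c)"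
        "w c' = frechet_derivative (cmap c' \<circ> cinv ?c) (at (cmap ?c p)) (w ?c)"
        using v w c True unfolding tspace_def by blast+
      then show ?thesis using True by (simp add: coord_vec_def linear_diff[OF lin])
    next
      case False
      then show ?thesis using tspace_outside[OF v] tspace_outside[OF w] by (simp add: coord_vec_def)
    qed
  qed
  then show ?thesis using coord_vec_self(2)[OF A c] by simp
qed

lemma tmap_diff:
  assumes A: "smooth_atlas A" and B: "smooth_atlas B" and f: "smooth_map_open A B W f" "p \<in> W"
  shows "tmap A B f p (v - w) = tmap A B f p v - tmap A B f p w"
proof
  fix c'
  have "linear (frechet_derivative (cmap c' \<circ> f \<circ> cinv (chart_of A p)) (at (cmap (chart_of A p) p)))"
    if "c' \<in> charts_at B (f p)"
    using has_derivative_linear[OF smooth_map_open_derivative[OF A B f chart_of_mem[OF A] that]] .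
  then show "tmap A B f p (v - w) c' = (tmap A B f p v - tmap A B f p w) c'"
    by (auto simp: tmap_def Let_def linear_diff)
qed

lemma tmap_zero:
  assumes A: "smooth_atlas A" and B: "smooth_atlas B" and f: "smooth_map_open A B W f" "p \<in> W"
  shows "tmap A B f p (\<lambda>_. 0) = (\<lambda>_. 0)"
  using velocity_map[OF A B f velocity_const] velocity_const velocity_eq by blast

text \<open>Whichever extension \<open>SOME\<close> picks, it agrees with \<open>f\<close> along a
  curve that remains in \<open>S\<close>.\<close>

lemma velocity_tmap_on:
  assumes A: "smooth_atlas A" and B: "smooth_atlas B"
    and ext: "\<exists>F. local_extension A B S f p F"
    and v: "velocity A \<gamma> p v" and S: "\<forall>\<^sub>F s in nhds 0. \<gamma> s \<in> S"
  shows "velocity B (\<lambda>s. f (\<gamma> s)) (f p) (tmap_on A B S f p v)"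
proof -
  define F where "F = (SOME F. local_extension A B S f p F)"
  have "local_extension A B S f p F" unfolding F_def using ext by (rule someI_ex)
  then obtain W where W: "p \<in> W" "smooth_map_open A B W F" and W_eq: "\<forall>q\<in>W \<inter> S. F q = f q"
    unfolding local_extension_def by blast
  have p: "p \<in> S" using eventually_nhds_x_imp_x[OF S] velocityD(1)[OF v] by simp
  have "\<forall>\<^sub>F s in nhds 0. \<gamma> s \<in> W"
    by (rule isCont_eventually_mem[OF velocityD(2)[OF v] smooth_map_open_open[OF W(2)]])
      (use W velocityD(1)[OF v] in simp)
  with S have "\<forall>\<^sub>F s in nhds 0. F (\<gamma> s) = f (\<gamma> s)" by eventually_elim (use W_eq in auto)
  then have "velocity B (\<lambda>s. f (\<gamma> s)) (F p) (tmap A B F p v)"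
    by (rule velocity_cong[OF velocity_map[OF A B W(2,1) v]])
  moreover have "F p = f p" using W_eq W(1) p by blast
  ultimately show ?thesis by (simp add: tmap_on_def F_def)
qed

text \<open>Serves both the fibres of a submersion (with \<open>g\<close> constant) and the
  composable pairs. In charts, the equation \<open>f = g\<close> is the zero level of the difference
  of two coordinate expressions, and the surjectivity hypothesis makes this difference submersive at
  \<open>p\<close>.\<close>

lemma equalizer_curve:
  fixes A :: "('m::{t2_space,second_countable_topology}, 'd::euclidean_space) chart set"
    and B :: "('n::{t2_space,second_countable_topology}, 'e::real_normed_vector) chart set"
  assumes A: "smooth_atlas A" and B: "smooth_atlas B"
    and f: "smooth_map A B f" and g: "smooth_map A B g"
    and fg: "f p = g p"
    and surj: "\<And>w. w \<in> tspace B (f p) \<Longrightarrow> \<exists>Z\<in>tspace A p. tmap A B f p Z - tmap A B g p Z = w"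
    and v: "v \<in> tspace A p" "tmap A B f p v = tmap A B g p v"
  obtains \<gamma> where "velocity A \<gamma> p v" "\<forall>\<^sub>F s in nhds 0. f (\<gamma> s) = g (\<gamma> s)"
proof -
  define c where "c = chart_of A p"
  define c' where "c' = chart_of B (f p)"
  have c: "c \<in> charts_at A p" and c': "c' \<in> charts_at B (f p)" "c' \<in> charts_at B (g p)"
    unfolding c_def c'_def fg using chart_of_mem[OF A] chart_of_mem[OF B] by auto
  \<comment> \<open>Coordinates can be subtracted only where both values lie in the same chart
    \<open>c'\<close>; around \<open>p\<close> they do because \<open>f p = g p\<close>.\<close>
  define Uf where "Uf = cmap c ` {q \<in> cdom c \<inter> UNIV. f q \<in> cdom c'}"
  define Ug where "Ug = cmap c ` {q \<in> cdom c \<inter> UNIV. g q \<in> cdom c'}"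
  define U where "U = Uf \<inter> Ug"
  define \<phi> where "\<phi> x = (cmap c' \<circ> f \<circ> cinv c) x - (cmap c' \<circ> g \<circ> cinv c) x" for x
  note cA = charts_at_atlas[OF c] and cB = charts_at_atlas[OF c'(1)]
  have oU: "open U" unfolding U_def Uf_def Ug_def
    using smooth_map_open_coord(2)[OF A B f cA cB] smooth_map_open_coord(2)[OF A B g cA cB] by blast
  have pU: "cmap c p \<in> U"
    using c c' by (auto simp: U_def Uf_def Ug_def charts_at_def)
  have Uc: "cinv c x \<in> cdom c \<and> f (cinv c x) \<in> cdom c' \<and> g (cinv c x) \<in> cdom c'" if "x \<in> U" for x
  proof -
    obtain q where "x = cmap c q" "q \<in> cdom c" "f q \<in> cdom c'" using \<open>x \<in> U\<close> by (auto simp: U_def Uf_def)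
    moreover obtain r where "x = cmap c r" "r \<in> cdom c" "g r \<in> cdom c'"
      using \<open>x \<in> U\<close> by (auto simp: U_def Ug_def)
    ultimately show ?thesis using cinv_cmap[OF A cA] by metis
  qed
  have C: "Cinf_on U \<phi>" unfolding \<phi>_def
    by (rule Cinf_on_diff[OF Cinf_on_subset[OF smooth_map_open_coord(3)[OF A B f cA cB]]
        Cinf_on_subset[OF smooth_map_open_coord(3)[OF A B g cA cB]] oU])
      (simp_all add: U_def Uf_def Ug_def)
  define \<phi>' where "\<phi>' x = frechet_derivative \<phi> (at x)" for x
  have d: "(\<phi> has_derivative \<phi>' x) (at x)" if "x \<in> U" for x
    unfolding \<phi>'_def using C that by (rule Cinf_on_has_derivative)
  have cont: "continuous_on U (\<lambda>x. \<phi>' x v)" for v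
    unfolding \<phi>'_def using Ck_on_continuous[OF Cinf_onD[OF Cinf_on_frechet[OF C]]] .
  have "(\<phi> has_derivative (\<lambda>u. frechet_derivative (cmap c' \<circ> f \<circ> cinv c) (at (cmap c p)) u
      - frechet_derivative (cmap c' \<circ> g \<circ> cinv c) (at (cmap c p)) u)) (at (cmap c p))"
    unfolding \<phi>_def using has_derivative_diff[OF smooth_map_open_derivative[OF A B f _ c c'(1)]
        smooth_map_open_derivative[OF A B g _ c c'(2)]] by simp
  then have "\<phi>' (cmap c p) u = frechet_derivative (cmap c' \<circ> f \<circ> cinv c) (at (cmap c p)) u
      - frechet_derivative (cmap c' \<circ> g \<circ> cinv c) (at (cmap c p)) u" for u
    using fun_cong[OF has_derivative_unique[OF d[OF pU]]] by simp
  then have \<phi>'_tmap: "\<phi>' (cmap c p) (Z c) = tmap A B f p Z c' - tmap A B g p Z c'" if "Z \<in> tspace A p" for Z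
    using tmap_coord[OF A B f _ that c c'(1)] tmap_coord[OF A B g _ that c c'(2)] by simp
  have "\<exists>u. \<phi>' (cmap c p) u = e" for e
  proof -
    obtain Z where Z: "Z \<in> tspace A p" "tmap A B f p Z - tmap A B g p Z = coord_vec B c' (f p) e"
      using surj coord_vec_self(2)[OF B c'(1)] by blast
    have "tmap A B f p Z c' - tmap A B g p Z c' = e"
      using fun_cong[OF Z(2), of c'] coord_vec_self(1)[OF B c'(1)] by simp
    then show ?thesis using \<phi>'_tmap[OF Z(1)] by metis
  qed
  then have sj: "surj (\<phi>' (cmap c p))" by (metis surjI)
  have k0: "\<phi>' (cmap c p) (v c) = 0" using \<phi>'_tmap v by simp
  obtain k where k: "k 0 = cmap c p" "(k has_vector_derivative v c) (at 0)"
    "\<forall>\<^sub>F s in nhds 0. k s \<in> U \<and> \<phi> (k s) = \<phi> (cmap c p)"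
    using level_set_curve[OF oU pU d cont sj k0] by blast
  have \<phi>0: "\<phi> (cmap c p) = 0" using fg cinv_cmap[OF A cA charts_at_dom[OF c]] by (simp add: \<phi>_def)
  have ev: "\<forall>\<^sub>F s in nhds 0. f (cinv c (k s)) = g (cinv c (k s))"
    using k(3)
  proof eventually_elim
    case (elim s)
    then have "cmap c' (f (cinv c (k s))) = cmap c' (g (cinv c (k s)))" using \<phi>0 by (simp add: \<phi>_def)
    then show ?case using Uc[of "k s"] elim cinv_cmap[OF B cB] by metis
  qed
  have "velocity A (\<lambda>s. cinv c (k s)) p v"
    using velocity_cinv(1)[OF A c k(1,2)] tspace_coord_vec[OF v(1) c] by simp
  then show thesis using ev that by blast
qed

section \<open>Products of manifolds\<close>

abbreviation cprod :: "('m, 'd) chart \<Rightarrow> ('n, 'e) chart \<Rightarrow> ('m \<times> 'n, 'd \<times> 'e) chart" where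
  "cprod c c' \<equiv> (cdom c \<times> cdom c', map_prod (cmap c) (cmap c'))"

lemma prod_atlasE:
  assumes "C \<in> prod_atlas A B"
  obtains c c' where "c \<in> A" "c' \<in> B" "C = cprod c c'"
  using assms by (auto simp: prod_atlas_def)

lemma cprod_charts_at:
  assumes "c \<in> charts_at A p" "c' \<in> charts_at B q"
  shows "cprod c c' \<in> charts_at (prod_atlas A B) (p, q)"
proof -
  have "cprod c c' \<in> prod_atlas A B"
    using assms unfolding charts_at_def prod_atlas_def by blast
  then show ?thesis using assms by (simp add: charts_at_def)
qed

context
  fixes A :: "('m::{t2_space,second_countable_topology}, 'd::real_normed_vector) chart set"
    and B :: "('n::{t2_space,second_countable_topology}, 'e::real_normed_vector) chart set"
  assumes A: "smooth_atlas A" and B: "smooth_atlas B"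
begin

lemma cinv_cprod:
  assumes c: "c \<in> A" "c' \<in> B" and x: "x \<in> cmap c ` cdom c" "y \<in> cmap c' ` cdom c'"
  shows "cinv (cprod c c') (x, y) = (cinv c x, cinv c' y)"
  unfolding cinv_def[of "cprod c c'"]
proof (rule inv_into_f_eq)
  have "inj_on (cmap c) (cdom c)" "inj_on (cmap c') (cdom c')"
    using cinv_cmap[OF A c(1)] cinv_cmap[OF B c(2)] by (metis inj_on_inverseI)+
  then show "inj_on (cmap (cprod c c')) (cdom (cprod c c'))"
    by (auto simp: inj_on_def)
qed (use x cinv_mem[OF A c(1)] cinv_mem[OF B c(2)] cmap_cinv[OF A c(1)] cmap_cinv[OF B c(2)] in auto)

lemma cprod_image: "cmap (cprod c c') ` (S \<times> T) = cmap c ` S \<times> cmap c' ` T"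
  by force

lemma smooth_atlas_prod: "smooth_atlas (prod_atlas A B)"
  unfolding smooth_atlas_def
proof (intro conjI ballI)
  obtain S :: "'d set" where S: "finite S" "span S = UNIV" using A by (auto simp: smooth_atlas_def)
  obtain T :: "'e set" where T: "finite T" "span T = UNIV" using B by (auto simp: smooth_atlas_def)
  define R where "R = (\<lambda>x. (x, 0::'e)) ` S \<union> (\<lambda>y. (0::'d, y)) ` T"
  have "(x, y) \<in> span R" for x y
  proof -
    have l: "linear (\<lambda>x::'d. (x, 0::'e))" "linear (\<lambda>y::'e. (0::'d, y))"
      by (auto intro: linearI)
    have "(x, 0) \<in> span ((\<lambda>x. (x, 0::'e)) ` S)" "(0, y) \<in> span ((\<lambda>y. (0::'d, y)) ` T)"
      unfolding linear_span_image[OF l(1)] linear_span_image[OF l(2)] S T by auto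
    then have "(x, 0) \<in> span R" "(0, y) \<in> span R"
      unfolding R_def by (meson span_mono subsetD sup_ge1 sup_ge2)+
    then have "(x, 0) + (0, y) \<in> span R" by (rule span_add)
    then show ?thesis by simp
  qed
  then have "span R = UNIV" by auto
  then show "\<exists>R::('d \<times> 'e) set. finite R \<and> span R = UNIV" using S T by (auto simp: R_def intro!: exI[of _ R])
  show "(\<Union>C\<in>prod_atlas A B. cdom C) = UNIV"
  proof -
    have "\<exists>C\<in>prod_atlas A B. p \<in> cdom C" for p
    proof -
      have "cprod (chart_of A (fst p)) (chart_of B (snd p)) \<in> charts_at (prod_atlas A B) (fst p, snd p)"
        by (intro cprod_charts_at chart_of_mem A B)
      then show ?thesis by (metis charts_at_atlas charts_at_dom prod.collapse)
    qed
    then show ?thesis by blast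
  qed
next
  fix C assume "C \<in> prod_atlas A B"
  then obtain c c' where c: "c \<in> A" "c' \<in> B" and C: "C = cprod c c'" by (rule prod_atlasE)
  note oA = chart_open[OF A c(1)] and oB = chart_open[OF B c(2)]
  show "open (cdom C)" using oA oB by (simp add: C open_Times)
  show "open (cmap C ` cdom C)" using oA oB by (simp add: C cprod_image[unfolded snd_conv] open_Times)
  have im: "cmap C ` cdom C = (cmap c ` cdom c) \<times> (cmap c' ` cdom c')"
    unfolding C using cprod_image[of c c' "cdom c" "cdom c'"] by simp
  show "homeomorphism (cdom C) (cmap C ` cdom C) (cmap C) (cinv C)"
  proof (rule homeomorphismI)
    have "continuous_on (cdom c \<times> cdom c') (\<lambda>p. (cmap c (fst p), cmap c' (snd p)))"
      by (intro continuous_on_Pair continuous_on_compose2[OF cmap_continuous[OF A c(1)]]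
          continuous_on_compose2[OF cmap_continuous[OF B c(2)]] continuous_intros) auto
    then show "continuous_on (cdom C) (cmap C)" by (simp add: C map_prod_def split_def)
    have "continuous_on ((cmap c ` cdom c) \<times> (cmap c' ` cdom c')) (\<lambda>p. (cinv c (fst p), cinv c' (snd p)))"
      by (intro continuous_on_Pair continuous_on_compose2[OF cinv_continuous[OF A c(1)]]
          continuous_on_compose2[OF cinv_continuous[OF B c(2)]] continuous_intros) auto
    then show "continuous_on (cmap C ` cdom C) (cinv C)"
      unfolding im by (rule continuous_on_eq) (use cinv_cprod[OF c] in \<open>auto simp: C\<close>)
    show inv: "cinv C (cmap C p) = p" if "p \<in> cdom C" for p
      using that cinv_cprod[OF c, of "cmap c (fst p)"
        "cmap c' (snd p)"] cinv_cmap[OF A c(1)] cinv_cmap[OF B c(2)]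
      by (auto simp: C)
    show "cmap C (cinv C y) = y" if "y \<in> cmap C ` cdom C" for y using that inv by auto
    show "cmap C ` cdom C \<subseteq> cmap C ` cdom C" by simp
    show "cinv C ` (cmap C ` cdom C) \<subseteq> cdom C" using inv by auto
  qed
next
  fix C D assume "C \<in> prod_atlas A B" "D \<in> prod_atlas A B"
  then obtain c c' d d' where c: "c \<in> A" "c' \<in> B" "d \<in> A" "d' \<in> B" and C: "C = cprod c c'" "D = cprod d d'"
    by (metis prod_atlasE)
  define S where "S = cmap c ` (cdom c \<inter> cdom d)"
  define T where "T = cmap c' ` (cdom c' \<inter> cdom d')"
  have o: "open S" "open T" unfolding S_def T_def
    using chart_image_open[OF A c(1) chart_open(1)[OF A c(3)]] chart_image_open[OF B c(2)
      chart_open(1)[OF B c(4)]] by auto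
  have im: "cmap C ` (cdom C \<inter> cdom D) = S \<times> T"
    unfolding C S_def T_def using cprod_image[of c c' "cdom c \<inter> cdom d" "cdom c' \<inter> cdom d'"]
      by (simp add: Times_Int_Times)
  have oST: "open (S \<times> T)" using o by (rule open_Times)
  have "Cinf_on (S \<times> T) (\<lambda>p. ((cmap d \<circ> cinv c) (fst p), (cmap d' \<circ> cinv c') (snd p)))"
    by (intro Cinf_on_Pair oST Cinf_on_compose_linear[OF chart_transition[OF A c(1,3)] bounded_linear_fst oST]
        Cinf_on_compose_linear[OF chart_transition[OF B c(2,4)] bounded_linear_snd oST])
      (auto simp: S_def T_def)
  then show "Cinf_on (cmap C ` (cdom C \<inter> cdom D)) (cmap D \<circ> cinv C)"
    unfolding im
  proof (rule Cinf_on_cong[OF _ oST])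
    fix p assume p: "p \<in> S \<times> T"
    then have "fst p \<in> cmap c ` cdom c" "snd p \<in> cmap c' ` cdom c'" by (auto simp: S_def T_def)
    from cinv_cprod[OF c(1,2) this]
    show "((cmap d \<circ> cinv c) (fst p), (cmap d' \<circ> cinv c') (snd p)) = (cmap D \<circ> cinv C) p"
      by (simp add: C)
  qed
qed

end

section \<open>Smooth maps from and into products\<close>

lemma smooth_map_ident:
  assumes "smooth_atlas A"
  shows "smooth_map A A (\<lambda>p. p)"
  using chart_transition[OF assms] by (auto simp: smooth_map_open_def Int_def o_def)

lemma smooth_map_open_const:
  assumes A: "smooth_atlas A" and "open W"
  shows "smooth_map_open A B W (\<lambda>p. q)"
proof -
  have "Cinf_on (cmap c ` {p \<in> cdom c \<inter> W. q \<in> cdom c'}) (\<lambda>x. cmap c' q)" if "c \<in> A" for c c'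
  proof (cases "q \<in> cdom c'")
    case True
    then have "cmap c ` {p \<in> cdom c \<inter> W. q \<in> cdom c'} = cmap c ` (cdom c \<inter> W)" by auto
    then show ?thesis using chart_image_open[OF A that \<open>open W\<close>] by (simp add: Cinf_on_const)
  next
    case False
    then show ?thesis by (simp add: Cinf_on_const)
  qed
  then show ?thesis using assms(2) by (auto simp: smooth_map_open_def o_def)
qed

lemma smooth_map_open_subset:
  assumes "smooth_map_open A B W f" "open V" "V \<subseteq> W"
  shows "smooth_map_open A B V f"
  unfolding smooth_map_open_def
proof (intro conjI ballI)
  show "continuous_on V f" using assms continuous_on_subset smooth_map_open_continuous by blast
  fix c c' assume c: "c \<in> A" "c' \<in> B"
  have "cmap c ` {p \<in> cdom c \<inter> V. f p \<in> cdom c'} \<subseteq> cmap c ` {p \<in> cdom c \<inter> W. f p \<in> cdom c'}"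
    using assms(3) by blast
  moreover have "Cinf_on (cmap c ` {p \<in> cdom c \<inter> W. f p \<in> cdom c'}) (cmap c' \<circ> f \<circ> cinv c)"
    using assms(1) c unfolding smooth_map_open_def by blast
  ultimately show "Cinf_on (cmap c ` {p \<in> cdom c \<inter> V. f p \<in> cdom c'}) (cmap c' \<circ> f \<circ> cinv c)"
    using Cinf_on_subset by blast
qed (use assms in auto)

lemma smooth_map_open_compose:
  fixes A :: "('m::{t2_space,second_countable_topology}, 'd::real_normed_vector) chart set"
    and B :: "('n::{t2_space,second_countable_topology}, 'e::euclidean_space) chart set"
    and C :: "('k::{t2_space,second_countable_topology}, 'f::real_normed_vector) chart set"
  assumes A: "smooth_atlas A" and B: "smooth_atlas B" and C: "smooth_atlas C"
    and f: "smooth_map_open A B W f" and g: "smooth_map_open B C V g" and fV: "f ` W \<subseteq> V"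
  shows "smooth_map_open A C W (\<lambda>p. g (f p))"
  unfolding smooth_map_open_def
proof (intro conjI ballI)
  show "open W" using f by (rule smooth_map_open_open)
  show "continuous_on W (\<lambda>p. g (f p))"
    using continuous_on_compose2[OF smooth_map_open_continuous[OF g] smooth_map_open_continuous[OF f] fV] .
  fix c c'' assume c: "c \<in> A" and c'': "c'' \<in> C"
  show "Cinf_on (cmap c ` {p \<in> cdom c \<inter> W. g (f p) \<in> cdom c''}) (cmap c'' \<circ> (\<lambda>p. g (f p)) \<circ> cinv c)"
  proof (rule Cinf_on_local)
    fix x assume "x \<in> cmap c ` {p \<in> cdom c \<inter> W. g (f p) \<in> cdom c''}"
    then obtain p where p: "x = cmap c p" "p \<in> cdom c" "p \<in> W" "g (f p) \<in> cdom c''" by blast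
    define c' where "c' = chart_of B (f p)"
    have "c' \<in> charts_at B (f p)" unfolding c'_def by (rule chart_of_mem[OF B])
    then have c': "c' \<in> B" "f p \<in> cdom c'" by (simp_all add: charts_at_def)
    define N where "N = {q \<in> V. g q \<in> cdom c''} \<inter> cdom c'"
    have oN: "open N" unfolding N_def
      using smooth_map_open_coord(1)[OF B C g c'(1) c''] chart_open(1)[OF B c'(1)] by blast
    have "open (f -` N \<inter> W)"
      by (rule continuous_on_open_vimage[THEN iffD1, rule_format])
        (use f oN in \<open>auto simp: smooth_map_open_def\<close>)
    define T where "T = cmap c ` (cdom c \<inter> (f -` N \<inter> W))"
    have oT: "open T" unfolding T_def by (rule chart_image_open[OF A c \<open>open (f -` N \<inter> W)\<close>])
    have xT: "x \<in> T" using p c' fV by (auto simp: T_def N_def)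
    have 1: "Cinf_on T (cmap c' \<circ> f \<circ> cinv c)"
      by (rule Cinf_on_subset[OF smooth_map_open_coord(3)[OF A B f c c'(1)]]) (auto simp: T_def N_def)
    have mem: "cinv c y \<in> cdom c \<and> f (cinv c y) \<in> N" if "y \<in> T" for y
      using that cinv_cmap[OF A c] by (auto simp: T_def)
    have 2: "(cmap c' \<circ> f \<circ> cinv c) ` T \<subseteq> cmap c' ` {q \<in> cdom c' \<inter> V. g q \<in> cdom c''}"
      using mem by (auto simp: N_def)
    have "Cinf_on T (\<lambda>y. (cmap c'' \<circ> g \<circ> cinv c') ((cmap c' \<circ> f \<circ> cinv c) y))"
      by (rule Cinf_on_compose[OF 1 smooth_map_open_coord(3)[OF B C g c'(1) c''] oT 2])
    then have "Cinf_on T (cmap c'' \<circ> (\<lambda>p. g (f p)) \<circ> cinv c)"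
      by (rule Cinf_on_cong[OF _ oT]) (use mem cinv_cmap[OF B c'(1)] in \<open>auto simp: N_def\<close>)
    then show "\<exists>T. open T \<and> x \<in> T \<and> Cinf_on T (cmap c'' \<circ> (\<lambda>p. g (f p)) \<circ> cinv c)"
      using oT xT by blast
  qed
qed

text \<open>Kept apart from \<open>smooth_map_open_compose\<close>, whose middle space is Euclidean:
  in product charts the projection is linear, so \<open>Cinf_on_compose_linear\<close> applies and
  the factors may be modelled on any normed space.\<close>

lemma smooth_map_open_comp_fst:
  fixes A :: "('m::{t2_space,second_countable_topology}, 'd::real_normed_vector) chart set"
    and B :: "('n::{t2_space,second_countable_topology}, 'e::real_normed_vector) chart set"
    and C :: "('k::{t2_space,second_countable_topology}, 'f::real_normed_vector) chart set"
  assumes A: "smooth_atlas A" and C: "smooth_atlas C" and B: "smooth_atlas B" and f: "smooth_map_open A B W f"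
  shows "smooth_map_open (prod_atlas A C) B (W \<times> UNIV) (\<lambda>p. f (fst p))"
  unfolding smooth_map_open_def
proof (intro conjI ballI)
  show "open (W \<times> (UNIV :: 'k set))" using smooth_map_open_open[OF f] by (intro open_Times) auto
  show "continuous_on (W \<times> UNIV) (\<lambda>p. f (fst p))"
    by (rule continuous_on_compose2[OF smooth_map_open_continuous[OF f]]) (auto intro: continuous_intros)
  fix D c' assume "D \<in> prod_atlas A C" and c': "c' \<in> B"
  then obtain c d where c: "c \<in> A" "d \<in> C" and D: "D = cprod c d" by (auto elim: prod_atlasE)
  define S where "S = cmap c ` {q \<in> cdom c \<inter> W. f q \<in> cdom c'}"
  define T where "T = cmap d ` cdom d"
  have o: "open (S \<times> T)" unfolding S_def T_def
    by (intro open_Times smooth_map_open_coord(2)[OF A B f c(1) c'] chart_open(2)[OF C c(2)])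
  have im: "cmap D ` {p \<in> cdom D \<inter> W \<times> UNIV. f (fst p) \<in> cdom c'} = S \<times> T"
    unfolding S_def T_def D by force
  have "Cinf_on (S \<times> T) (\<lambda>x. (cmap c' \<circ> f \<circ> cinv c) (fst x))"
    by (rule Cinf_on_compose_linear[OF smooth_map_open_coord(3)[OF A B f c(1) c'] bounded_linear_fst o])
      (auto simp: S_def)
  then show "Cinf_on (cmap D ` {p \<in> cdom D \<inter> W \<times> UNIV. f (fst p) \<in> cdom c'}) (cmap c' \<circ> (\<lambda>p. f
    (fst p)) \<circ> cinv D)"
    unfolding im
  proof (rule Cinf_on_cong[OF _ o])
    fix p assume "p \<in> S \<times> T"
    then have "fst p \<in> cmap c ` cdom c" "snd p \<in> cmap d ` cdom d" by (auto simp: S_def T_def)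
    from cinv_cprod[OF A C c this]
    show "(cmap c' \<circ> f \<circ> cinv c) (fst p) = (cmap c' \<circ> (\<lambda>p. f (fst p)) \<circ> cinv D) p"
      by (simp add: D)
  qed
qed

lemma smooth_map_open_comp_snd:
  fixes A :: "('m::{t2_space,second_countable_topology}, 'd::real_normed_vector) chart set"
    and B :: "('n::{t2_space,second_countable_topology}, 'e::real_normed_vector) chart set"
    and C :: "('k::{t2_space,second_countable_topology}, 'f::real_normed_vector) chart set"
  assumes C: "smooth_atlas C" and A: "smooth_atlas A" and B: "smooth_atlas B" and f: "smooth_map_open A B W f"
  shows "smooth_map_open (prod_atlas C A) B (UNIV \<times> W) (\<lambda>p. f (snd p))"
  unfolding smooth_map_open_def
proof (intro conjI ballI)
  show "open ((UNIV :: 'k set) \<times> W)" using smooth_map_open_open[OF f] by (intro open_Times) auto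
  show "continuous_on (UNIV \<times> W) (\<lambda>p. f (snd p))"
    by (rule continuous_on_compose2[OF smooth_map_open_continuous[OF f]]) (auto intro: continuous_intros)
  fix D c' assume "D \<in> prod_atlas C A" and c': "c' \<in> B"
  then obtain c d where c: "c \<in> A" "d \<in> C" and D: "D = cprod d c" by (auto elim: prod_atlasE)
  define S where "S = cmap c ` {q \<in> cdom c \<inter> W. f q \<in> cdom c'}"
  define T where "T = cmap d ` cdom d"
  have o: "open (T \<times> S)" unfolding S_def T_def
    by (intro open_Times smooth_map_open_coord(2)[OF A B f c(1) c'] chart_open(2)[OF C c(2)])
  have im: "cmap D ` {p \<in> cdom D \<inter> UNIV \<times> W. f (snd p) \<in> cdom c'} = T \<times> S"
    unfolding S_def T_def D by force
  have "Cinf_on (T \<times> S) (\<lambda>x. (cmap c' \<circ> f \<circ> cinv c) (snd x))"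
    by (rule Cinf_on_compose_linear[OF smooth_map_open_coord(3)[OF A B f c(1) c'] bounded_linear_snd o])
      (auto simp: S_def)
  then show "Cinf_on (cmap D ` {p \<in> cdom D \<inter> UNIV \<times> W. f (snd p) \<in> cdom c'}) (cmap c' \<circ> (\<lambda>p. f
    (snd p)) \<circ> cinv D)"
    unfolding im
  proof (rule Cinf_on_cong[OF _ o])
    fix p assume "p \<in> T \<times> S"
    then have "fst p \<in> cmap d ` cdom d" "snd p \<in> cmap c ` cdom c" by (auto simp: S_def T_def)
    from cinv_cprod[OF C A c(2,1) this]
    show "(cmap c' \<circ> f \<circ> cinv c) (snd p) = (cmap c' \<circ> (\<lambda>p. f (snd p)) \<circ> cinv D) p"
      by (simp add: D)
  qed
qed

lemma smooth_map_comp_fst: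
  "smooth_atlas A \<Longrightarrow> smooth_atlas C \<Longrightarrow> smooth_atlas B \<Longrightarrow> smooth_map A B f \<Longrightarrow>
    smooth_map (prod_atlas A C) B (\<lambda>p. f (fst p))"
  using smooth_map_open_comp_fst by fastforce

lemma smooth_map_comp_snd:
  "smooth_atlas C \<Longrightarrow> smooth_atlas A \<Longrightarrow> smooth_atlas B \<Longrightarrow> smooth_map A B f \<Longrightarrow>
    smooth_map (prod_atlas C A) B (\<lambda>p. f (snd p))"
  using smooth_map_open_comp_snd by fastforce

lemma smooth_map_fst: "smooth_atlas A \<Longrightarrow> smooth_atlas B \<Longrightarrow> smooth_map (prod_atlas A B) A fst"
  using smooth_map_comp_fst[OF _ _ _ smooth_map_ident] by fastforce

lemma smooth_map_snd: "smooth_atlas A \<Longrightarrow> smooth_atlas B \<Longrightarrow> smooth_map (prod_atlas A B) B snd"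
  using smooth_map_comp_snd[OF _ _ _ smooth_map_ident] by fastforce

lemma smooth_map_open_Pair:
  assumes A: "smooth_atlas A" and B: "smooth_atlas B" and C: "smooth_atlas C"
    and f: "smooth_map_open A B W f" and g: "smooth_map_open A C W g"
  shows "smooth_map_open A (prod_atlas B C) W (\<lambda>p. (f p, g p))"
  unfolding smooth_map_open_def
proof (intro conjI ballI)
  show "open W" using smooth_map_open_open[OF f] .
  show "continuous_on W (\<lambda>p. (f p, g p))"
    by (rule continuous_on_Pair[OF smooth_map_open_continuous[OF f] smooth_map_open_continuous[OF g]])
  fix c D assume c: "c \<in> A" and "D \<in> prod_atlas B C"
  then obtain c' d where c': "c' \<in> B" "d \<in> C" and D: "D = cprod c' d" by (auto elim: prod_atlasE)
  let ?W = "{p \<in> W. f p \<in> cdom c'} \<inter> {p \<in> W. g p \<in> cdom d}"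
  have o: "open (cmap c ` (cdom c \<inter> ?W))"
    by (rule chart_image_open[OF A c])
      (use smooth_map_open_coord(1)[OF A B f c c'(1)] smooth_map_open_coord(1)[OF A C g c c'(2)] in blast)
  have im: "cmap c ` {p \<in> cdom c \<inter> W. (f p, g p) \<in> cdom D} = cmap c ` (cdom c \<inter> ?W)"
    unfolding D by (rule arg_cong[where f = "image (cmap c)"]) auto
  have "Cinf_on (cmap c ` (cdom c \<inter> ?W)) (\<lambda>x. ((cmap c' \<circ> f \<circ> cinv c) x, (cmap d \<circ> g \<circ> cinv c) x))"
    by (rule Cinf_on_Pair[OF Cinf_on_subset[OF smooth_map_open_coord(3)[OF A B f c c'(1)]]
        Cinf_on_subset[OF smooth_map_open_coord(3)[OF A C g c c'(2)]] o]) auto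
  then show "Cinf_on (cmap c ` {p \<in> cdom c \<inter> W. (f p, g p) \<in> cdom D}) (cmap D \<circ> (\<lambda>p. (f p, g p)) \<circ> cinv c)"
    unfolding im by (simp add: D o_def)
qed

abbreviation "tfst A B \<equiv> tmap (prod_atlas A B) A fst"
abbreviation "tsnd A B \<equiv> tmap (prod_atlas A B) B snd"

lemma velocity_Pair:
  assumes A: "smooth_atlas A" and B: "smooth_atlas B"
    and v: "velocity A \<gamma> p v" and w: "velocity B \<delta> q w"
  obtains Z where "velocity (prod_atlas A B) (\<lambda>s. (\<gamma> s, \<delta> s)) (p, q) Z"
    "Z \<in> tspace (prod_atlas A B) (p, q)"
    "tfst A B (p, q) Z = v" "tsnd A B (p, q) Z = w"
proof -
  note AB = smooth_atlas_prod[OF A B]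
  let ?c = "chart_of A p" and ?d = "chart_of B q"
  have c: "cprod ?c ?d \<in> charts_at (prod_atlas A B) (p, q)"
    by (intro cprod_charts_at chart_of_mem A B)
  have "((\<lambda>s. (cmap ?c (\<gamma> s), cmap ?d (\<delta> s))) has_vector_derivative (v ?c, w ?d)) (at 0)"
    using has_derivative_Pair[OF velocityD(3)[OF v chart_of_mem[OF A], unfolded has_vector_derivative_def]
        velocityD(3)[OF w chart_of_mem[OF B], unfolded has_vector_derivative_def]]
    by (simp add: has_vector_derivative_def)
  moreover have "isCont (\<lambda>s. (\<gamma> s, \<delta> s)) 0" using velocityD(2)[OF v] velocityD(2)[OF w] by simp
  ultimately obtain Z where Z: "velocity (prod_atlas A B) (\<lambda>s. (\<gamma> s, \<delta> s)) (p, q) Z"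
    using velocity_chartI[OF AB c, of "\<lambda>s. (\<gamma> s, \<delta> s)"] velocityD(1)[OF v] velocityD(1)[OF w] by auto
  show thesis
  proof
    show "velocity (prod_atlas A B) (\<lambda>s. (\<gamma> s, \<delta> s)) (p, q) Z" by fact
    then show "Z \<in> tspace (prod_atlas A B) (p, q)" by (rule velocity_tspace[OF AB])
    show "tfst A B (p, q) Z = v"
      using velocity_map[OF AB A smooth_map_fst[OF A B] UNIV_I Z] v velocity_eq by fastforce
    show "tsnd A B (p, q) Z = w"
      using velocity_map[OF AB B smooth_map_snd[OF A B] UNIV_I Z] w velocity_eq by fastforce
  qed
qed

text \<open>In a product chart the coordinates of a vector are the pair of coordinates of its two
  components.\<close>

lemma prod_tspace_eqI:
  assumes A: "smooth_atlas A" and B: "smooth_atlas B"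
    and Z: "Z \<in> tspace (prod_atlas A B) p" "Z' \<in> tspace (prod_atlas A B) p"
    and eq: "tfst A B p Z = tfst A B p Z'"
      "tsnd A B p Z = tsnd A B p Z'"
  shows "Z = Z'"
proof -
  note AB = smooth_atlas_prod[OF A B]
  let ?c = "chart_of A (fst p)" and ?d = "chart_of B (snd p)"
  have c: "cprod ?c ?d \<in> charts_at (prod_atlas A B) p"
    using cprod_charts_at[OF chart_of_mem[OF A] chart_of_mem[OF B], of "fst p" "snd p"] by simp
  have *: "X (cprod ?c ?d) = (tfst A B p X ?c, tsnd A B p X ?d)"
    if X: "X \<in> tspace (prod_atlas A B) p" for X
  proof -
    obtain \<gamma> where \<gamma>: "velocity (prod_atlas A B) \<gamma> p X" using tspace_velocity[OF AB X] .
    have "((\<lambda>s. cmap ?c (fst (\<gamma> s))) has_vector_derivative tfst A B p X ?c) (at 0)"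
      by (rule velocityD(3)[OF velocity_map[OF AB A smooth_map_fst[OF A B] UNIV_I \<gamma>] chart_of_mem[OF A]])
    moreover have "((\<lambda>s. cmap ?d (snd (\<gamma> s))) has_vector_derivative tsnd A B p X ?d) (at 0)"
      by (rule velocityD(3)[OF velocity_map[OF AB B smooth_map_snd[OF A B] UNIV_I \<gamma>] chart_of_mem[OF B]])
    ultimately have "((\<lambda>s. (cmap ?c (fst (\<gamma> s)), cmap ?d (snd (\<gamma> s)))) has_vector_derivative
        (tfst A B p X ?c, tsnd A B p X ?d)) (at 0)"
      unfolding has_vector_derivative_def by (auto dest: has_derivative_Pair)
    moreover have "((\<lambda>s. (cmap ?c (fst (\<gamma> s)), cmap ?d (snd (\<gamma> s)))) has_vector_derivative X
      (cprod ?c ?d)) (at 0)"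
      using velocityD(3)[OF \<gamma> c] by (simp add: map_prod_def split_def)
    ultimately show ?thesis using vector_derivative_unique_at by blast
  qed
  show ?thesis by (rule tspace_eqI[OF Z c]) (simp only: *[OF Z(1)] *[OF Z(2)] eq)
qed

lemma velocity_fst:
  assumes "smooth_atlas A" "smooth_atlas B" "velocity (prod_atlas A B) \<gamma> p Z"
  shows "velocity A (\<lambda>s. fst (\<gamma> s)) (fst p) (tfst A B p Z)"
  using velocity_map[OF smooth_atlas_prod[OF assms(1,2)] assms(1) smooth_map_fst[OF assms(1,2)]
    UNIV_I assms(3)] .

lemma velocity_snd:
  assumes "smooth_atlas A" "smooth_atlas B" "velocity (prod_atlas A B) \<gamma> p Z"
  shows "velocity B (\<lambda>s. snd (\<gamma> s)) (snd p) (tsnd A B p Z)"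
  using velocity_map[OF smooth_atlas_prod[OF assms(1,2)] assms(2) smooth_map_snd[OF assms(1,2)]
    UNIV_I assms(3)] .

section \<open>The real line as a manifold\<close>

abbreviation rchart :: "(real, real) chart" where "rchart \<equiv> (UNIV, \<lambda>t. t)"

lemma charts_at_real [simp]: "charts_at real_atlas t = {rchart}"
  by (auto simp: charts_at_def real_atlas_def)

lemma cinv_rchart [simp]: "cinv rchart = (\<lambda>t. t)"
  by (auto simp: cinv_def fun_eq_iff inv_into_def)

lemma smooth_atlas_real: "smooth_atlas real_atlas"
  unfolding smooth_atlas_def
proof (intro conjI ballI)
  have "span {1::real} = UNIV"
  proof -
    have "x \<in> span {1}" for x :: real using span_scale[OF span_base[of "1::real" "{1}"], of x] by simp
    then show ?thesis by auto
  qed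
  then show "\<exists>B::real set. finite B \<and> span B = UNIV" by blast
  fix c assume "c \<in> real_atlas"
  then have c: "c = rchart" by (simp add: real_atlas_def)
  show "open (cdom c)" "open (cmap c ` cdom c)" by (simp_all add: c)
  show "homeomorphism (cdom c) (cmap c ` cdom c) (cmap c) (cinv c)"
    by (simp add: c homeomorphism_def)
  fix c' assume "c' \<in> real_atlas"
  then have c': "c' = rchart" by (simp add: real_atlas_def)
  show "Cinf_on (cmap c ` (cdom c \<inter> cdom c')) (cmap c' \<circ> cinv c)"
    by (simp add: c c' o_def Cinf_on_bounded_linear bounded_linear_ident)
qed (auto simp: real_atlas_def)

lemma smooth_map_open_real_iff:
  "smooth_map_open A real_atlas W f \<longleftrightarrow> open W \<and> continuous_on W f \<and>
     (\<forall>c\<in>A. Cinf_on (cmap c ` (cdom c \<inter> W)) (f \<circ> cinv c))"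
proof -
  have "{p \<in> cdom c \<inter> W. f p \<in> UNIV} = cdom c \<inter> W" for c :: "('a, 'b) chart" by auto
  then show ?thesis by (simp add: smooth_map_open_def real_atlas_def o_def)
qed

lemma smooth_map_add:
  assumes A: "smooth_atlas A" and f: "smooth_map A real_atlas f" and g: "smooth_map A real_atlas g"
  shows "smooth_map A real_atlas (\<lambda>p. f p + g p)"
  unfolding smooth_map_open_real_iff
proof (intro conjI ballI)
  show "continuous_on UNIV (\<lambda>p. f p + g p)"
    by (rule continuous_on_add[OF smooth_map_open_continuous[OF f] smooth_map_open_continuous[OF g]])
  fix c assume c: "c \<in> A"
  have "Cinf_on (cmap c ` (cdom c \<inter> UNIV)) (\<lambda>x. (f \<circ> cinv c) x + (g \<circ> cinv c) x)"
    using f g c chart_open(2)[OF A c] unfolding smooth_map_open_real_iff Int_UNIV_right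
    by (intro Cinf_on_add) blast+
  then show "Cinf_on (cmap c ` (cdom c \<inter> UNIV)) ((\<lambda>p. f p + g p) \<circ> cinv c)"
    by (simp add: o_def)
qed simp

definition rvec :: "real \<Rightarrow> (real, real) tvec" where
  "rvec r = (\<lambda>c. if c = rchart then r else 0)"

lemma velocity_real:
  "velocity real_atlas \<gamma> t v \<longleftrightarrow> \<gamma> 0 = t \<and> (\<gamma> has_real_derivative v rchart) (at 0) \<and> v = rvec (v rchart)"
  unfolding velocity_def charts_at_real rvec_def fun_eq_iff
  by (auto simp: has_real_derivative_iff_has_vector_derivative has_vector_derivative_continuous)

lemma velocity_realI:
  "(\<gamma> has_real_derivative r) (at 0) \<Longrightarrow> velocity real_atlas \<gamma> (\<gamma> 0) (rvec r)"
  by (simp add: velocity_real) (simp add: rvec_def)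

section \<open>The contact volume\<close>

definition alt_sum :: "nat \<Rightarrow> ('a list \<Rightarrow> real) \<Rightarrow> 'a list \<Rightarrow> real" where
  "alt_sum N \<phi> vs = (\<Sum>\<pi> | \<pi> permutes {..<N}. of_int (sign \<pi>) * \<phi> (map (\<lambda>i. vs ! \<pi> i) [0..<N]))"

text \<open>A permutation \<open>\<rho>\<close> of the last \<open>l\<close> positions, shifted to
  the block \<open>{k..<k + l}\<close>, can be absorbed into \<open>\<pi>\<close>. Signs multiply,
  so all \<open>fact l\<close> choices of \<open>\<rho>\<close> contribute the same sum, and nested
  antisymmetrisations collapse into one.\<close>

lemma alt_sum_tensor:
  assumes "length vs = k + l"
  shows "(\<Sum>\<pi> | \<pi> permutes {..<k + l}. of_int (sign \<pi>) * \<phi> (map (\<lambda>i. vs ! \<pi> i) [0..<k]) *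
      alt_sum l \<psi> (map (\<lambda>i. vs ! \<pi> i) [k..<k + l])) =
    fact l * (\<Sum>\<pi> | \<pi> permutes {..<k + l}. of_int (sign \<pi>) * \<phi> (map (\<lambda>i. vs ! \<pi> i) [0..<k]) *
      \<psi> (map (\<lambda>i. vs ! \<pi> i) [k..<k + l]))"
    (is "?L = fact l * ?R")
proof -
  define g :: "(nat \<Rightarrow> nat) \<Rightarrow> real" where
    "g \<pi> = of_int (sign \<pi>) * \<phi> (map (\<lambda>i. vs ! \<pi> i) [0..<k]) * \<psi> (map (\<lambda>i. vs ! \<pi> i) [k..<k + l])" for \<pi>
  have inner: "alt_sum l \<psi> (map (\<lambda>i. vs ! \<pi> i) [k..<k + l]) =
      (\<Sum>\<rho> | \<rho> permutes {..<l}. of_int (sign \<rho>) * \<psi> (map (\<lambda>i. vs ! \<pi> (k + \<rho> i)) [0..<l]))" for \<pi>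
    unfolding alt_sum_def
  proof (rule sum.cong[OF refl])
    fix \<rho> assume "\<rho> \<in> {\<rho>. \<rho> permutes {..<l}}"
    then have "\<rho> i < l" if "i < l" for i using that permutes_in_image[of \<rho> "{..<l}" i] by simp
    then show "of_int (sign \<rho>) * \<psi> (map (\<lambda>i. map (\<lambda>i. vs ! \<pi> i) [k..<k + l] ! \<rho> i) [0..<l]) =
        of_int (sign \<rho>) * \<psi> (map (\<lambda>i. vs ! \<pi> (k + \<rho> i)) [0..<l])"
      by (auto intro!: arg_cong[where f = \<psi>])
  qed
  have shift: "(\<Sum>\<pi> | \<pi> permutes {..<k + l}. of_int (sign \<pi>) * \<phi> (map (\<lambda>i. vs ! \<pi> i) [0..<k]) *
       (of_int (sign \<rho>) * \<psi> (map (\<lambda>i. vs ! \<pi> (k + \<rho> i)) [0..<l]))) = ?R"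
    if \<rho>: "\<rho> permutes {..<l}" for \<rho>
  proof -
    define \<rho>' where "\<rho>' = map_permutation {..<l} ((+) k) \<rho>"
    have bij: "bij_betw ((+) k) {..<l} {k..<k + l}"
      by (rule bij_betw_byWitness[where f' = "\<lambda>i. i - k"]) auto
    then have p0: "\<rho>' permutes {k..<k + l}"
      unfolding \<rho>'_def using map_permutation_permutes \<rho> by blast
    then have p: "\<rho>' permutes {..<k + l}" by (rule permutes_subset) auto
    have sg: "sign \<rho>' = sign \<rho>"
      unfolding \<rho>'_def using \<rho> by (intro sign_map_permutation) auto
    have low: "\<rho>' i = i" if "i < k" for i using p0 that by (auto simp: permutes_def)
    have high: "\<rho>' (k + i) = k + \<rho> i" if "i < l" for i
      using map_permutation_apply[of "(+) k" "{..<l}" i \<rho>] that bij by (simp add: \<rho>'_def)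
    have high': "map (\<lambda>i. vs ! (\<pi> \<circ> \<rho>') i) [k..<k + l] = map (\<lambda>i. vs ! \<pi> (k + \<rho> i)) [0..<l]" for \<pi>
      by (rule nth_equalityI) (auto simp: high)
    have low': "map (\<lambda>i. vs ! (\<pi> \<circ> \<rho>') i) [0..<k] = map (\<lambda>i. vs ! \<pi> i) [0..<k]" for \<pi>
      by (auto simp: low)
    have "?R = sum g {\<pi>. \<pi> permutes {..<k + l}}" by (simp add: g_def)
    also have "\<dots> = (\<Sum>\<pi> | \<pi> permutes {..<k + l}. g (\<pi> \<circ> \<rho>'))"
      by (rule sum_permutations_compose_right[OF p])
    also have "\<dots> = (\<Sum>\<pi> | \<pi> permutes {..<k + l}. of_int (sign \<pi>) * \<phi> (map (\<lambda>i. vs ! \<pi> i) [0..<k]) *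
       (of_int (sign \<rho>) * \<psi> (map (\<lambda>i. vs ! \<pi> (k + \<rho> i)) [0..<l])))"
    proof (rule sum.cong[OF refl])
      fix \<pi> assume "\<pi> \<in> {\<pi>. \<pi> permutes {..<k + l}}"
      then have "permutation \<pi>" "permutation \<rho>'"
        using p permutation_permutes finite_lessThan by blast+
      then have "sign (\<pi> \<circ> \<rho>') = sign \<pi> * sign \<rho>" by (simp add: sign_compose sg)
      then show "g (\<pi> \<circ> \<rho>') = of_int (sign \<pi>) * \<phi> (map (\<lambda>i. vs ! \<pi> i) [0..<k]) *
         (of_int (sign \<rho>) * \<psi> (map (\<lambda>i. vs ! \<pi> (k + \<rho> i)) [0..<l]))"
        unfolding g_def low' high' by simp
    qed
    finally show ?thesis by simp
  qed
  have "?L = (\<Sum>\<pi> | \<pi> permutes {..<k + l}. \<Sum>\<rho> | \<rho> permutes {..<l}.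
      of_int (sign \<pi>) * \<phi> (map (\<lambda>i. vs ! \<pi> i) [0..<k]) * (of_int (sign \<rho>) * \<psi> (map (\<lambda>i. vs ! \<pi> (k
        + \<rho> i)) [0..<l])))"
    unfolding inner by (simp add: sum_distrib_left)
  also have "\<dots> = (\<Sum>\<rho> | \<rho> permutes {..<l}. ?R)"
    unfolding sum.swap[of _ "{\<rho>. \<rho> permutes {..<l}}"] by (rule sum.cong[OF refl]) (use shift in simp)
  also have "\<dots> = fact l * ?R" by (simp add: card_permutations)
  finally show ?thesis .
qed

text \<open>The factor \<open>fact l\<close> produced by the inner antisymmetrisation cancels the
  one in \<open>wedge\<close>; only \<open>fact k\<close> survives.\<close>

lemma wedge_alt_sum:
  assumes "length vs = k + l" and \<beta>: "\<And>ws. length ws = l \<Longrightarrow> \<beta> p ws = c * alt_sum l \<psi> ws"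
  shows "wedge k l \<alpha> \<beta> p vs = c / fact k *
    (\<Sum>\<pi> | \<pi> permutes {..<k + l}. of_int (sign \<pi>) * \<alpha> p (map (\<lambda>i. vs ! \<pi> i) [0..<k]) *
      \<psi> (map (\<lambda>i. vs ! \<pi> i) [k..<k + l]))"
proof -
  have "wedge k l \<alpha> \<beta> p vs = c * (\<Sum>\<pi> | \<pi> permutes {..<k + l}.
      of_int (sign \<pi>) * \<alpha> p (map (\<lambda>i. vs ! \<pi> i) [0..<k]) * alt_sum l \<psi> (map (\<lambda>i. vs ! \<pi> i) [k..<k + l]))
      / (fact k * fact l)"
    unfolding wedge_def by (simp add: \<beta> sum_distrib_left ac_simps)
  then show ?thesis unfolding alt_sum_tensor[OF assms(1)] by simp
qed

text \<open>Every wedge with the 2-form contributes a factor \<open>1 / fact 2\<close>.\<close>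

lemma wedge_power_alt_sum:
  "length vs = 2 * n \<Longrightarrow>
     wedge_power 2 \<beta> n p vs = (1 / 2) ^ n * alt_sum (2 * n) (\<lambda>ws. \<Prod>i<n. \<beta> p [ws ! (2 * i), ws ! (2
       * i + 1)]) vs"
proof (induction n arbitrary: vs)
  case 0
  then show ?case by (simp add: zero_form_def alt_sum_def)
next
  case (Suc n)
  let ?\<psi> = "\<lambda>ws. \<Prod>i<n. \<beta> p [ws ! (2 * i), ws ! (2 * i + 1)]"
  have len: "length vs = 2 + 2 * n" using Suc.prems by simp
  have "wedge_power 2 \<beta> (Suc n) p vs = (1 / 2) ^ n / fact 2 *
    (\<Sum>\<pi> | \<pi> permutes {..<2 + 2 * n}. of_int (sign \<pi>) * \<beta> p (map (\<lambda>i. vs ! \<pi> i) [0..<2]) *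
      ?\<psi> (map (\<lambda>i. vs ! \<pi> i) [2..<2 + 2 * n]))"
    unfolding wedge_power.simps by (rule wedge_alt_sum[OF len]) (rule Suc.IH)
  also have "\<dots> = (1 / 2) ^ Suc n * (\<Sum>\<pi> | \<pi> permutes {..<2 + 2 * n}. of_int (sign \<pi>) *
      (\<Prod>i<Suc n. \<beta> p [map (\<lambda>i. vs ! \<pi> i) [0..<2 + 2 * n] ! (2 * i), map (\<lambda>i. vs ! \<pi> i) [0..<2 + 2
        * n] ! (2 * i + 1)]))"
  proof -
    have "\<beta> p (map (\<lambda>i. vs ! \<pi> i) [0..<2]) * ?\<psi> (map (\<lambda>i. vs ! \<pi> i) [2..<2 + 2 * n]) =
      (\<Prod>i<Suc n. \<beta> p [map (\<lambda>i. vs ! \<pi> i) [0..<2 + 2 * n] ! (2 * i), map (\<lambda>i. vs ! \<pi> i) [0..<2 + 2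
        * n] ! (2 * i + 1)])" for \<pi>
    proof -
      have "[0..<2] = [0, 1::nat]" by (simp add: upt_rec)
      then have "\<beta> p (map (\<lambda>i. vs ! \<pi> i) [0..<2]) = \<beta> p [map (\<lambda>i. vs ! \<pi> i) [0..<2 + 2 * n] ! (2 *
        0), map (\<lambda>i. vs ! \<pi> i) [0..<2 + 2 * n] ! (2 * 0 + 1)]"
        by (simp del: upt_Suc)
      moreover have "?\<psi> (map (\<lambda>i. vs ! \<pi> i) [2..<2 + 2 * n]) =
         (\<Prod>i<n. \<beta> p [map (\<lambda>i. vs ! \<pi> i) [0..<2 + 2 * n] ! (2 * Suc i), map (\<lambda>i. vs ! \<pi> i) [0..<2 +
           2 * n] ! (2 * Suc i + 1)])"
        by (rule prod.cong[OF refl]) (auto simp del: upt_Suc)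
      ultimately show ?thesis by (simp only: prod.lessThan_Suc_shift)
    qed
    then show ?thesis by (simp add: mult.assoc)
  qed
  also have "\<dots> = (1 / 2) ^ Suc n * alt_sum (2 * Suc n) (\<lambda>ws. \<Prod>i<Suc n. \<beta> p [ws ! (2 * i), ws ! (2 * i + 1)]) vs"
    by (simp add: alt_sum_def del: prod.lessThan_Suc)
  finally show ?case .
qed

text \<open>Antisymmetrised, this is the volume form \<open>a \<and> b\<^sup>n\<close> up to a constant factor.\<close>
definition contact_tensor :: "nat \<Rightarrow> ('a \<Rightarrow> real) \<Rightarrow> ('a \<Rightarrow> 'a \<Rightarrow> real) \<Rightarrow> (nat \<Rightarrow> 'a) \<Rightarrow> real" where
  "contact_tensor n a b w = a (w 0) * (\<Prod>i<n. b (w (2 * i + 1)) (w (2 * i + 2)))"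

definition contact_volume :: "nat \<Rightarrow> ('a \<Rightarrow> real) \<Rightarrow> ('a \<Rightarrow> 'a \<Rightarrow> real) \<Rightarrow> (nat \<Rightarrow> 'a) \<Rightarrow> real" where
  "contact_volume n a b v = (\<Sum>\<pi> | \<pi> permutes {..<2 * n + 1}. of_int (sign \<pi>) * contact_tensor n a b (v \<circ> \<pi>))"

text \<open>In the application \<open>v i\<close> is the coordinate vector of \<open>vs ! i\<close>,
  so that the volume is computed from linear maps on a Euclidean space.\<close>

lemma contact_volume_wedge:
  assumes len: "length vs = 2 * n + 1"
    and a: "\<And>i. i < 2 * n + 1 \<Longrightarrow> \<eta> p [vs ! i] = a (v i)"
    and b: "\<And>i j. i < 2 * n + 1 \<Longrightarrow> j < 2 * n + 1 \<Longrightarrow> \<beta> p [vs ! i, vs ! j] = b (v i) (v j)"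
  shows "wedge 1 (2 * n) \<eta> (wedge_power 2 \<beta> n) p vs = (1 / 2) ^ n * contact_volume n a b v"
proof -
  have len': "length vs = 1 + 2 * n" using len by simp
  have "wedge 1 (2 * n) \<eta> (wedge_power 2 \<beta> n) p vs = (1 / 2) ^ n / fact 1 *
    (\<Sum>\<pi> | \<pi> permutes {..<1 + 2 * n}. of_int (sign \<pi>) * \<eta> p (map (\<lambda>i. vs ! \<pi> i) [0..<1]) *
      (\<Prod>i<n. \<beta> p [map (\<lambda>i. vs ! \<pi> i) [1..<1 + 2 * n] ! (2 * i), map (\<lambda>i. vs ! \<pi> i) [1..<1 + 2 * n]
        ! (2 * i + 1)]))"
    by (rule wedge_alt_sum[OF len']) (rule wedge_power_alt_sum)
  also have "(\<Sum>\<pi> | \<pi> permutes {..<1 + 2 * n}. of_int (sign \<pi>) * \<eta> p (map (\<lambda>i. vs ! \<pi> i) [0..<1]) *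
      (\<Prod>i<n. \<beta> p [map (\<lambda>i. vs ! \<pi> i) [1..<1 + 2 * n] ! (2 * i), map (\<lambda>i. vs ! \<pi> i) [1..<1 + 2 * n]
        ! (2 * i + 1)]))
    = (\<Sum>\<pi> | \<pi> permutes {..<1 + 2 * n}. of_int (sign \<pi>) * contact_tensor n a b (v \<circ> \<pi>))"
  proof (rule sum.cong[OF refl])
    fix \<pi> assume "\<pi> \<in> {\<pi>. \<pi> permutes {..<1 + 2 * n}}"
    then have \<pi>: "\<pi> i < 2 * n + 1" if "i < 2 * n + 1" for i
      using that permutes_in_image[of \<pi> "{..<1 + 2 * n}" i] by simp
    have "(\<Prod>i<n. \<beta> p [map (\<lambda>i. vs ! \<pi> i) [1..<1 + 2 * n] ! (2 * i), map (\<lambda>i. vs ! \<pi> i) [1..<1 + 2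
      * n] ! (2 * i + 1)])
       = (\<Prod>i<n. b ((v \<circ> \<pi>) (2 * i + 1)) ((v \<circ> \<pi>) (2 * i + 2)))"
    proof (rule prod.cong[OF refl])
      fix i assume "i \<in> {..<n}"
      then have i: "2 * i + 1 < 2 * n + 1" "2 * i + 2 < 2 * n + 1" by auto
      then have "map (\<lambda>i. vs ! \<pi> i) [1..<1 + 2 * n] ! (2 * i) = vs ! \<pi> (2 * i + 1)"
        "map (\<lambda>i. vs ! \<pi> i) [1..<1 + 2 * n] ! (2 * i + 1) = vs ! \<pi> (2 * i + 2)"
        by (simp_all del: upt_Suc)
      then show "\<beta> p [map (\<lambda>i. vs ! \<pi> i) [1..<1 + 2 * n] ! (2 * i), map (\<lambda>i. vs ! \<pi> i) [1..<1 + 2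
        * n] ! (2 * i + 1)]
         = b ((v \<circ> \<pi>) (2 * i + 1)) ((v \<circ> \<pi>) (2 * i + 2))"
        using b[OF \<pi>[OF i(1)] \<pi>[OF i(2)]] by (simp only: o_apply)
    qed
    moreover have "\<eta> p (map (\<lambda>i. vs ! \<pi> i) [0..<1]) = a ((v \<circ> \<pi>) 0)" using a[OF \<pi>, of 0] by simp
    ultimately show "of_int (sign \<pi>) * \<eta> p (map (\<lambda>i. vs ! \<pi> i) [0..<1]) *
         (\<Prod>i<n. \<beta> p [map (\<lambda>i. vs ! \<pi> i) [1..<1 + 2 * n] ! (2 * i), map (\<lambda>i. vs ! \<pi> i) [1..<1 + 2 *
           n] ! (2 * i + 1)])
        = of_int (sign \<pi>) * contact_tensor n a b (v \<circ> \<pi>)"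
      by (simp only: contact_tensor_def mult.assoc)
  qed
  also have "(1 / 2) ^ n / fact 1 * \<dots> = (1 / 2) ^ n * contact_volume n a b v"
    by (simp add: contact_volume_def)
  finally show ?thesis .
qed

section \<open>Linear algebra of the contact condition\<close>

context
  fixes n :: nat and a :: "'a::euclidean_space \<Rightarrow> real" and b :: "'a \<Rightarrow> 'a \<Rightarrow> real"
  assumes a: "linear a" and b1: "\<And>y. linear (\<lambda>x. b x y)" and b2: "\<And>x. linear (b x)"
begin

lemma contact_tensor_linear:
  assumes "l < 2 * n + 1"
  shows "linear (\<lambda>x. contact_tensor n a b (w(l := x)))"
proof (cases "l = 0")
  case True
  then have "contact_tensor n a b (w(l := x)) = a x * (\<Prod>i<n. b (w (2 * i + 1)) (w (2 * i + 2)))" for x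
    by (simp add: contact_tensor_def)
  then show ?thesis
    using linear_compose[OF a, of "\<lambda>r. r * (\<Prod>i<n. b (w (2 * i + 1)) (w (2 * i + 2)))"]
    by (simp add: o_def bounded_linear.linear[OF bounded_linear_mult_left])
next
  case False
  \<comment> \<open>Position 0 belongs to \<open>a\<close>, and the others are paired by
    \<open>b\<close> as \<open>2 * i + 1\<close> with \<open>2 * i + 2\<close>; \<open>i0\<close> is
    the index of the pair that contains \<open>l\<close>.\<close>
  define i0 where "i0 = (l - 1) div 2"
  have i0: "i0 < n" "l = 2 * i0 + 1 \<or> l = 2 * i0 + 2" using False assms by (auto simp: i0_def)
  define C where "C = a (w 0) * (\<Prod>i\<in>{..<n} - {i0}. b (w (2 * i + 1)) (w (2 * i + 2)))"
  define f where "f x = b ((w(l := x)) (2 * i0 + 1)) ((w(l := x)) (2 * i0 + 2))" for x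
  have "contact_tensor n a b (w(l := x)) = f x * C" for x
  proof -
    have "(\<Prod>i\<in>{..<n} - {i0}. b ((w(l := x)) (2 * i + 1)) ((w(l := x)) (2 * i + 2))) =
        (\<Prod>i\<in>{..<n} - {i0}. b (w (2 * i + 1)) (w (2 * i + 2)))"
      by (rule prod.cong[OF refl]) (use i0 in auto)
    then show ?thesis
      using False i0(1) prod.remove[of "{..<n}" i0 "\<lambda>i. b ((w(l := x)) (2 * i + 1)) ((w(l := x)) (2 * i + 2))"]
      by (simp add: contact_tensor_def C_def f_def)
  qed
  moreover have "linear f"
    using i0(2)
  proof
    assume "l = 2 * i0 + 1"
    then show ?thesis using b1 by (simp add: f_def[abs_def])
  next
    assume "l = 2 * i0 + 2"
    then show ?thesis using b2 by (simp add: f_def[abs_def])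
  qed
  ultimately show ?thesis
    using linear_compose[of f "\<lambda>r. r * C"]
      by (simp add: o_def bounded_linear.linear[OF bounded_linear_mult_left])
qed

lemma contact_volume_linear:
  assumes "j < 2 * n + 1"
  shows "linear (\<lambda>x. contact_volume n a b (v(j := x)))"
  unfolding contact_volume_def
proof (rule linear_compose_sum, rule ballI)
  fix \<pi> assume "\<pi> \<in> {\<pi>. \<pi> permutes {..<2 * n + 1}}"
  then have \<pi>: "\<pi> permutes {..<2 * n + 1}" by simp
  have "v(j := x) \<circ> \<pi> = (v \<circ> \<pi>)(inv \<pi> j := x)" for x
    by (rule ext) (use permutes_inverses[OF \<pi>] in auto)
  moreover have "inv \<pi> j < 2 * n + 1"
    using permutes_in_image[OF permutes_inv[OF \<pi>]] assms by (metis lessThan_iff)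
  ultimately show "linear (\<lambda>x. of_int (sign \<pi>) * contact_tensor n a b (v(j := x) \<circ> \<pi>))"
    using linear_compose[OF contact_tensor_linear, of "inv \<pi> j" "\<lambda>r. of_int (sign \<pi>) * r" "v \<circ> \<pi>"]
    by (simp add: o_def bounded_linear.linear[OF bounded_linear_mult_right])
qed

text \<open>Reindexing by the transposition of \<open>i\<close> and \<open>j\<close> leaves all
  arguments as they are and flips every sign.\<close>

lemma contact_volume_repeat:
  assumes "i < 2 * n + 1" "j < 2 * n + 1" "i \<noteq> j" "v i = v j"
  shows "contact_volume n a b v = 0"
proof -
  let ?\<tau> = "Transposition.transpose i j" and ?S = "{..<2 * n + 1}"
  have \<tau>: "?\<tau> permutes ?S" using assms by (intro permutes_swap_id) auto
  have v: "v \<circ> (?\<tau> \<circ> \<pi>) = v \<circ> \<pi>" for \<pi>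
  proof -
    have "v (?\<tau> x) = v x" for x using assms(4) by (cases "x = i"; cases "x = j") simp_all
    then show ?thesis by (simp add: fun_eq_iff)
  qed
  have "contact_volume n a b v = (\<Sum>\<pi> | \<pi> permutes ?S. of_int (sign (?\<tau> \<circ> \<pi>)) * contact_tensor n a
    b (v \<circ> (?\<tau> \<circ> \<pi>)))"
    unfolding contact_volume_def
    using setum_permutations_compose_left[OF \<tau>, of "\<lambda>\<pi>. of_int (sign \<pi>) * contact_tensor n a b (v \<circ> \<pi>)"] .
  also have "\<dots> = (\<Sum>\<pi> | \<pi> permutes ?S. - (of_int (sign \<pi>) * contact_tensor n a b (v \<circ> \<pi>)))"
  proof (rule sum.cong[OF refl])
    fix \<pi> assume "\<pi> \<in> {\<pi>. \<pi> permutes ?S}"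
    then have "permutation \<pi>" using permutation_permutes finite_lessThan by blast
    then have "sign (?\<tau> \<circ> \<pi>) = - sign \<pi>"
      using assms by (simp add: sign_compose permutation_swap_id sign_swap_id)
    then show "of_int (sign (?\<tau> \<circ> \<pi>)) * contact_tensor n a b (v \<circ> (?\<tau> \<circ> \<pi>)) = - (of_int (sign \<pi>) *
      contact_tensor n a b (v \<circ> \<pi>))"
      by (simp add: v)
  qed
  also have "\<dots> = - contact_volume n a b v" by (simp add: contact_volume_def sum_negf)
  finally show ?thesis by simp
qed

text \<open>In each term in which \<open>X\<close> is paired with some \<open>y\<close> by \<open>b\<close>, the factor \<open>b X y\<close> is a multiple of
  \<open>a y\<close>, and the term cancels against the one in which \<open>y\<close> is exchanged with the argument of \<open>a\<close>.\<close>
lemma contact_volume_kernel: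
  assumes anti: "\<And>x y. b x y = - b y x" and X: "a X = 0" "\<And>y. b X y = \<tau> * a y"
    and j: "j < 2 * n + 1" "v j = X"
  shows "contact_volume n a b v = 0"
proof -
  let ?S = "{..<2 * n + 1}"
  \<comment> \<open>\<open>mate l\<close> is the position paired with \<open>l\<close>, and
    \<open>F\<close> is the involution that exchanges the mate of the position of \<open>X\<close>
    with position 0. It fixes the terms in which \<open>X\<close> stands at position 0, and these
    are 0 because \<open>a X = 0\<close>.\<close>
  define mate where "mate l = (if odd l then l + 1 else l - 1)" for l :: nat
  define F where "F \<pi> = (if inv \<pi> j = 0 then \<pi> else \<pi> \<circ> Transposition.transpose 0 (mate (inv \<pi>
    j)))" for \<pi> :: "nat \<Rightarrow> nat"
  define t where "t \<pi> = of_int (sign \<pi>) * contact_tensor n a b (v \<circ> \<pi>)" for \<pi>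
  have mate: "mate l < 2 * n + 1" "mate l \<noteq> l" "mate l \<noteq> 0" if "l \<noteq> 0" "l < 2 * n + 1" for l
    using that by (auto simp: mate_def elim!: oddE evenE)
  have inv_lt: "inv \<pi> j < 2 * n + 1" if "\<pi> permutes ?S" for \<pi>
    using permutes_in_image[OF permutes_inv[OF that]] j(1) by (metis lessThan_iff)
  have main: "F \<pi> permutes ?S \<and> F (F \<pi>) = \<pi> \<and> t (F \<pi>) = - t \<pi>" if \<pi>: "\<pi> permutes ?S" for \<pi>
  proof (cases "inv \<pi> j = 0")
    case True
    then have "\<pi> 0 = j" using permutes_inverses(1)[OF \<pi>, of j] by simp
    then have "t \<pi> = 0" by (simp add: t_def contact_tensor_def j X)
    then show ?thesis using True \<pi> by (simp add: F_def)
  next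
    case False
    define l where "l = inv \<pi> j"
    define m where "m = mate l"
    have l: "l \<noteq> 0" "l < 2 * n + 1" "\<pi> l = j"
      using False inv_lt[OF \<pi>] permutes_inverses(1)[OF \<pi>, of j] by (auto simp: l_def)
    have m: "m < 2 * n + 1" "m \<noteq> l" "m \<noteq> 0" using mate l by (auto simp: m_def)
    let ?s = "Transposition.transpose 0 m"
    have F\<pi>: "F \<pi> = \<pi> \<circ> ?s" using False by (simp add: F_def l_def m_def)
    have s: "?s permutes ?S" using m by (intro permutes_swap_id) auto
    have p: "F \<pi> permutes ?S" unfolding F\<pi> by (rule permutes_compose[OF s \<pi>])
    have Fl: "F \<pi> l = j" using l m by (simp add: F\<pi> transpose_def)
    then have inv': "inv (F \<pi>) j = l" using permutes_inverses(2)[OF p, of l] by simp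
    then have FF: "F (F \<pi>) = \<pi>"
      using l m by (simp add: F_def[of "F \<pi>"] m_def[symmetric]) (simp add: F\<pi> o_assoc[symmetric])
    have "permutation \<pi>" using \<pi> permutation_permutes finite_lessThan by blast
    then have sg: "sign (F \<pi>) = - sign \<pi>"
      using m by (simp add: F\<pi> sign_compose permutation_swap_id sign_swap_id)
    define i0 where "i0 = (l - 1) div 2"
    have i0: "i0 < n" using l by (auto simp: i0_def)
    have lm: "l = 2 * i0 + 1 \<and> m = 2 * i0 + 2 \<or> m = 2 * i0 + 1 \<and> l = 2 * i0 + 2"
      using l by (auto simp: i0_def m_def mate_def elim!: oddE evenE)
    \<comment> \<open>The sign records whether \<open>X\<close> is the first or the second entry of
      its pair.\<close>
    define s' where "s' = (if l = 2 * i0 + 1 then \<tau> else - \<tau>)"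
    define w where "w = v \<circ> \<pi>"
    define w' where "w' = v \<circ> F \<pi>"
    have ww: "w' 0 = w m" "w' m = w 0" "w l = X" "w' l = X"
      and same: "\<And>i. i \<noteq> 0 \<Longrightarrow> i \<noteq> m \<Longrightarrow> w' i = w i"
      using l m Fl j by (auto simp: w_def w'_def F\<pi> transpose_def)
    have pair: "b (x (2 * i0 + 1)) (x (2 * i0 + 2)) = s' * a (x m)" if "x l = X" for x
      using lm
    proof
      assume "l = 2 * i0 + 1 \<and> m = 2 * i0 + 2"
      then show ?thesis using that X(2) by (auto simp: s'_def)
    next
      assume *: "m = 2 * i0 + 1 \<and> l = 2 * i0 + 2"
      then have "b (x (2 * i0 + 1)) (x (2 * i0 + 2)) = b (x m) X" using that by simp
      then show ?thesis using anti[of "x m" X] X(2) * by (simp add: s'_def)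
    qed
    have T: "contact_tensor n a b x = a (x 0) * (s' * a (x m)) * (\<Prod>i\<in>{..<n} - {i0}. b (x (2 * i +
      1)) (x (2 * i + 2)))"
      if "x l = X" for x
      using prod.remove[of "{..<n}" i0 "\<lambda>i. b (x (2 * i + 1)) (x (2 * i + 2))"] i0 pair[of x, OF that]
      by (simp add: contact_tensor_def)
    have "(\<Prod>i\<in>{..<n} - {i0}. b (w' (2 * i + 1)) (w' (2 * i + 2))) = (\<Prod>i\<in>{..<n} - {i0}. b (w (2 * i
      + 1)) (w (2 * i + 2)))"
    proof (rule prod.cong[OF refl])
      fix i assume "i \<in> {..<n} - {i0}"
      then have "i \<noteq> i0" by simp
      moreover have "m = 2 * i0 + 2 \<or> m = 2 * i0 + 1" using lm by blast
      ultimately have "2 * i + 1 \<noteq> m" "2 * i + 2 \<noteq> m" by presburger+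
      then show "b (w' (2 * i + 1)) (w' (2 * i + 2)) = b (w (2 * i + 1)) (w (2 * i + 2))"
        by (simp add: same)
    qed
    \<comment> \<open>By \<open>T\<close> the exchange of positions 0 and \<open>m\<close> merely
      swaps the factors \<open>a (x 0)\<close> and \<open>a (x m)\<close>; the sign of the
      permutation does change.\<close>
    then have "contact_tensor n a b w' = contact_tensor n a b w" using T ww by simp
    then have "t (F \<pi>) = - t \<pi>" by (simp add: t_def sg w_def w'_def)
    then show ?thesis using p FF by simp
  qed
  have bij: "bij_betw F {\<pi>. \<pi> permutes ?S} {\<pi>. \<pi> permutes ?S}"
    by (rule bij_betw_byWitness[where f' = F]) (use main in auto)
  have "contact_volume n a b v = sum t {\<pi>. \<pi> permutes ?S}" by (simp add: contact_volume_def t_def)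
  also have "\<dots> = (\<Sum>\<pi> | \<pi> permutes ?S. t (F \<pi>))"
    using sum.reindex_bij_betw[OF bij, of t] by simp
  also have "\<dots> = - sum t {\<pi>. \<pi> permutes ?S}" using main by (simp add: sum_negf)
  finally have "contact_volume n a b v = - contact_volume n a b v"
    by (simp add: contact_volume_def t_def)
  then show ?thesis by simp
qed

text \<open>An alternating multilinear function vanishes on dependent vectors.\<close>

lemma contact_volume_independent:
  assumes nz: "contact_volume n a b v \<noteq> 0"
  shows "inj_on v {..<2 * n + 1}" "independent (v ` {..<2 * n + 1})"
proof -
  let ?S = "{..<2 * n + 1}"
  show inj: "inj_on v ?S"
    using contact_volume_repeat nz by (auto simp: inj_on_def)
  show "independent (v ` ?S)"
  proof (rule ccontr)
    assume "\<not> independent (v ` ?S)"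
    then obtain j where j: "j \<in> ?S" "v j \<in> span (v ` ?S - {v j})" by (auto simp: dependent_def)
    have lin: "linear (\<lambda>x. contact_volume n a b (v(j := x)))"
      using j by (intro contact_volume_linear) simp
    have "contact_volume n a b (v(j := x)) = 0" if x: "x \<in> v ` ?S - {v j}" for x
    proof -
      obtain i where i: "i \<in> ?S" "x = v i" "v i \<noteq> v j" using x by auto
      then have "i \<noteq> j" by auto
      then show ?thesis using i j by (intro contact_volume_repeat[of i j]) auto
    qed
    then have "contact_volume n a b (v(j := v j)) = 0"
      using linear_eq_0_on_span[OF lin _ j(2)] by blast
    then show False using nz by simp
  qed
qed

text \<open>By dimension the \<open>v i\<close> form a basis. Putting \<open>X\<close> in place of
  \<open>v j\<close> multiplies the volume by the coefficient of \<open>X\<close> at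
  \<open>v j\<close>, as in Cramer's rule, but the result is 0 by
  \<open>contact_volume_kernel\<close>. So \<open>X = 0\<close>, whence
  \<open>\<tau> * a y = 0\<close> for all \<open>y\<close> while \<open>a\<close> is not zero. The
  multiplier \<open>\<tau>\<close> is there for \<Omega>: a vector in its kernel with
  \<open>dt\<close> component \<open>r\<close> over \<open>X\<close> has
  \<open>b X y = - r * a y\<close>.\<close>

lemma contact_nondegenerate:
  assumes dim: "DIM('a) = 2 * n + 1" and nz: "contact_volume n a b v \<noteq> 0"
    and anti: "\<And>x y. b x y = - b y x" and X: "a X = 0" "\<And>y. b X y = \<tau> * a y"
  shows "X = 0" "\<tau> = 0"
proof -
  let ?S = "{..<2 * n + 1}"
  note ind = contact_volume_independent[OF nz]
  have "UNIV \<subseteq> span (v ` ?S)"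
    by (rule card_ge_dim_independent) (use ind dim in \<open>auto simp: card_image\<close>)
  then obtain u where u: "X = (\<Sum>x\<in>v ` ?S. u x *\<^sub>R x)"
    using span_finite[of "v ` ?S"] by auto
  then have X_eq: "X = (\<Sum>i\<in>?S. u (v i) *\<^sub>R v i)" using sum.reindex[OF ind(1)] by simp
  have "u (v j) = 0" if j: "j \<in> ?S" for j
  proof -
    have lin: "linear (\<lambda>x. contact_volume n a b (v(j := x)))"
      using j by (intro contact_volume_linear) simp
    have "0 = contact_volume n a b (v(j := X))"
      using contact_volume_kernel[OF anti X, of j "v(j := X)"] j by simp
    also have "\<dots> = (\<Sum>i\<in>?S. u (v i) * contact_volume n a b (v(j := v i)))"
      unfolding X_eq linear_sum[OF lin] by (simp add: linear_scale[OF lin])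
    also have "\<dots> = (\<Sum>i\<in>?S. if i = j then u (v j) * contact_volume n a b v else 0)"
    proof (rule sum.cong[OF refl])
      fix i assume i: "i \<in> ?S"
      show "u (v i) * contact_volume n a b (v(j := v i)) = (if i = j then u (v j) * contact_volume
        n a b v else 0)"
      proof (cases "i = j")
        case False
        then have "contact_volume n a b (v(j := v i)) = 0"
          using i j by (intro contact_volume_repeat[of i j]) auto
        then show ?thesis using False by simp
      qed simp
    qed
    also have "\<dots> = u (v j) * contact_volume n a b v" using j by (simp add: sum.delta')
    finally show ?thesis using nz by simp
  qed
  then show X0: "X = 0" using X_eq by simp
  show "\<tau> = 0"
  proof (rule ccontr)
    assume "\<tau> \<noteq> 0"
    then have "a y = 0" for y using X(2)[of y] X0 linear_0[OF b1[of y]] by simp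
    then show False using nz by (simp add: contact_volume_def contact_tensor_def)
  qed
qed

end

section \<open>Lie groupoids\<close>

lemma tmap_fst_snd_coord:
  assumes A: "smooth_atlas A" and B: "smooth_atlas B" and Z: "Z \<in> tspace (prod_atlas A B) p"
    and c: "c \<in> charts_at A (fst p)" and d: "d \<in> charts_at B (snd p)"
  shows "Z (cprod c d) = (tfst A B p Z c, tsnd A B p Z d)"
proof -
  note AB = smooth_atlas_prod[OF A B]
  have cd: "cprod c d \<in> charts_at (prod_atlas A B) p"
    using cprod_charts_at[OF c d] by simp
  obtain \<gamma> where \<gamma>: "velocity (prod_atlas A B) \<gamma> p Z" using tspace_velocity[OF AB Z] .
  have "((\<lambda>s. (cmap c (fst (\<gamma> s)), cmap d (snd (\<gamma> s)))) has_vector_derivative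
      (tfst A B p Z c, tsnd A B p Z d)) (at 0)"
    using has_derivative_Pair[OF velocityD(3)[OF velocity_fst[OF A B \<gamma>] c, unfolded has_vector_derivative_def]
        velocityD(3)[OF velocity_snd[OF A B \<gamma>] d, unfolded has_vector_derivative_def]]
    by (simp add: has_vector_derivative_def)
  moreover have "((\<lambda>s. (cmap c (fst (\<gamma> s)), cmap d (snd (\<gamma> s)))) has_vector_derivative Z (cprod c d)) (at 0)"
    using velocityD(3)[OF \<gamma> cd] by (simp add: map_prod_def split_def)
  ultimately show ?thesis using vector_derivative_unique_at by blast
qed

lemma tmap_compose:
  assumes A: "smooth_atlas A" and B: "smooth_atlas B" and C: "smooth_atlas C"
    and f: "smooth_map A B f" and g: "smooth_map B C g" and gf: "smooth_map A C (\<lambda>p. g (f p))"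
    and v: "v \<in> tspace A p"
  shows "tmap A C (\<lambda>p. g (f p)) p v = tmap B C g (f p) (tmap A B f p v)"
proof -
  obtain \<gamma> where \<gamma>: "velocity A \<gamma> p v" using tspace_velocity[OF A v] .
  show ?thesis
    using velocity_eq[OF velocity_map[OF A C gf UNIV_I \<gamma>]
        velocity_map[OF B C g UNIV_I velocity_map[OF A B f UNIV_I \<gamma>]]] .
qed

lemma tmap_const:
  assumes A: "smooth_atlas A" and B: "smooth_atlas B" and v: "v \<in> tspace A p"
  shows "tmap A B (\<lambda>p. q) p v = (\<lambda>_. 0)"
proof -
  obtain \<gamma> where \<gamma>: "velocity A \<gamma> p v" using tspace_velocity[OF A v] .
  show ?thesis
    using velocity_eq[OF velocity_map[OF A B smooth_map_open_const[OF A open_UNIV] UNIV_I \<gamma>] velocity_const] .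
qed

lemma submersion_onto:
  assumes "submersion A B f" "w \<in> tspace B (f p)"
  obtains Z where "Z \<in> tspace A p" "tmap A B f p Z = w"
proof -
  have "w \<in> tmap A B f p ` tspace A p" using assms by (simp add: submersion_def)
  then show thesis using that by blast
qed

lemma fibre_curve:
  fixes A :: "('m::{t2_space,second_countable_topology}, 'd::euclidean_space) chart set"
    and B :: "('n::{t2_space,second_countable_topology}, 'e::real_normed_vector) chart set"
  assumes A: "smooth_atlas A" and B: "smooth_atlas B" and f: "submersion A B f"
    and v: "v \<in> tspace A p" "tmap A B f p v = (\<lambda>_. 0)"
  obtains \<gamma> where "velocity A \<gamma> p v" "\<forall>\<^sub>F s in nhds 0. f (\<gamma> s) = f p"
proof (rule equalizer_curve[OF A B _ _ _ _ v(1)])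
  show "smooth_map A B f" using f by (simp add: submersion_def)
  show "smooth_map A B (\<lambda>q. f p)" by (rule smooth_map_open_const[OF A open_UNIV])
  show "tmap A B f p v = tmap A B (\<lambda>q. f p) p v" using v by (simp add: tmap_const[OF A B])
  fix w assume "w \<in> tspace B (f p)"
  then obtain Z where "Z \<in> tspace A p" "tmap A B f p Z = w" using submersion_onto[OF f] by blast
  then show "\<exists>Z\<in>tspace A p. tmap A B f p Z - tmap A B (\<lambda>q. f p) p Z = w"
    by (intro bexI[of _ Z]) (auto simp: tmap_const[OF A B] fun_eq_iff)
qed (use that in auto)

lemma lie_groupoidD:
  assumes "lie_groupoid G"
  shows "smooth_atlas (arr G)" "smooth_atlas (obj G)"
    "submersion (arr G) (obj G) (src G)" "submersion (arr G) (obj G) (tgt G)"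
    "smooth_map (arr G) (obj G) (src G)" "smooth_map (arr G) (obj G) (tgt G)"
    "smooth_map (obj G) (arr G) (idt G)"
    "\<And>p. p \<in> composable G \<Longrightarrow> \<exists>F. local_extension (arr2 G) (arr G) (composable G) (mul G) p F"
    "\<And>x. src G (idt G x) = x" "\<And>x. tgt G (idt G x) = x"
    "\<And>g h. src G g = tgt G h \<Longrightarrow> src G (mul G (g, h)) = src G h"
    "\<And>g h. src G g = tgt G h \<Longrightarrow> tgt G (mul G (g, h)) = tgt G g"
    "\<And>g h k. src G g = tgt G h \<Longrightarrow> src G h = tgt G k \<Longrightarrow> mul G (mul G (g, h), k) = mul G (g, mul G (h, k))"
    "\<And>g. mul G (g, idt G (src G g)) = g" "\<And>g. mul G (idt G (tgt G g), g) = g"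
  using assms unfolding lie_groupoid_def submersion_def smooth_on_sub_def composable_def by blast+

abbreviation "tsrc G \<equiv> tmap (arr G) (obj G) (src G)"
abbreviation "ttgt G \<equiv> tmap (arr G) (obj G) (tgt G)"
abbreviation "tidt G \<equiv> tmap (obj G) (arr G) (idt G)"
abbreviation "tpr1 G \<equiv> tmap (arr2 G) (arr G) fst"
abbreviation "tpr2 G \<equiv> tmap (arr2 G) (arr G) snd"
abbreviation "tmul G \<equiv> tmap_on (arr2 G) (arr G) (composable G) (mul G)"

section \<open>Products, translations and units on tangent vectors\<close>

context
  fixes G :: "('g::{t2_space,second_countable_topology}, 'd::euclidean_space,
               'm::{t2_space,second_countable_topology}, 'e::real_normed_vector) groupoid"
  assumes G: "lie_groupoid G"
begin

private lemmas arr_atlas = lie_groupoidD(1)[OF G] and obj_atlas = lie_groupoidD(2)[OF G]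
private lemmas arr2_atlas = smooth_atlas_prod[OF arr_atlas arr_atlas]

lemma smooth_map_src_fst: "smooth_map (arr2 G) (obj G) (\<lambda>p. src G (fst p))"
  by (rule smooth_map_comp_fst[OF arr_atlas arr_atlas obj_atlas lie_groupoidD(5)[OF G]])

lemma smooth_map_tgt_snd: "smooth_map (arr2 G) (obj G) (\<lambda>p. tgt G (snd p))"
  by (rule smooth_map_comp_snd[OF arr_atlas arr_atlas obj_atlas lie_groupoidD(6)[OF G]])

text \<open>Rewrites composability of tangent vectors through the two maps from the product to the
  base whose equalizer is the set of composable pairs, as \<open>equalizer_curve\<close>
  requires.\<close>

lemma tspace_comp_iff:
  "Z \<in> tspace_comp G p \<longleftrightarrow> Z \<in> tspace (arr2 G) p \<and>
     tmap (arr2 G) (obj G) (\<lambda>p. src G (fst p)) p Z = tmap (arr2 G) (obj G) (\<lambda>p. tgt G (snd p)) p Z"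
proof (cases "Z \<in> tspace (arr2 G) p")
  case True
  then show ?thesis
    using tmap_compose[OF arr2_atlas arr_atlas obj_atlas smooth_map_fst[OF arr_atlas arr_atlas]
      lie_groupoidD(5)[OF G] smooth_map_src_fst True]
      tmap_compose[OF arr2_atlas arr_atlas obj_atlas smooth_map_snd[OF arr_atlas arr_atlas]
        lie_groupoidD(6)[OF G] smooth_map_tgt_snd True]
    by (simp add: tspace_comp_def)
qed (simp add: tspace_comp_def)

text \<open>The transversality that makes the composable pairs a submanifold. Moving the first arrow
  alone is enough, since the source is a submersion.\<close>

lemma composable_tangent_onto:
  assumes "src G g = tgt G h" "w \<in> tspace (obj G) (src G g)"
  shows "\<exists>Z\<in>tspace (arr2 G) (g, h). tmap (arr2 G) (obj G) (\<lambda>p. src G (fst p)) (g, h) Z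
     - tmap (arr2 G) (obj G) (\<lambda>p. tgt G (snd p)) (g, h) Z = w"
proof -
  obtain X where X: "X \<in> tspace (arr G) g" "tsrc G g X = w"
    using submersion_onto[OF lie_groupoidD(3)[OF G] assms(2)] by blast
  obtain \<gamma> where \<gamma>: "velocity (arr G) \<gamma> g X" using tspace_velocity[OF arr_atlas X(1)] .
  obtain Z where Z: "Z \<in> tspace (arr2 G) (g, h)"
    "tpr1 G (g, h) Z = X" "tpr2 G (g, h) Z = (\<lambda>_. 0)"
    using velocity_Pair[OF arr_atlas arr_atlas \<gamma> velocity_const[of "arr G" h]] by blast
  have "tmap (arr2 G) (obj G) (\<lambda>p. src G (fst p)) (g, h) Z = w"
    using tmap_compose[OF arr2_atlas arr_atlas obj_atlas smooth_map_fst[OF arr_atlas arr_atlas]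
      lie_groupoidD(5)[OF G] smooth_map_src_fst Z(1)] Z X by simp
  moreover have "tmap (arr2 G) (obj G) (\<lambda>p. tgt G (snd p)) (g, h) Z = (\<lambda>_. 0)"
    using tmap_compose[OF arr2_atlas arr_atlas obj_atlas smooth_map_snd[OF arr_atlas arr_atlas]
      lie_groupoidD(6)[OF G] smooth_map_tgt_snd Z(1)] Z
      tmap_zero[OF arr_atlas obj_atlas lie_groupoidD(6)[OF G] UNIV_I] by simp
  ultimately show ?thesis using Z(1) by (intro bexI[of _ Z]) (auto simp: fun_eq_iff)
qed

lemma composable_curve:
  assumes gh: "src G g = tgt G h" and Z: "Z \<in> tspace_comp G (g, h)"
  obtains \<gamma> where "velocity (arr2 G) \<gamma> (g, h) Z" "\<forall>\<^sub>F s in nhds 0. \<gamma> s \<in> composable G"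
proof (rule equalizer_curve[OF arr2_atlas obj_atlas smooth_map_src_fst smooth_map_tgt_snd])
  show "src G (fst (g, h)) = tgt G (snd (g, h))" using gh by simp
  show "Z \<in> tspace (arr2 G) (g, h)"
    "tmap (arr2 G) (obj G) (\<lambda>p. src G (fst p)) (g, h) Z = tmap (arr2 G) (obj G) (\<lambda>p. tgt G (snd p)) (g, h) Z"
    using Z by (simp_all add: tspace_comp_iff)
  show "\<exists>Z\<in>tspace (arr2 G) (g, h). tmap (arr2 G) (obj G) (\<lambda>p. src G (fst p)) (g, h) Z
     - tmap (arr2 G) (obj G) (\<lambda>p. tgt G (snd p)) (g, h) Z = w"
    if "w \<in> tspace (obj G) (src G (fst (g, h)))" for w
    using composable_tangent_onto[OF gh] that by simp
  show thesis if "velocity (arr2 G) \<gamma> (g, h) Z" "\<forall>\<^sub>F s in nhds 0. src G (fst (\<gamma> s)) = tgt G (snd (\<gamma> s))" for \<gamma>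
    using that(1)
  proof (rule \<open>\<And>\<gamma>. velocity (arr2 G) \<gamma> (g, h) Z \<Longrightarrow> \<forall>\<^sub>F s in nhds 0. \<gamma> s \<in> composable G \<Longrightarrow> thesis\<close>)
    show "\<forall>\<^sub>F s in nhds 0. \<gamma> s \<in> composable G"
      using that(2) by eventually_elim (simp add: composable_def split_def)
  qed
qed

lemma velocity_tspace_comp:
  assumes v: "velocity (arr2 G) \<gamma> p Z" and ev: "\<forall>\<^sub>F s in nhds 0. \<gamma> s \<in> composable G"
  shows "Z \<in> tspace_comp G p"
proof -
  have eq: "\<forall>\<^sub>F s in nhds 0. src G (fst (\<gamma> s)) = tgt G (snd (\<gamma> s))"
    using ev by eventually_elim (simp add: composable_def split_def)
  then have p: "src G (fst p) = tgt G (snd p)"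
    using eventually_nhds_x_imp_x velocityD(1)[OF v] by fastforce
  have "tmap (arr2 G) (obj G) (\<lambda>p. src G (fst p)) p Z = tmap (arr2 G) (obj G) (\<lambda>p. tgt G (snd p)) p Z"
    by (rule velocity_unique[OF velocity_map[OF arr2_atlas obj_atlas smooth_map_src_fst UNIV_I v]
        velocity_map[OF arr2_atlas obj_atlas smooth_map_tgt_snd UNIV_I v, folded p] eq])
  then show ?thesis using velocity_tspace[OF arr2_atlas v] by (simp add: tspace_comp_iff)
qed

lemma velocity_mul:
  assumes v: "velocity (arr2 G) \<gamma> p Z" and ev: "\<forall>\<^sub>F s in nhds 0. \<gamma> s \<in> composable G"
  shows "velocity (arr G) (\<lambda>s. mul G (\<gamma> s)) (mul G p) (tmul G p Z)"
proof -
  have "p \<in> composable G" using eventually_nhds_x_imp_x[OF ev] velocityD(1)[OF v] by simp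
  then show ?thesis using velocity_tmap_on[OF arr2_atlas arr_atlas lie_groupoidD(8)[OF G] v ev] by blast
qed

text \<open>The projections are their own extensions to the product, so the pullbacks
  \<open>pr1_pullback\<close> and \<open>pr2_pullback\<close> can be computed with ordinary tangent
  maps.\<close>

lemma velocity_proj:
  assumes v: "velocity (arr2 G) \<gamma> p Z" and ev: "\<forall>\<^sub>F s in nhds 0. \<gamma> s \<in> composable G"
  shows "tmap_on (arr2 G) (arr G) (composable G) fst p Z = tpr1 G p Z"
    "tmap_on (arr2 G) (arr G) (composable G) snd p Z = tpr2 G p Z"
proof -
  have 1: "local_extension (arr2 G) (arr G) (composable G) fst p fst"
    unfolding local_extension_def using smooth_map_fst[OF arr_atlas arr_atlas] by blast
  have 2: "local_extension (arr2 G) (arr G) (composable G) snd p snd"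
    unfolding local_extension_def using smooth_map_snd[OF arr_atlas arr_atlas] by blast
  show "tmap_on (arr2 G) (arr G) (composable G) fst p Z = tpr1 G p Z"
    by (rule velocity_eq[OF velocity_tmap_on[OF arr2_atlas arr_atlas exI[of _ fst] v ev]
      velocity_fst[OF arr_atlas arr_atlas v]]) (rule 1)
  show "tmap_on (arr2 G) (arr G) (composable G) snd p Z = tpr2 G p Z"
    by (rule velocity_eq[OF velocity_tmap_on[OF arr2_atlas arr_atlas exI[of _ snd] v ev]
      velocity_snd[OF arr_atlas arr_atlas v]]) (rule 2)
qed

text \<open>The working form of the tangent multiplication: curves that are composable near 0 yield
  a composable pair \<open>Z\<close> of their velocities, and the velocity of the product curve is
  the product of that pair.\<close>

lemma mul_curveE:
  assumes "velocity (arr G) \<gamma> g X" "velocity (arr G) \<delta> h Y" "\<forall>\<^sub>F s in nhds 0. src G (\<gamma> s) = tgt G (\<delta> s)"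
  obtains Z where "velocity (arr2 G) (\<lambda>s. (\<gamma> s, \<delta> s)) (g, h) Z" "Z \<in> tspace_comp G (g, h)"
    "tpr1 G (g, h) Z = X" "tpr2 G (g, h) Z = Y"
    "velocity (arr G) (\<lambda>s. mul G (\<gamma> s, \<delta> s)) (mul G (g, h))
       (tmul G (g, h) Z)"
proof -
  obtain Z where Z: "velocity (arr2 G) (\<lambda>s. (\<gamma> s, \<delta> s)) (g, h) Z"
    "tpr1 G (g, h) Z = X" "tpr2 G (g, h) Z = Y"
    using velocity_Pair[OF arr_atlas arr_atlas assms(1,2)] by blast
  have ev: "\<forall>\<^sub>F s in nhds 0. (\<gamma> s, \<delta> s) \<in> composable G"
    using assms(3) by eventually_elim (simp add: composable_def)
  show thesis
    by (rule that[OF Z(1) velocity_tspace_comp[OF Z(1) ev] Z(2,3) velocity_mul[OF Z(1) ev]])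
qed

text \<open>Obtained by freezing the first argument of a local extension of the
  multiplication.\<close>

lemma left_translation_extension:
  assumes "src G g = tgt G h"
  shows "\<exists>F. local_extension (arr G) (arr G) {h. tgt G h = src G g} (\<lambda>h. mul G (g, h)) h F"
proof -
  have "(g, h) \<in> composable G" using assms by (simp add: composable_def)
  then obtain F W where W: "(g, h) \<in> W" "smooth_map_open (arr2 G) (arr G) W F"
    and F: "\<forall>q\<in>W \<inter> composable G. F q = mul G q"
    using lie_groupoidD(8)[OF G] unfolding local_extension_def by blast
  define V where "V = (\<lambda>h. (g, h)) -` W"
  have oV: "open V" unfolding V_def
    by (intro open_vimage smooth_map_open_open[OF W(2)] continuous_intros)
  have "smooth_map_open (arr G) (arr2 G) V (\<lambda>h. (g, h))"
    by (intro smooth_map_open_Pair arr_atlas smooth_map_open_const oV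
        smooth_map_open_subset[OF smooth_map_ident[OF arr_atlas] oV]) auto
  then have "smooth_map_open (arr G) (arr G) V (\<lambda>h. F (g, h))"
    by (rule smooth_map_open_compose[OF arr_atlas arr2_atlas arr_atlas _ W(2)]) (auto simp: V_def)
  then have "local_extension (arr G) (arr G) {h. tgt G h = src G g} (\<lambda>h. mul G (g, h)) h (\<lambda>h. F (g, h))"
    unfolding local_extension_def using W(1) F by (intro exI[of _ V]) (auto simp: V_def composable_def)
  then show ?thesis by blast
qed

lemma right_translation_extension:
  assumes "src G g = tgt G h"
  shows "\<exists>F. local_extension (arr G) (arr G) {g. src G g = tgt G h} (\<lambda>g. mul G (g, h)) g F"
proof -
  have "(g, h) \<in> composable G" using assms by (simp add: composable_def)
  then obtain F W where W: "(g, h) \<in> W" "smooth_map_open (arr2 G) (arr G) W F"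
    and F: "\<forall>q\<in>W \<inter> composable G. F q = mul G q"
    using lie_groupoidD(8)[OF G] unfolding local_extension_def by blast
  define V where "V = (\<lambda>g. (g, h)) -` W"
  have oV: "open V" unfolding V_def
    by (intro open_vimage smooth_map_open_open[OF W(2)] continuous_intros)
  have "smooth_map_open (arr G) (arr2 G) V (\<lambda>g. (g, h))"
    by (intro smooth_map_open_Pair arr_atlas smooth_map_open_const oV
        smooth_map_open_subset[OF smooth_map_ident[OF arr_atlas] oV]) auto
  then have "smooth_map_open (arr G) (arr G) V (\<lambda>g. F (g, h))"
    by (rule smooth_map_open_compose[OF arr_atlas arr2_atlas arr_atlas _ W(2)]) (auto simp: V_def)
  then have "local_extension (arr G) (arr G) {g. src G g = tgt G h} (\<lambda>g. mul G (g, h)) g (\<lambda>g. F (g, h))"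
    unfolding local_extension_def using W(1) F by (intro exI[of _ V]) (auto simp: V_def composable_def)
  then show ?thesis by blast
qed

lemma tmap_tgt_idt:
  assumes "w \<in> tspace (obj G) x"
  shows "ttgt G (idt G x) (tidt G x w) = w"
proof -
  obtain \<delta> where \<delta>: "velocity (obj G) \<delta> x w" using tspace_velocity[OF obj_atlas assms] .
  have "velocity (obj G) (\<lambda>s. tgt G (idt G (\<delta> s))) (tgt G (idt G x))
     (ttgt G (idt G x) (tidt G x w))"
    by (rule velocity_map[OF arr_atlas obj_atlas lie_groupoidD(6)[OF G] UNIV_I velocity_map[OF
      obj_atlas arr_atlas lie_groupoidD(7)[OF G] UNIV_I \<delta>]])
  then show ?thesis using \<delta> velocity_eq by (simp add: lie_groupoidD(10)[OF G]) blast
qed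

lemma tmap_src_idt:
  assumes "w \<in> tspace (obj G) x"
  shows "tsrc G (idt G x) (tidt G x w) = w"
proof -
  obtain \<delta> where \<delta>: "velocity (obj G) \<delta> x w" using tspace_velocity[OF obj_atlas assms] .
  have "velocity (obj G) (\<lambda>s. src G (idt G (\<delta> s))) (src G (idt G x))
     (tsrc G (idt G x) (tidt G x w))"
    by (rule velocity_map[OF arr_atlas obj_atlas lie_groupoidD(5)[OF G] UNIV_I velocity_map[OF
      obj_atlas arr_atlas lie_groupoidD(7)[OF G] UNIV_I \<delta>]])
  then show ?thesis using \<delta> velocity_eq by (simp add: lie_groupoidD(9)[OF G]) blast
qed

text \<open>Splits a vector at a unit into a unit vector and a Lie algebroid vector, as occurs in
  \<open>cot_idt\<close>.\<close>

lemma idt_tgt_projection: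
  assumes Y: "Y \<in> tspace (arr G) (idt G x)"
  defines "w \<equiv> ttgt G (idt G x) Y"
  shows "w \<in> tspace (obj G) x" "tidt G x w \<in> tspace (arr G) (idt G x)"
    "Y - tidt G x w \<in> algebroid_fibre G x"
proof -
  show w: "w \<in> tspace (obj G) x"
    using tmap_tspace[OF arr_atlas obj_atlas lie_groupoidD(6)[OF G] UNIV_I Y]
      by (simp add: w_def lie_groupoidD(10)[OF G])
  show i: "tidt G x w \<in> tspace (arr G) (idt G x)"
    by (rule tmap_tspace[OF obj_atlas arr_atlas lie_groupoidD(7)[OF G] UNIV_I w])
  have "ttgt G (idt G x) (Y - tidt G x w) = w - w"
    unfolding tmap_diff[OF arr_atlas obj_atlas lie_groupoidD(6)[OF G] UNIV_I] tmap_tgt_idt[OF w]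
      by (simp add: w_def)
  then show "Y - tidt G x w \<in> algebroid_fibre G x"
    using tspace_diff[OF arr_atlas Y i] by (auto simp: algebroid_fibre_def fun_eq_iff)
qed

text \<open>The splitting with the source in place of the target, as occurs in
  \<open>cot_tgt\<close>; the remainder can be right translated.\<close>

lemma idt_src_projection:
  assumes Y: "Y \<in> tspace (arr G) (idt G x)"
  defines "w \<equiv> tsrc G (idt G x) Y"
  shows "w \<in> tspace (obj G) x" "tidt G x w \<in> tspace (arr G) (idt G x)"
    "Y - tidt G x w \<in> tspace (arr G) (idt G x)"
    "tsrc G (idt G x) (Y - tidt G x w) = (\<lambda>_. 0)"
proof -
  show w: "w \<in> tspace (obj G) x"
    using tmap_tspace[OF arr_atlas obj_atlas lie_groupoidD(5)[OF G] UNIV_I Y]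
      by (simp add: w_def lie_groupoidD(9)[OF G])
  show i: "tidt G x w \<in> tspace (arr G) (idt G x)"
    by (rule tmap_tspace[OF obj_atlas arr_atlas lie_groupoidD(7)[OF G] UNIV_I w])
  show "Y - tidt G x w \<in> tspace (arr G) (idt G x)"
    by (rule tspace_diff[OF arr_atlas Y i])
  have "tsrc G (idt G x) (Y - tidt G x w) = w - w"
    unfolding tmap_diff[OF arr_atlas obj_atlas lie_groupoidD(5)[OF G] UNIV_I] tmap_src_idt[OF w]
      by (simp add: w_def)
  then show "tsrc G (idt G x) (Y - tidt G x w) = (\<lambda>_. 0)"
    by (auto simp: fun_eq_iff)
qed

lemma algebroid_curve:
  assumes "X \<in> algebroid_fibre G x"
  obtains \<gamma> where "velocity (arr G) \<gamma> (idt G x) X" "\<forall>\<^sub>F s in nhds 0. tgt G (\<gamma> s) = x"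
  using fibre_curve[OF arr_atlas obj_atlas lie_groupoidD(4)[OF G], of X "idt G x"] assms
  by (auto simp: algebroid_fibre_def lie_groupoidD(10)[OF G])

lemma tmap_tgt_mul:
  assumes gh: "src G g = tgt G h" and Z: "Z \<in> tspace_comp G (g, h)"
  shows "ttgt G (mul G (g, h)) (tmul G (g, h) Z)
     = ttgt G g (tpr1 G (g, h) Z)"
proof -
  obtain k where k: "velocity (arr2 G) k (g, h) Z" "\<forall>\<^sub>F s in nhds 0. k s \<in> composable G"
    using composable_curve[OF gh Z] .
  have "\<forall>\<^sub>F s in nhds 0. tgt G (mul G (k s)) = tgt G (fst (k s))"
    using k(2) by eventually_elim (auto simp: composable_def lie_groupoidD(12)[OF G])
  moreover have "velocity (obj G) (\<lambda>s. tgt G (mul G (k s))) (tgt G g)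
      (ttgt G (mul G (g, h)) (tmul G (g, h) Z))"
    using velocity_map[OF arr_atlas obj_atlas lie_groupoidD(6)[OF G] UNIV_I velocity_mul[OF k]]
    by (simp add: lie_groupoidD(12)[OF G gh])
  moreover have "velocity (obj G) (\<lambda>s. tgt G (fst (k s))) (tgt G g)
      (ttgt G g (tpr1 G (g, h) Z))"
    using velocity_map[OF arr_atlas obj_atlas lie_groupoidD(6)[OF G] UNIV_I velocity_fst[OF
      arr_atlas arr_atlas k(1)]] by simp
  ultimately show ?thesis using velocity_unique by blast
qed

lemma tmap_src_mul:
  assumes gh: "src G g = tgt G h" and Z: "Z \<in> tspace_comp G (g, h)"
  shows "tsrc G (mul G (g, h)) (tmul G (g, h) Z)
     = tsrc G h (tpr2 G (g, h) Z)"
proof -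
  obtain k where k: "velocity (arr2 G) k (g, h) Z" "\<forall>\<^sub>F s in nhds 0. k s \<in> composable G"
    using composable_curve[OF gh Z] .
  have "\<forall>\<^sub>F s in nhds 0. src G (mul G (k s)) = src G (snd (k s))"
    using k(2) by eventually_elim (auto simp: composable_def lie_groupoidD(11)[OF G])
  moreover have "velocity (obj G) (\<lambda>s. src G (mul G (k s))) (src G h)
      (tsrc G (mul G (g, h)) (tmul G (g, h) Z))"
    using velocity_map[OF arr_atlas obj_atlas lie_groupoidD(5)[OF G] UNIV_I velocity_mul[OF k]]
    by (simp add: lie_groupoidD(11)[OF G gh])
  moreover have "velocity (obj G) (\<lambda>s. src G (snd (k s))) (src G h)
      (tsrc G h (tpr2 G (g, h) Z))"
    using velocity_map[OF arr_atlas obj_atlas lie_groupoidD(5)[OF G] UNIV_I velocity_snd[OF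
      arr_atlas arr_atlas k(1)]] by simp
  ultimately show ?thesis using velocity_unique by blast
qed

text \<open>Left translates stay tangent to the target fibre, so a form pulled back from the base
  along the target kills them. This is what makes \<open>cot_src\<close> vanish on \<omega>.\<close>

lemma tmap_on_left_translation:
  assumes X: "X \<in> algebroid_fibre G (src G g)"
  defines "V \<equiv> tmap_on (arr G) (arr G) {h. tgt G h = src G g} (\<lambda>h. mul G (g, h)) (idt G (src G g)) X"
  shows "V \<in> tspace (arr G) g" "ttgt G g V = (\<lambda>_. 0)"
proof -
  obtain k where k: "velocity (arr G) k (idt G (src G g)) X" "\<forall>\<^sub>F s in nhds 0. tgt G (k s) = src G g"
    using algebroid_curve[OF X] .
  have "\<exists>F. local_extension (arr G) (arr G) {h. tgt G h = src G g} (\<lambda>h. mul G (g, h)) (idt G (src G g)) F"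
    by (rule left_translation_extension) (simp add: lie_groupoidD(10)[OF G])
  from velocity_tmap_on[OF arr_atlas arr_atlas this k(1)] k(2)
  have v: "velocity (arr G) (\<lambda>s. mul G (g, k s)) g V"
    by (simp add: V_def lie_groupoidD(14)[OF G])
  show "V \<in> tspace (arr G) g" by (rule velocity_tspace[OF arr_atlas v])
  have "\<forall>\<^sub>F s in nhds 0. tgt G (mul G (g, k s)) = tgt G g"
    using k(2) by eventually_elim (simp add: lie_groupoidD(12)[OF G])
  then show "ttgt G g V = (\<lambda>_. 0)"
    by (rule velocity_unique[OF velocity_map[OF arr_atlas obj_atlas lie_groupoidD(6)[OF G] UNIV_I
      v] velocity_const])
qed

text \<open>The counterpart for \<theta> and \<open>cot_tgt\<close>. The third clause, translation
  by a unit, enters the identity on units in iv).\<close>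

lemma tmap_on_right_translation:
  assumes X: "X \<in> tspace (arr G) (idt G (tgt G h))" "tsrc G (idt G (tgt G h)) X = (\<lambda>_. 0)"
  defines "V \<equiv> tmap_on (arr G) (arr G) {g. src G g = tgt G h} (\<lambda>g. mul G (g, h)) (idt G (tgt G h)) X"
  shows "V \<in> tspace (arr G) h" "tsrc G h V = (\<lambda>_. 0)"
    "h = idt G (tgt G h) \<Longrightarrow> V = X"
proof -
  obtain k where k: "velocity (arr G) k (idt G (tgt G h)) X" "\<forall>\<^sub>F s in nhds 0. src G (k s) = tgt G h"
    using fibre_curve[OF arr_atlas obj_atlas lie_groupoidD(3)[OF G] X] unfolding lie_groupoidD(9)[OF G] .
  have "\<exists>F. local_extension (arr G) (arr G) {g. src G g = tgt G h} (\<lambda>g. mul G (g, h)) (idt G (tgt G h)) F"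
    by (rule right_translation_extension) (simp add: lie_groupoidD(9)[OF G])
  from velocity_tmap_on[OF arr_atlas arr_atlas this k(1)] k(2)
  have v: "velocity (arr G) (\<lambda>s. mul G (k s, h)) h V"
    by (simp add: V_def lie_groupoidD(15)[OF G])
  show "V \<in> tspace (arr G) h" by (rule velocity_tspace[OF arr_atlas v])
  have "\<forall>\<^sub>F s in nhds 0. src G (mul G (k s, h)) = src G h"
    using k(2) by eventually_elim (simp add: lie_groupoidD(11)[OF G])
  then show "tsrc G h V = (\<lambda>_. 0)"
    by (rule velocity_unique[OF velocity_map[OF arr_atlas obj_atlas lie_groupoidD(5)[OF G] UNIV_I
      v] velocity_const])
  assume h: "h = idt G (tgt G h)"
  have "\<forall>\<^sub>F s in nhds 0. mul G (k s, h) = k s"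
    using k(2) by eventually_elim (metis h lie_groupoidD(14)[OF G])
  from velocity_unique[OF v _ this] show "V = X" using k(1) h by metis
qed

end

section \<open>1-forms in coordinates\<close>

lemma form1_coord:
  assumes A: "smooth_atlas A" and V: "V \<in> tspace A p" and c: "c \<in> charts_at A p"
  shows "\<eta> p [V] = coord_form A \<eta> c (cmap c p) [V c]"
  using tspace_coord_vec[OF V c] cinv_cmap[OF A charts_at_atlas[OF c] charts_at_dom[OF c]]
  by (simp add: coord_form_def)

lemma smooth_form1_coord:
  assumes \<eta>: "smooth_form A 1 \<eta>" and c: "c \<in> A"
  shows "Cinf_on (cmap c ` cdom c) (\<lambda>x. coord_form A \<eta> c x [u])"
    and "x \<in> cmap c ` cdom c \<Longrightarrow> linear (\<lambda>u. coord_form A \<eta> c x [u])"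
proof -
  have *: "Cinf_on (cmap c ` cdom c) (\<lambda>x. coord_form A \<eta> c x us) \<and>
     (\<forall>x\<in>cmap c ` cdom c. \<forall>i<1. linear (\<lambda>u. coord_form A \<eta> c x (us[i := u])))" if "length us = 1" for us
    using \<eta> c that unfolding smooth_form_def by blast
  show "Cinf_on (cmap c ` cdom c) (\<lambda>x. coord_form A \<eta> c x [u])" using *[of "[u]"] by simp
  show "linear (\<lambda>u. coord_form A \<eta> c x [u])" if "x \<in> cmap c ` cdom c"
    using *[of "[0]"] that by auto
qed

lemma form1_diff:
  assumes A: "smooth_atlas A" and \<eta>: "smooth_form A 1 \<eta>" and V: "V \<in> tspace A p" and W: "W \<in> tspace A p"
  shows "\<eta> p [V - W] = \<eta> p [V] - \<eta> p [W]"
proof -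
  let ?c = "chart_of A p"
  have c: "?c \<in> charts_at A p" by (rule chart_of_mem[OF A])
  have l: "linear (\<lambda>u. coord_form A \<eta> ?c (cmap ?c p) [u])"
    by (rule smooth_form1_coord(2)[OF \<eta>]) (use c in \<open>auto simp: charts_at_def\<close>)
  show ?thesis
    unfolding form1_coord[OF A V c] form1_coord[OF A W c] form1_coord[OF A tspace_diff[OF A V W] c]
    using linear_diff[OF l] by simp
qed

lemma form1_zero:
  assumes A: "smooth_atlas A" and \<eta>: "smooth_form A 1 \<eta>"
  shows "\<eta> p [\<lambda>_. 0] = 0"
  using form1_diff[OF A \<eta> tspace_zero[OF A] tspace_zero[OF A], of p]
  by (simp add: fun_diff_def)

section \<open>The twisted product\<close>

lemma velocity_real_rvec:
  assumes "velocity real_atlas \<gamma> t v" "(\<gamma> has_real_derivative r) (at 0)"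
  shows "v rchart = r" "v = rvec r"
  using assms DERIV_unique unfolding velocity_real by blast+

lemma rvec_rchart [simp]: "rvec r rchart = r"
  by (simp add: rvec_def)

lemma tspace_real: "v \<in> tspace real_atlas t \<Longrightarrow> v = rvec (v rchart)"
  using tspace_velocity[OF smooth_atlas_real] velocity_real by metis

text \<open>Used for the source with \<open>k = \<sigma>\<close> and for the target with
  \<open>k\<close> zero. The first component is lifted by the submersion \<open>f\<close>; the real
  component is then free to be adjusted.\<close>

lemma submersion_twist:
  assumes A: "smooth_atlas A" and B: "smooth_atlas B" and f: "submersion A B f" and k:
    "smooth_map A real_atlas k"
  shows "submersion (prod_atlas A real_atlas) (prod_atlas B real_atlas) (\<lambda>p. (f (fst p), k (fst p) + snd p))"
  unfolding submersion_def
proof (intro conjI allI subset_antisym)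
  note R = smooth_atlas_real
  note AR = smooth_atlas_prod[OF A R] and BR = smooth_atlas_prod[OF B R]
  have f': "smooth_map A B f" using f by (simp add: submersion_def)
  show s: "smooth_map (prod_atlas A real_atlas) (prod_atlas B real_atlas) (\<lambda>p. (f (fst p), k (fst p) + snd p))"
    by (rule smooth_map_open_Pair[OF AR B R smooth_map_comp_fst[OF A R B f']
          smooth_map_add[OF AR smooth_map_comp_fst[OF A R R k] smooth_map_snd[OF A R]]])
  fix p :: "'a \<times> real"
  let ?\<Phi> = "\<lambda>p. (f (fst p), k (fst p) + snd p)"
  show "tmap (prod_atlas A real_atlas) (prod_atlas B real_atlas) ?\<Phi> p ` tspace (prod_atlas A real_atlas) p
      \<subseteq> tspace (prod_atlas B real_atlas) (?\<Phi> p)"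
    using tmap_tspace[OF AR BR s UNIV_I] by blast
  obtain g t where p: "p = (g, t)" by (cases p)
  show "tspace (prod_atlas B real_atlas) (?\<Phi> p) \<subseteq>
      tmap (prod_atlas A real_atlas) (prod_atlas B real_atlas) ?\<Phi> p ` tspace (prod_atlas A real_atlas) p"
  proof
    fix w assume w: "w \<in> tspace (prod_atlas B real_atlas) (?\<Phi> p)"
    obtain d where d: "velocity (prod_atlas B real_atlas) d (?\<Phi> p) w" using tspace_velocity[OF BR w] .
    let ?w1 = "tfst B real_atlas (?\<Phi> p) w"
    let ?w2 = "tsnd B real_atlas (?\<Phi> p) w"
    have w1: "?w1 \<in> tspace B (f g)" using velocity_tspace[OF B velocity_fst[OF B R d]] by (simp add: p)
    have w2: "?w2 = rvec (?w2 rchart)" using tspace_real velocity_tspace[OF R velocity_snd[OF B R d]] by blast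
    obtain X where X: "X \<in> tspace A g" "tmap A B f g X = ?w1" using submersion_onto[OF f w1] .
    obtain \<gamma> where \<gamma>: "velocity A \<gamma> g X" using tspace_velocity[OF A X(1)] .
    obtain e where e: "((\<lambda>s. k (\<gamma> s)) has_real_derivative e) (at 0)"
      using velocity_map[OF A R k UNIV_I \<gamma>] by (auto simp: velocity_real)
    \<comment> \<open>Chosen to compensate the motion of \<open>k (\<gamma> s)\<close>: the sum
      \<open>k (\<gamma> s) + \<delta> s\<close> is the affine function with the prescribed
      slope.\<close>
    define \<delta> where "\<delta> s = t + k g - k (\<gamma> s) + s * ?w2 rchart" for s
    have "(\<delta> has_real_derivative (?w2 rchart - e)) (at 0)"
      unfolding \<delta>_def by (auto intro!: derivative_eq_intros e)
    from velocity_realI[OF this] have v\<delta>: "velocity real_atlas \<delta> t (rvec (?w2 rchart - e))"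
      using velocityD(1)[OF \<gamma>] by (simp add: \<delta>_def)
    obtain Z where Z: "velocity (prod_atlas A real_atlas) (\<lambda>s. (\<gamma> s, \<delta> s)) (g, t) Z"
      "Z \<in> tspace (prod_atlas A real_atlas) (g, t)"
      using velocity_Pair[OF A R \<gamma> v\<delta>] by blast
    let ?V = "tmap (prod_atlas A real_atlas) (prod_atlas B real_atlas) ?\<Phi> p Z"
    have v: "velocity (prod_atlas B real_atlas) (\<lambda>s. (f (\<gamma> s), k (\<gamma> s) + \<delta> s)) (?\<Phi> p) ?V"
      using velocity_map[OF AR BR s UNIV_I Z(1)] by (simp add: p)
    have "velocity B (\<lambda>s. f (\<gamma> s)) (f g) ?w1" using velocity_map[OF A B f' UNIV_I \<gamma>] X by simp
    moreover have "velocity B (\<lambda>s. f (\<gamma> s)) (f g) (tfst B real_atlas (?\<Phi> p) ?V)"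
      using velocity_fst[OF B R v] by (simp add: p)
    ultimately have 1: "tfst B real_atlas (?\<Phi> p) ?V = ?w1"
      by (rule velocity_eq[rotated])
    have der: "((\<lambda>s. k (\<gamma> s) + \<delta> s) has_real_derivative ?w2 rchart) (at 0)"
      unfolding \<delta>_def by (auto intro!: derivative_eq_intros e)
    have vk: "velocity real_atlas (\<lambda>s. k (\<gamma> s) + \<delta> s) (snd (?\<Phi> p)) (tsnd B real_atlas (?\<Phi> p) ?V)"
      using velocity_snd[OF B R v] by simp
    have 2: "tsnd B real_atlas (?\<Phi> p) ?V = ?w2"
      by (rule trans[OF velocity_real_rvec(2)[OF vk der] w2[symmetric]])
    have "?V = w"
      by (rule prod_tspace_eqI[OF B R velocity_tspace[OF BR v] w 1 2])
    then show "w \<in> tmap (prod_atlas A real_atlas) (prod_atlas B real_atlas) ?\<Phi> p ` tspace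
      (prod_atlas A real_atlas) p"
      using Z(2) unfolding p by blast
  qed
qed

lemma twisted_product_simps [simp]:
  "arr (twisted_product G \<sigma>) = prod_atlas (arr G) real_atlas"
  "obj (twisted_product G \<sigma>) = prod_atlas (obj G) real_atlas"
  "src (twisted_product G \<sigma>) = (\<lambda>p. (src G (fst p), \<sigma> (fst p) + snd p))"
  "tgt (twisted_product G \<sigma>) = (\<lambda>p. (tgt G (fst p), snd p))"
  "idt (twisted_product G \<sigma>) = (\<lambda>p. (idt G (fst p), snd p))"
  "mul (twisted_product G \<sigma>) = (\<lambda>q. (mul G (fst (fst q), fst (snd q)), snd (fst q)))"
  by (auto simp: twisted_product_def fun_eq_iff)

lemma twisted_product_composable:
  "q \<in> composable (twisted_product G \<sigma>) \<longleftrightarrow>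
     src G (fst (fst q)) = tgt G (fst (snd q)) \<and> \<sigma> (fst (fst q)) + snd (fst q) = snd (snd q)"
  by (auto simp: composable_def split_def)

lemma twisted_product_lie_groupoid:
  fixes G :: "('g::{t2_space,second_countable_topology}, 'd::euclidean_space,
               'm::{t2_space,second_countable_topology}, 'e::real_normed_vector) groupoid"
  assumes G: "lie_groupoid G" and \<sigma>: "smooth_map (arr G) real_atlas \<sigma>"
    and mult: "\<And>g h. src G g = tgt G h \<Longrightarrow> \<sigma> (mul G (g, h)) = \<sigma> g + \<sigma> h"
  shows "lie_groupoid (twisted_product G \<sigma>)"
proof -
  let ?H = "twisted_product G \<sigma>"
  let ?B = "prod_atlas (arr G) real_atlas" and ?N = "prod_atlas (obj G) real_atlas"
  let ?BB = "prod_atlas ?B ?B"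
  note A = lie_groupoidD(1)[OF G] and M = lie_groupoidD(2)[OF G] and R = smooth_atlas_real
  note AA = smooth_atlas_prod[OF A A] and AR = smooth_atlas_prod[OF A R] and MR = smooth_atlas_prod[OF M R]
  note AR2 = smooth_atlas_prod[OF AR AR]
  \<comment> \<open>A unit is its own square, so its value under \<sigma> equals twice
    itself.\<close>
  have idt0: "\<sigma> (idt G x) = 0" for x
    using mult[of "idt G x" "idt G x"] lie_groupoidD(14)[OF G, of "idt G x"]
    by (simp add: lie_groupoidD(9,10)[OF G])
  obtain iv where iv: "smooth_map (arr G) (arr G) iv"
    "\<And>g. src G (iv g) = tgt G g" "\<And>g. tgt G (iv g) = src G g"
    "\<And>g. mul G (g, iv g) = idt G (tgt G g)" "\<And>g. mul G (iv g, g) = idt G (src G g)"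
    using G unfolding lie_groupoid_def by blast
  have iv\<sigma>: "\<sigma> (iv g) + \<sigma> g = 0" for g
    using mult[of "iv g" g] iv by (simp add: idt0)
  have surj: "surj (src G)" "surj (tgt G)" using G by (simp_all add: lie_groupoid_def)
  have 1: "surj (\<lambda>p. (src G (fst p), \<sigma> (fst p) + snd p))"
  proof -
    have "\<exists>p. y = (src G (fst p), \<sigma> (fst p) + snd p)" for y
    proof -
      obtain g where "fst y = src G g" using surjD[OF surj(1)] by blast
      then have "y = (src G (fst (g, snd y - \<sigma> g)), \<sigma> (fst (g, snd y - \<sigma> g)) + snd (g, snd y - \<sigma> g))"
        by (simp add: prod_eq_iff)
      then show ?thesis by blast
    qed
    then show ?thesis unfolding surj_def by blast
  qed
  have 2: "surj (\<lambda>p. (tgt G (fst p), snd p :: real))"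
  proof -
    have "\<exists>p. y = (tgt G (fst p), snd p :: real)" for y
    proof -
      obtain g where "fst y = tgt G g" using surjD[OF surj(2)] by blast
      then have "y = (tgt G (fst (g, snd y)), snd (g, snd y))" by (simp add: prod_eq_iff)
      then show ?thesis by blast
    qed
    then show ?thesis unfolding surj_def by blast
  qed
  have k0: "smooth_map (arr G) real_atlas (\<lambda>p. 0)" by (rule smooth_map_open_const[OF A open_UNIV])
  have 3: "submersion ?B ?N (\<lambda>p. (src G (fst p), \<sigma> (fst p) + snd p))"
    by (rule submersion_twist[OF A M lie_groupoidD(3)[OF G] \<sigma>])
  have 4: "submersion ?B ?N (\<lambda>p. (tgt G (fst p), snd p))"
    using submersion_twist[OF A M lie_groupoidD(4)[OF G] k0] by simp
  have 5: "smooth_map ?N ?B (\<lambda>p. (idt G (fst p), snd p))"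
    by (rule smooth_map_open_Pair[OF MR A R smooth_map_comp_fst[OF M R A lie_groupoidD(7)[OF G]]
      smooth_map_snd[OF M R]])
  have 6: "\<exists>F. local_extension ?BB
      ?B (composable ?H) (mul ?H) q F"
    if q: "q \<in> composable ?H" for q
  proof -
    \<comment> \<open>The real parts are forgotten by \<open>?L\<close>: only the product in
      \<open>G\<close> needs a local extension, the real component of the product being defined
      everywhere.\<close>
    let ?L = "\<lambda>q. (fst (fst q), fst (snd q))"
    have "?L q \<in> composable G" using q unfolding twisted_product_composable by (simp add: composable_def)
    then obtain F W where W: "?L q \<in> W" "smooth_map_open (arr2 G) (arr G) W F"
      and F: "\<forall>q\<in>W \<inter> composable G. F q = mul G q"
      using lie_groupoidD(8)[OF G] unfolding local_extension_def by blast
    define V where "V = {q :: ('g \<times> real) \<times> ('g \<times> real). ?L q \<in> W}"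
    have oV: "open V"
      using open_vimage[OF smooth_map_open_open[OF W(2)], of ?L] unfolding V_def vimage_def
      by (simp add: continuous_intros continuous_on_fst continuous_on_snd)
    have "smooth_map ?BB (arr2 G) ?L"
      by (rule smooth_map_open_Pair[OF AR2 A A smooth_map_comp_fst[OF AR AR A smooth_map_fst[OF A R]]
            smooth_map_comp_snd[OF AR AR A smooth_map_fst[OF A R]]])
    then have "smooth_map_open ?BB (arr2 G) V ?L"
      using smooth_map_open_subset oV by blast
    then have "smooth_map_open ?BB (arr G) V (\<lambda>q. F (?L q))"
      by (rule smooth_map_open_compose[OF AR2 AA A _ W(2)]) (auto simp: V_def)
    moreover have "smooth_map_open ?BB real_atlas V (\<lambda>q. snd (fst q))"
      using smooth_map_open_subset[OF smooth_map_comp_fst[OF AR AR R smooth_map_snd[OF A R]] oV] by simp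
    ultimately have "smooth_map_open ?BB
       ?B V (\<lambda>q. (F (?L q), snd (fst q)))"
      by (rule smooth_map_open_Pair[OF AR2 A R])
    moreover have "(F (?L x), snd (fst x)) = mul ?H x" if "x \<in> V \<inter> composable ?H" for x
    proof -
      have "?L x \<in> W \<inter> composable G"
        using that by (auto simp: V_def composable_def split_def)
      then show ?thesis using F by simp
    qed
    moreover have "q \<in> V" using W(1) by (simp add: V_def)
    ultimately show ?thesis unfolding local_extension_def by blast
  qed
  have 7: "\<exists>jv. smooth_map ?B ?B jv \<and>
     (\<forall>p. src ?H (jv p) = tgt ?H p \<and>
        tgt ?H (jv p) = src ?H p \<and>
        mul ?H (p, jv p) = idt ?H (tgt ?H p) \<and>
        mul ?H (jv p, p) = idt ?H (src ?H p))"
  proof (intro exI conjI allI)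
    \<comment> \<open>The real entry is forced, as the target of the inverse must be the source of
      \<open>p\<close>.\<close>
    show "smooth_map ?B ?B (\<lambda>p. (iv (fst p), \<sigma> (fst p) + snd p))"
      by (rule smooth_map_open_Pair[OF AR A R smooth_map_comp_fst[OF A R A iv(1)]
            smooth_map_add[OF AR smooth_map_comp_fst[OF A R R \<sigma>] smooth_map_snd[OF A R]]])
    fix p :: "'g \<times> real"
    have "\<sigma> (iv (fst p)) + (\<sigma> (fst p) + snd p) = snd p" using iv\<sigma>[of "fst p"] by simp
    then show "src ?H (iv (fst p), \<sigma> (fst p) + snd p) = tgt ?H p"
      "tgt ?H (iv (fst p), \<sigma> (fst p) + snd p) = src ?H p"
      "mul ?H (p, (iv (fst p), \<sigma> (fst p) + snd p)) = idt ?H (tgt ?H p)"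
      "mul ?H ((iv (fst p), \<sigma> (fst p) + snd p), p) = idt ?H (src ?H p)"
      by (simp_all add: iv)
  qed
  have 8: "\<forall>(g, h)\<in>composable ?H. src ?H (mul ?H (g, h)) = src ?H h \<and>
      tgt ?H (mul ?H (g, h)) = tgt ?H g"
    by (auto simp: composable_def mult lie_groupoidD(11,12)[OF G])
  show ?thesis
    unfolding lie_groupoid_def smooth_on_sub_def
    using AR MR 1 2 3 4 5 6 7 8
    by (simp add: lie_groupoidD(9,10,13,14,15)[OF G] idt0 composable_def)
qed

section \<open>The forms of the claim\<close>

lemma wedge_1_1: "wedge 1 1 \<alpha> \<beta> p [V, W] = \<alpha> p [V] * \<beta> p [W] - \<alpha> p [W] * \<beta> p [V]"
proof -
  have S: "{\<pi>. \<pi> permutes {..<Suc (Suc 0)}} = {id, Transposition.transpose 0 1}"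
    using permutes_doubleton_iff[of _ "0::nat" 1] by (auto simp: lessThan_Suc insert_commute)
  have ne: "id \<noteq> Transposition.transpose 0 (Suc 0)"
    by (metis id_apply transpose_apply_first zero_neq_one One_nat_def)
  show ?thesis
    unfolding wedge_def by (simp add: S ne sign_swap_id)
qed

definition twisted_dt :: "('g, 'd::real_normed_vector, 'm, 'e) groupoid \<Rightarrow> ('g \<Rightarrow> real) \<Rightarrow> ('g \<times>
  real, 'd \<times> real) form" where
  "twisted_dt G \<sigma> = pullback (arr (twisted_product G \<sigma>)) real_atlas snd (ext_deriv real_atlas
    (zero_form (\<lambda>t. t)))"

definition twisted_Omega :: "('g, 'd::real_normed_vector, 'm, 'e) groupoid \<Rightarrow> ('g, 'd) form \<Rightarrow> ('g \<Rightarrow>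
  real) \<Rightarrow> ('g \<times> real, 'd \<times> real) form" where
  "twisted_Omega G \<eta> \<sigma> = (\<lambda>p vs. - (pullback (arr (twisted_product G \<sigma>)) (arr G) fst (ext_deriv
    (arr G) \<eta>) p vs +
      wedge 1 1 (twisted_dt G \<sigma>) (pullback (arr (twisted_product G \<sigma>)) (arr G) fst \<eta>) p vs))"

definition twisted_theta :: "('g, 'd::real_normed_vector, 'm, 'e) groupoid \<Rightarrow> ('g \<Rightarrow> real) \<Rightarrow> ('g \<times>
  real, 'd \<times> real) form" where
  "twisted_theta G \<sigma> = (\<lambda>p vs. exp ((\<sigma> \<circ> fst) p) *
     (ext_deriv (arr (twisted_product G \<sigma>)) (zero_form (\<sigma> \<circ> fst)) p vs - (- twisted_dt G \<sigma> p vs)))"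

definition base_dt :: "('g, 'd, 'm, 'e::real_normed_vector) groupoid \<Rightarrow> ('g \<Rightarrow> real) \<Rightarrow>
    'm \<times> real \<Rightarrow> ('m \<times> real, 'e \<times> real) tvec \<Rightarrow> real" where
  "base_dt G \<sigma> x v = tmap (obj (twisted_product G \<sigma>)) real_atlas snd x v rchart"

lemma twisted_dt_eq: "twisted_dt G \<sigma> p [Z] = tmap (arr (twisted_product G \<sigma>)) real_atlas snd p Z rchart"
proof -
  have c: "chart_of real_atlas t = rchart" for t by (simp add: chart_of_def)
  have "frechet_derivative (\<lambda>x::real. x) (at x) = (\<lambda>h. h)" for x
    by (rule frechet_derivative_at[symmetric, OF has_derivative_ident])
  then show ?thesis
    by (simp add: twisted_dt_def pullback_def ext_deriv_def c Let_def coord_form_def zero_form_def)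
qed

lemma twisted_Omega_eq:
  fixes G :: "('g, 'd::real_normed_vector, 'm, 'e) groupoid" and \<sigma> :: "'g \<Rightarrow> real" and p :: "'g \<times> real"
  defines "X \<equiv> tmap (arr (twisted_product G \<sigma>)) (arr G) fst p"
  shows "twisted_Omega G \<eta> \<sigma> p [Z, W] = - (ext_deriv (arr G) \<eta> (fst p) [X Z, X W]
     + (twisted_dt G \<sigma> p [Z] * \<eta> (fst p) [X W] - twisted_dt G \<sigma> p [W] * \<eta> (fst p) [X Z]))"
  unfolding twisted_Omega_def wedge_1_1 by (simp add: pullback_def X_def)

section \<open>Contact groupoids\<close>

text \<open>Inherited from the family by uniqueness of derivatives. Together with linearity in the
  direction \<open>h\<close> it makes the exterior derivative of a 1-form bilinear.\<close>

lemma derivative_family_linear: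
  fixes lam :: "'c::real_normed_vector \<Rightarrow> 'a::real_vector \<Rightarrow> 'b::real_normed_vector"
  assumes U: "open U" "x \<in> U" and lin: "\<And>y. y \<in> U \<Longrightarrow> linear (lam y)"
    and L: "\<And>w. ((\<lambda>y. lam y w) has_derivative L w) (at x)"
  shows "linear (\<lambda>w. L w h)"
proof (rule linearI)
  fix w1 w2
  have "((\<lambda>y. lam y w1 + lam y w2) has_derivative (\<lambda>h. L w1 h + L w2 h)) (at x)"
    by (intro has_derivative_add L)
  then have "((\<lambda>y. lam y (w1 + w2)) has_derivative (\<lambda>h. L w1 h + L w2 h)) (at x)"
    by (rule has_derivative_transform_within_open[OF _ U]) (simp add: linear_add[OF lin])
  then show "L (w1 + w2) h = L w1 h + L w2 h"
    using fun_cong[OF has_derivative_unique[OF L]] by blast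
next
  fix r w
  have "((\<lambda>y. r *\<^sub>R lam y w) has_derivative (\<lambda>h. r *\<^sub>R L w h)) (at x)"
    by (intro has_derivative_scaleR_right L)
  then have "((\<lambda>y. lam y (r *\<^sub>R w)) has_derivative (\<lambda>h. r *\<^sub>R L w h)) (at x)"
    by (rule has_derivative_transform_within_open[OF _ U]) (simp add: linear_scale[OF lin])
  then show "L (r *\<^sub>R w) h = r *\<^sub>R L w h"
    using fun_cong[OF has_derivative_unique[OF L]] by blast
qed

lemma ext_deriv_1form:
  "ext_deriv A \<eta> p [V, W] =
     frechet_derivative (\<lambda>x. coord_form A \<eta> (chart_of A p) x [W (chart_of A p)])
       (at (cmap (chart_of A p) p)) (V (chart_of A p))
     - frechet_derivative (\<lambda>x. coord_form A \<eta> (chart_of A p) x [V (chart_of A p)])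
       (at (cmap (chart_of A p) p)) (W (chart_of A p))"
  by (simp add: ext_deriv_def Let_def numeral_2_eq_2)

lemma ext_deriv_0form:
  assumes A: "smooth_atlas A" and f: "smooth_map A real_atlas f" and v: "velocity A \<gamma> p V"
  shows "((\<lambda>s. f (\<gamma> s)) has_real_derivative ext_deriv A (zero_form f) p [V]) (at 0)"
proof -
  let ?c = "chart_of A p"
  have V: "V \<in> tspace A p" by (rule velocity_tspace[OF A v])
  have "tmap A real_atlas f p V rchart = frechet_derivative (cmap rchart \<circ> f \<circ> cinv ?c) (at (cmap ?c p)) (V ?c)"
    by (rule tmap_coord[OF A smooth_atlas_real f UNIV_I V chart_of_mem[OF A]]) simp
  then have "ext_deriv A (zero_form f) p [V] = tmap A real_atlas f p V rchart"
    by (simp add: ext_deriv_def Let_def zero_form_def coord_form_def o_def)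
  then show ?thesis
    using velocity_map[OF A smooth_atlas_real f UNIV_I v] by (simp add: velocity_real)
qed

context
  fixes A :: "('m::{t2_space,second_countable_topology}, 'd::euclidean_space) chart set"
    and \<eta> :: "('m, 'd) form" and p :: 'm
  assumes A: "smooth_atlas A" and \<eta>: "smooth_form A 1 \<eta>"
begin

private abbreviation (input) "c \<equiv> chart_of A p"
private abbreviation (input) "a x u \<equiv> coord_form A \<eta> c x [u]"
private abbreviation (input) "b u w \<equiv> frechet_derivative (\<lambda>x. a x w) (at (cmap c p)) u
  - frechet_derivative (\<lambda>x. a x u) (at (cmap c p)) w"

private lemma U: "open (cmap c ` cdom c)" "cmap c p \<in> cmap c ` cdom c"
  using chart_open(2)[OF A] chart_of_mem[OF A, of p] by (auto simp: charts_at_def)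

private lemma lin: "x \<in> cmap c ` cdom c \<Longrightarrow> linear (a x)"
  using smooth_form1_coord(2)[OF \<eta> charts_at_atlas[OF chart_of_mem[OF A]]] by blast

private lemma hd: "((\<lambda>x. a x w) has_derivative frechet_derivative (\<lambda>x. a x w) (at (cmap c p))) (at (cmap c p))"
  by (rule Cinf_on_has_derivative[OF smooth_form1_coord(1)[OF \<eta> charts_at_atlas[OF chart_of_mem[OF A]]] U(2)])

private lemma b_linear: "linear (\<lambda>u. b u w)" "linear (b u)"
proof -
  show "linear (\<lambda>u. b u w)"
    by (rule linear_compose_sub[OF has_derivative_linear[OF hd] derivative_family_linear[OF U lin hd]])
  show "linear (b u)"
    by (rule linear_compose_sub[OF derivative_family_linear[OF U lin hd] has_derivative_linear[OF hd]])
qed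

lemma ext_deriv_bilinear:
  obtains b' where "\<And>w. linear (\<lambda>u. b' u w)" "\<And>u. linear (b' u)"
    "\<And>V W. ext_deriv A \<eta> p [V, W] = b' (V c) (W c)"
  using b_linear ext_deriv_1form[of A \<eta> p] by (rule that[of "\<lambda>u w. b u w"])

lemma form1_linear:
  obtains a' where "linear a'" "\<And>V. V \<in> tspace A p \<Longrightarrow> \<eta> p [V] = a' (V c)"
  using lin[OF U(2)] form1_coord[OF A _ chart_of_mem[OF A]] by (rule that)

lemma ext_deriv_diff_left:
  "ext_deriv A \<eta> p [V - V', W] = ext_deriv A \<eta> p [V, W] - ext_deriv A \<eta> p [V', W]"
  unfolding ext_deriv_1form using linear_diff[OF b_linear(1)] by simp

lemma ext_deriv_diff_right:
  "ext_deriv A \<eta> p [V, W - W'] = ext_deriv A \<eta> p [V, W] - ext_deriv A \<eta> p [V, W']"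
  unfolding ext_deriv_1form using linear_diff[OF b_linear(2)] by simp

lemma contact_form_nondegenerate:
  assumes contact: "contact_form A \<eta>"
  shows "\<exists>Y\<in>tspace A p. \<eta> p [Y] \<noteq> 0"
    and "X \<in> tspace A p \<Longrightarrow> \<eta> p [X] = 0 \<Longrightarrow>
      (\<And>Y. Y \<in> tspace A p \<Longrightarrow> ext_deriv A \<eta> p [X, Y] = r * \<eta> p [Y]) \<Longrightarrow> X = (\<lambda>_. 0) \<and> r = 0"
proof -
  have c: "c \<in> charts_at A p" by (rule chart_of_mem[OF A])
  obtain n vs where n: "DIM('d) = 2 * n + 1" and vs: "length vs = 2 * n + 1" "set vs \<subseteq> tspace A p"
    and nz: "wedge 1 (2 * n) \<eta> (wedge_power 2 (ext_deriv A \<eta>) n) p vs \<noteq> 0"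
    using contact unfolding contact_form_def by blast
  have "vs ! i \<in> tspace A p" if "i < 2 * n + 1" for i using that vs nth_mem by (metis subsetD)
  then have "wedge 1 (2 * n) \<eta> (wedge_power 2 (ext_deriv A \<eta>) n) p vs
      = (1 / 2) ^ n * contact_volume n (a (cmap c p)) (\<lambda>u w. b u w) (\<lambda>i. (vs ! i) c)"
    by (intro contact_volume_wedge vs form1_coord[OF A _ c] ext_deriv_1form) auto
  then have vol: "contact_volume n (a (cmap c p)) (\<lambda>u w. b u w) (\<lambda>i. (vs ! i) c) \<noteq> 0" using nz by auto
  note nd = contact_nondegenerate[OF lin[OF U(2)] b_linear n vol]
  have X: "X c = 0 \<and> r = 0" if X: "X \<in> tspace A p" "\<eta> p [X] = 0"
    "\<And>Y. Y \<in> tspace A p \<Longrightarrow> ext_deriv A \<eta> p [X, Y] = r * \<eta> p [Y]" for X r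
  proof -
    have "a (cmap c p) (X c) = 0" using X form1_coord[OF A X(1) c, of \<eta>] by simp
    moreover have "b (X c) y = r * a (cmap c p) y" for y
      using X(3)[OF coord_vec_self(2)[OF A c, of y]] form1_coord[OF A coord_vec_self(2)[OF A c, of y] c, of \<eta>]
      unfolding ext_deriv_1form by (simp add: coord_vec_self(1)[OF A c])
    ultimately show ?thesis using nd[of "X c" r] by simp
  qed
  show "X = (\<lambda>_. 0) \<and> r = 0" if "X \<in> tspace A p" "\<eta> p [X] = 0"
    "\<And>Y. Y \<in> tspace A p \<Longrightarrow> ext_deriv A \<eta> p [X, Y] = r * \<eta> p [Y]"
    using X[OF that] tspace_eqI[OF that(1) tspace_zero[OF A] c] by simp
  show "\<exists>Y\<in>tspace A p. \<eta> p [Y] \<noteq> 0"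
  proof (rule ccontr)
    assume "\<not> ?thesis"
    then have "\<eta> p [Y] = 0" if "Y \<in> tspace A p" for Y using that by blast
    \<comment> \<open>If \<eta> vanished at \<open>p\<close>, the zero vector with
      \<open>r = 1\<close> would meet the hypotheses of the second claim, which gives
      \<open>r = 0\<close>.\<close>
    then have "(0::'d) = 0 \<and> (1::real) = 0"
      using X[OF tspace_zero[OF A], of 1] form1_zero[OF A \<eta>] ext_deriv_diff_left[of "\<lambda>_. 0" "\<lambda>_. 0"]
      by (simp add: fun_diff_def)
    then show False by simp
  qed
qed

end

lemma contact_groupoidD:
  assumes "contact_groupoid G \<eta> \<sigma>"
  shows "lie_groupoid G" "contact_form (arr G) \<eta>" "smooth_form (arr G) 1 \<eta>" "smooth_map (arr G) real_atlas \<sigma>"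
    "\<And>g h Z. src G g = tgt G h \<Longrightarrow> Z \<in> tspace_comp G (g, h) \<Longrightarrow>
        \<eta> (mul G (g, h)) [tmul G (g, h) Z] =
        \<eta> g [tpr1 G (g, h) Z] + exp (\<sigma> g) * \<eta> h [tpr2 G (g, h) Z]"
proof -
  show "lie_groupoid G" "contact_form (arr G) \<eta>" "smooth_form (arr G) 1 \<eta>" "smooth_map (arr G) real_atlas \<sigma>"
    using assms unfolding contact_groupoid_def contact_form_def by blast+
  fix g h Z assume "src G g = tgt G h" and Z: "Z \<in> tspace_comp G (g, h)"
  then have "(g, h) \<in> composable G" by (simp add: composable_def)
  then show "\<eta> (mul G (g, h)) [tmul G (g, h) Z] =
        \<eta> g [tpr1 G (g, h) Z] + exp (\<sigma> g) * \<eta> h [tpr2 G (g, h) Z]"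
    using assms Z unfolding contact_groupoid_def by blast
qed

section \<open>Consequences of the multiplicativity of \<eta>\<close>

context
  fixes G :: "('g::{t2_space,second_countable_topology}, 'd::euclidean_space,
               'm::{t2_space,second_countable_topology}, 'e::real_normed_vector) groupoid"
    and \<eta> :: "('g, 'd) form" and \<sigma> :: "'g \<Rightarrow> real"
  assumes contact: "contact_groupoid G \<eta> \<sigma>"
begin

private lemmas G = contact_groupoidD(1)[OF contact]
private lemmas A = lie_groupoidD(1)[OF G] and M = lie_groupoidD(2)[OF G]
private lemmas AA = smooth_atlas_prod[OF A A]
private lemmas form = contact_groupoidD(3)[OF contact]

lemma contact_mul_curve:
  assumes "velocity (arr G) \<gamma> g X" "velocity (arr G) \<delta> h Y" "\<forall>\<^sub>F s in nhds 0. src G (\<gamma> s) = tgt G (\<delta> s)"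
    and V: "velocity (arr G) (\<lambda>s. mul G (\<gamma> s, \<delta> s)) (mul G (g, h)) V"
  shows "\<eta> (mul G (g, h)) [V] = \<eta> g [X] + exp (\<sigma> g) * \<eta> h [Y]"
proof -
  have "src G g = tgt G h"
    using eventually_nhds_x_imp_x[OF assms(3)] velocityD(1)[OF assms(1)] velocityD(1)[OF assms(2)] by simp
  moreover obtain Z where Z: "Z \<in> tspace_comp G (g, h)"
    "tpr1 G (g, h) Z = X" "tpr2 G (g, h) Z = Y"
    "velocity (arr G) (\<lambda>s. mul G (\<gamma> s, \<delta> s)) (mul G (g, h))
       (tmul G (g, h) Z)"
    using mul_curveE[OF G assms(1-3)] .
  ultimately show ?thesis
    using contact_groupoidD(5)[OF contact _ Z(1)] unfolding velocity_eq[OF V Z(4)] Z(2,3) by blast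
qed

text \<open>A unit vector \<open>u\<close> satisfies \<open>u \<oplus> u = u\<close>, so
  \<open>\<eta> u = \<eta> u + e^\<sigma> \<eta> u\<close>, and the exponential is not 0. At this
  stage the value of \<sigma> on units is still unknown.\<close>

lemma contact_form_idt:
  assumes w: "w \<in> tspace (obj G) x"
  shows "\<eta> (idt G x) [tidt G x w] = 0"
proof -
  obtain \<delta> where \<delta>: "velocity (obj G) \<delta> x w" using tspace_velocity[OF M w] .
  note v = velocity_map[OF M A lie_groupoidD(7)[OF G] UNIV_I \<delta>]
  have m: "mul G (idt G y, idt G y) = idt G y" for y
    using lie_groupoidD(14)[OF G, of "idt G y"] by (simp add: lie_groupoidD(9)[OF G])
  have "\<eta> (mul G (idt G x, idt G x)) [tidt G x w] =
      \<eta> (idt G x) [tidt G x w] + exp (\<sigma> (idt G x)) * \<eta> (idt G x) [tidt G x w]"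
    by (rule contact_mul_curve[OF v v]) (simp_all add: lie_groupoidD(9,10)[OF G] m v)
  then show ?thesis by (simp add: m)
qed

text \<open>Some vector at the unit is not annihilated by \<eta>; removing its unit part, which
  \<eta> kills, moves it into the algebroid. It is the probe against which \<sigma> is
  measured.\<close>

lemma contact_form_algebroid: "\<exists>Y\<in>algebroid_fibre G x. \<eta> (idt G x) [Y] \<noteq> 0"
proof -
  obtain Y where Y: "Y \<in> tspace (arr G) (idt G x)" "\<eta> (idt G x) [Y] \<noteq> 0"
    using contact_form_nondegenerate(1)[OF A form contact_groupoidD(2)[OF contact]] by blast
  note p = idt_tgt_projection[OF G Y(1)]
  have "\<eta> (idt G x) [Y - tidt G x (ttgt G (idt G x) Y)] \<noteq> 0"
    using form1_diff[OF A form Y(1) p(2)] contact_form_idt[OF p(1)] Y(2) by simp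
  then show ?thesis using p(3) by blast
qed

text \<open>Both \<open>g(h\<kappa>)\<close> and \<open>(gh)\<kappa>\<close> describe the same left translation of a vector \<open>Y\<close> tangent to a target
  fibre, which scales \<open>\<eta>(Y)\<close> by \<open>e\<^sup>\<sigma>\<close> of the arrow.\<close>
lemma sigma_mult:
  assumes gh: "src G g = tgt G h"
  shows "\<sigma> (mul G (g, h)) = \<sigma> g + \<sigma> h"
proof -
  let ?x = "src G h"
  let ?e = "idt G ?x"
  obtain Y where Y: "Y \<in> algebroid_fibre G ?x" "\<eta> ?e [Y] \<noteq> 0" using contact_form_algebroid by blast
  obtain k where k: "velocity (arr G) k ?e Y" "\<forall>\<^sub>F s in nhds 0. tgt G (k s) = ?x"
    using algebroid_curve[OF G Y(1)] .
  have ev1: "\<forall>\<^sub>F s in nhds 0. src G h = tgt G (k s)" using k(2) by eventually_elim simp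
  have ev2: "\<forall>\<^sub>F s in nhds 0. src G g = tgt G (mul G (h, k s))"
    using ev1 by eventually_elim (simp add: gh lie_groupoidD(12)[OF G])
  have ev3: "\<forall>\<^sub>F s in nhds 0. src G (mul G (g, h)) = tgt G (k s)"
    using ev1 by eventually_elim (simp add: lie_groupoidD(11)[OF G gh])
  have ev4: "\<forall>\<^sub>F s in nhds 0. mul G (g, mul G (h, k s)) = mul G (mul G (g, h), k s)"
    using ev1 by eventually_elim (simp add: lie_groupoidD(13)[OF G gh])
  have he: "mul G (h, ?e) = h" by (rule lie_groupoidD(14)[OF G])
  have ghe: "mul G (mul G (g, h), ?e) = mul G (g, h)"
    using lie_groupoidD(14)[OF G, of "mul G (g, h)"] by (simp add: lie_groupoidD(11)[OF G gh])
  obtain V1 where V1: "velocity (arr G) (\<lambda>s. mul G (h, k s)) (mul G (h, ?e)) V1"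
    using mul_curveE[OF G velocity_const k(1) ev1] by blast
  have 1: "\<eta> h [V1] = exp (\<sigma> h) * \<eta> ?e [Y]"
    using contact_mul_curve[OF velocity_const k(1) ev1 V1] form1_zero[OF A form] he by simp
  obtain V2 where V2: "velocity (arr G) (\<lambda>s. mul G (g, mul G (h, k s))) (mul G (g, h)) V2"
    using mul_curveE[OF G velocity_const V1[unfolded he] ev2] by blast
  have 2: "\<eta> (mul G (g, h)) [V2] = exp (\<sigma> g) * \<eta> h [V1]"
    using contact_mul_curve[OF velocity_const V1[unfolded he] ev2 V2] form1_zero[OF A form] by simp
  have "\<eta> (mul G (mul G (g, h), ?e)) [V2] = exp (\<sigma> (mul G (g, h))) * \<eta> ?e [Y]"
    using contact_mul_curve[OF velocity_const k(1) ev3, of V2] velocity_cong[OF V2 ev4] form1_zero[OF A form]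
    by (simp add: ghe)
  then have "exp (\<sigma> (mul G (g, h))) = exp (\<sigma> g) * exp (\<sigma> h)" using 1 2 Y(2) by (simp add: ghe)
  then show ?thesis by (metis exp_add exp_inj_iff)
qed

lemma sigma_idt: "\<sigma> (idt G x) = 0"
  using sigma_mult[of "idt G x" "idt G x"] lie_groupoidD(14)[OF G, of "idt G x"]
  by (simp add: lie_groupoidD(9,10)[OF G])

text \<open>This is \<open>d\<close> applied to
  \<open>m^*\<eta> = pr1^*\<eta> + e^\<sigma> pr2^*\<eta>\<close>. The middle term is
  \<open>e^\<sigma> d\<sigma> \<and> \<eta>\<close>; the numbers \<open>r\<close> and
  \<open>r'\<close> are the values of \<open>d\<sigma>\<close> on the first components of
  \<open>Z\<close> and \<open>Z'\<close>. The proof applies \<open>closed_on_level_set\<close> to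
  the difference of the two sides in charts.\<close>

lemma ext_deriv_contact_mul:
  assumes gh: "src G g = tgt G h" and Z: "Z \<in> tspace_comp G (g, h)" and Z': "Z' \<in> tspace_comp G (g, h)"
    and \<gamma>: "velocity (arr G) \<gamma> g (tpr1 G (g, h) Z)" "((\<lambda>s. \<sigma> (\<gamma> s)) has_real_derivative r) (at 0)"
    and \<gamma>': "velocity (arr G) \<gamma>' g (tpr1 G (g, h) Z')" "((\<lambda>s. \<sigma> (\<gamma>' s)) has_real_derivative r') (at 0)"
  shows "ext_deriv (arr G) \<eta> (mul G (g, h)) [tmul G (g, h) Z,
       tmul G (g, h) Z'] =
    ext_deriv (arr G) \<eta> g [tpr1 G (g, h) Z, tpr1 G (g, h) Z']
    + exp (\<sigma> g) * (r * \<eta> h [tpr2 G (g, h) Z'] - r' * \<eta> h [tpr2 G (g, h) Z])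
    + exp (\<sigma> g) * ext_deriv (arr G) \<eta> h [tpr2 G (g, h) Z, tpr2 G (g, h) Z']"
proof -
  define m where "m = mul G (g, h)"
  define c1 where "c1 = chart_of (arr G) g"
  define c2 where "c2 = chart_of (arr G) h"
  define c3 where "c3 = chart_of (arr G) m"
  define cM where "cM = chart_of (obj G) (src G g)"
  define C where "C = cprod c1 c2"
  have c1: "c1 \<in> charts_at (arr G) g" and c2: "c2 \<in> charts_at (arr G) h" and c3: "c3 \<in> charts_at (arr G) m"
    and cM: "cM \<in> charts_at (obj G) (src G g)"
    unfolding c1_def c2_def c3_def cM_def by (intro chart_of_mem A M)+
  have C: "C \<in> charts_at (arr2 G) (g, h)" unfolding C_def by (rule cprod_charts_at[OF c1 c2])
  note C_mem = charts_at_atlas[OF C] and c1_mem = charts_at_atlas[OF c1] and c2_mem = charts_at_atlas[OF c2]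
    and c3_mem = charts_at_atlas[OF c3] and cM_mem = charts_at_atlas[OF cM]
  define z0 where "z0 = cmap C (g, h)"
  have p: "(g, h) \<in> composable G" using gh by (simp add: composable_def)
  obtain F W where W: "(g, h) \<in> W" "smooth_map_open (arr2 G) (arr G) W F"
    and F: "\<forall>q\<in>W \<inter> composable G. F q = mul G q"
    using lie_groupoidD(8)[OF G p] unfolding local_extension_def by blast
  have Fm: "F (g, h) = m" using F W p by (simp add: m_def)
  \<comment> \<open>One extension \<open>F\<close> is used at all nearby composable pairs, whereas
    \<open>tmul\<close> may rest on a different choice at each of them.\<close>
  have tmF: "tmul G q Y = tmap (arr2 G) (arr G) F q Y"
    if q: "q \<in> W" "q \<in> composable G" and Y: "Y \<in> tspace_comp G q" for q Y
  proof -
    have "src G (fst q) = tgt G (snd q)" "Y \<in> tspace_comp G (fst q, snd q)"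
      using q(2) Y by (auto simp: composable_def)
    from composable_curve[OF G this]
    obtain k where k: "velocity (arr2 G) k q Y" "\<forall>\<^sub>F s in nhds 0. k s \<in> composable G"
      unfolding prod.collapse .
    have "\<forall>\<^sub>F s in nhds 0. k s \<in> W"
      by (rule isCont_eventually_mem[OF velocityD(2)[OF k(1)] smooth_map_open_open[OF W(2)]])
        (simp add: velocityD(1)[OF k(1)] q)
    with k(2) have "\<forall>\<^sub>F s in nhds 0. F (k s) = mul G (k s)" by eventually_elim (use F in blast)
    moreover have "F q = mul G q" using F q by blast
    ultimately show ?thesis
      using velocity_unique[OF velocity_map[OF AA A W(2) q(1) k(1)], of
        "\<lambda>s. mul G (k s)"] velocity_mul[OF G k] by simp
  qed
  define fS :: "'g \<times> 'g \<Rightarrow> 'm" where "fS = (\<lambda>q. src G (fst q))"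
  define fT :: "'g \<times> 'g \<Rightarrow> 'm" where "fT = (\<lambda>q. tgt G (snd q))"
  have fS: "smooth_map (arr2 G) (obj G) fS" and fT: "smooth_map (arr2 G) (obj G) fT"
    unfolding fS_def fT_def using smooth_map_src_fst[OF G] smooth_map_tgt_snd[OF G] by (auto simp: comp_def)
  \<comment> \<open>Cut down so that the extended products lie in one chart of the arrows, and the
    two base points, which need not coincide here, in one chart of the base.\<close>
  define N where "N = {q \<in> W. F q \<in> cdom c3} \<inter> {q \<in> UNIV. fS q \<in> cdom cM} \<inter> {q \<in> UNIV. fT q \<in> cdom cM}"
  define U where "U = cmap C ` (cdom C \<inter> N)"
  have oN: "open N" unfolding N_def
    using smooth_map_open_coord(1)[OF AA A W(2) C_mem c3_mem] smooth_map_open_coord(1)[OF AA M fS C_mem cM_mem]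
      smooth_map_open_coord(1)[OF AA M fT C_mem cM_mem] by blast
  have oU: "open U" unfolding U_def by (rule chart_image_open[OF AA C_mem oN])
  have pN: "(g, h) \<in> N" using W Fm c3 cM gh by (auto simp: N_def fS_def fT_def charts_at_def)
  have z0: "z0 \<in> U" unfolding U_def z0_def using pN charts_at_dom[OF C] by blast
  have cz0: "cinv C z0 = (g, h)" unfolding z0_def by (rule cinv_cmap[OF AA C_mem charts_at_dom[OF C]])
  have Uq: "cinv C z \<in> cdom C" "cinv C z \<in> N" "cmap C (cinv C z) = z" if "z \<in> U" for z
  proof -
    obtain q where q: "q \<in> cdom C" "q \<in> N" "z = cmap C q"
      using \<open>z \<in> U\<close> unfolding U_def by blast
    then have "cinv C z = q" using cinv_cmap[OF AA C_mem] by simp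
    then show "cinv C z \<in> cdom C" "cinv C z \<in> N" "cmap C (cinv C z) = z" using q by simp_all
  qed
  have Uz: "fst z = cmap c1 (fst (cinv C z))" "snd z = cmap c2 (snd (cinv C z))"
    "c1 \<in> charts_at (arr G) (fst (cinv C z))" "c2 \<in> charts_at (arr G) (snd (cinv C z))"
    "C \<in> charts_at (arr2 G) (cinv C z)" "c3 \<in> charts_at (arr G) (F (cinv C z))" "cinv C z \<in> W"
    "cM \<in> charts_at (obj G) (fS (cinv C z))" "cM \<in> charts_at (obj G) (fT (cinv C z))" if "z \<in> U" for z
    using Uq[OF that] c1_mem c2_mem C_mem c3_mem cM_mem
    by (auto simp: C_def N_def charts_at_def map_prod_def split_def prod_eq_iff)
  define f where "f = cmap c3 \<circ> F \<circ> cinv C"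
  define sg where "sg = cmap rchart \<circ> (\<lambda>q. \<sigma> (fst q)) \<circ> cinv C"
  define \<psi>S where "\<psi>S = cmap cM \<circ> fS \<circ> cinv C"
  define \<psi>T where "\<psi>T = cmap cM \<circ> fT \<circ> cinv C"
  \<comment> \<open>Its zero level is the set of composable pairs, and the kernel of its derivative
    there is \<open>tspace_comp\<close>.\<close>
  define \<psi> where "\<psi> z = \<psi>S z - \<psi>T z" for z
  have s2: "smooth_map (arr2 G) real_atlas (\<lambda>q. \<sigma> (fst q))"
    by (rule smooth_map_comp_fst[OF A A smooth_atlas_real contact_groupoidD(4)[OF contact]])
  have Cf: "Cinf_on U f" unfolding f_def
    by (rule Cinf_on_subset[OF smooth_map_open_coord(3)[OF AA A W(2) C_mem c3_mem]]) (auto simp: U_def N_def)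
  have CS: "Cinf_on U \<psi>S" unfolding \<psi>S_def
    by (rule Cinf_on_subset[OF smooth_map_open_coord(3)[OF AA M fS C_mem cM_mem]]) (auto simp: U_def N_def)
  have CT: "Cinf_on U \<psi>T" unfolding \<psi>T_def
    by (rule Cinf_on_subset[OF smooth_map_open_coord(3)[OF AA M fT C_mem cM_mem]]) (auto simp: U_def N_def)
  have C\<psi>: "Cinf_on U \<psi>" unfolding \<psi>_def by (rule Cinf_on_diff[OF CS CT oU])
  define D where "D z = frechet_derivative f (at z)" for z
  define \<psi>' where "\<psi>' z = frechet_derivative \<psi> (at z)" for z
  define ds where "ds = frechet_derivative sg (at z0)"
  have hf: "(f has_derivative D z) (at z)" if "z \<in> U" for z
    unfolding D_def by (rule Cinf_on_has_derivative[OF Cf that])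
  have h\<psi>: "(\<psi> has_derivative \<psi>' z) (at z)" if "z \<in> U" for z
    unfolding \<psi>'_def by (rule Cinf_on_has_derivative[OF C\<psi> that])
  have hs: "(sg has_derivative ds) (at z0)"
    unfolding ds_def sg_def z0_def
    by (rule smooth_map_open_derivative[OF AA smooth_atlas_real s2 UNIV_I C]) simp
  define D2 where "D2 w = frechet_derivative (\<lambda>z. D z w) (at z0)" for w
  define \<psi>'' where "\<psi>'' w = frechet_derivative (\<lambda>z. \<psi>' z w) (at z0)" for w
  have hD: "((\<lambda>z. D z w) has_derivative D2 w) (at z0)" for w
    unfolding D2_def D_def by (rule Cinf_on_has_derivative[OF Cinf_on_frechet[OF Cf] z0])
  have h\<psi>': "((\<lambda>z. \<psi>' z w) has_derivative \<psi>'' w) (at z0)" for w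
    unfolding \<psi>''_def \<psi>'_def by (rule Cinf_on_has_derivative[OF Cinf_on_frechet[OF C\<psi>] z0])
  have c\<psi>': "continuous_on U (\<lambda>z. \<psi>' z w)" for w
    unfolding \<psi>'_def by (rule Ck_on_continuous[OF Cinf_onD[OF Cinf_on_frechet[OF C\<psi>]]])
  have \<psi>'_tmap: "\<psi>' z (Y C) = tmap (arr2 G) (obj G) fS (cinv C z) Y cM - tmap (arr2 G) (obj G) fT
    (cinv C z) Y cM"
    if z: "z \<in> U" and Y: "Y \<in> tspace (arr2 G) (cinv C z)" for z Y
  proof -
    have "(\<psi> has_derivative (\<lambda>w. frechet_derivative \<psi>S (at z) w - frechet_derivative \<psi>T (at z) w)) (at z)"
      unfolding \<psi>_def using Cinf_on_has_derivative[OF CS z] Cinf_on_has_derivative[OF CT z]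
        by (rule has_derivative_diff)
    then have "\<psi>' z (Y C) = frechet_derivative \<psi>S (at z) (Y C) - frechet_derivative \<psi>T (at z) (Y C)"
      using fun_cong[OF has_derivative_unique[OF h\<psi>[OF z]]] by blast
    then show ?thesis
      using tmap_coord[OF AA M fS UNIV_I Y Uz(5,8)[OF z]] tmap_coord[OF AA M fT UNIV_I Y Uz(5,9)[OF z]]
      by (simp only: \<psi>S_def \<psi>T_def Uq(3)[OF z])
  qed
  define a1 where "a1 x u = coord_form (arr G) \<eta> c1 x [u]" for x u
  define a2 where "a2 x u = coord_form (arr G) \<eta> c2 x [u]" for x u
  define a3 where "a3 x u = coord_form (arr G) \<eta> c3 x [u]" for x u
  define A1 where "A1 u = frechet_derivative (\<lambda>x. a1 x u) (at (fst z0))" for u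
  define A2 where "A2 u = frechet_derivative (\<lambda>x. a2 x u) (at (snd z0))" for u
  define A3 where "A3 u = frechet_derivative (\<lambda>x. a3 x u) (at (f z0))" for u
  have x1: "fst z \<in> cmap c1 ` cdom c1" and x2: "snd z \<in> cmap c2 ` cdom c2" and x3: "f z \<in> cmap c3 ` cdom c3"
    if "z \<in> U" for z
    using Uz[OF that] by (auto simp: charts_at_def f_def)
  have hA1: "((\<lambda>x. a1 x u) has_derivative A1 u) (at (fst z0))" for u
    unfolding A1_def a1_def by (rule Cinf_on_has_derivative[OF smooth_form1_coord(1)[OF form c1_mem] x1[OF z0]])
  have hA2: "((\<lambda>x. a2 x u) has_derivative A2 u) (at (snd z0))" for u
    unfolding A2_def a2_def by (rule Cinf_on_has_derivative[OF smooth_form1_coord(1)[OF form c2_mem] x2[OF z0]])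
  have hA3: "((\<lambda>x. a3 x u) has_derivative A3 u) (at (f z0))" for u
    unfolding A3_def a3_def by (rule Cinf_on_has_derivative[OF smooth_form1_coord(1)[OF form c3_mem] x3[OF z0]])
  have l1: "linear (a1 (fst z))" and l2: "linear (a2 (snd z))" and l3: "linear (a3 (f z))" if "z \<in> U" for z
    unfolding a1_def a2_def a3_def
    using smooth_form1_coord(2)[OF form c1_mem x1[OF that]] smooth_form1_coord(2)[OF form c2_mem x2[OF that]]
      smooth_form1_coord(2)[OF form c3_mem x3[OF that]] by blast+
  \<comment> \<open>The multiplicativity defect of \<eta> as a 1-form in coordinates;
    \<open>L\<close> below is its derivative at \<open>z0\<close> by the product and chain
    rules.\<close>
  define lam where "lam z w = a3 (f z) (D z w) - a1 (fst z) (fst w) - exp (sg z) * a2 (snd z) (snd w)" for z w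
  define L where "L w w' = a3 (f z0) (D2 w w') + A3 (D z0 w) (D z0 w') - A1 (fst w) (fst w')
     - (exp (sg z0) * A2 (snd w) (snd w') + exp (sg z0) * ds w' * a2 (snd z0) (snd w))" for w w'
  have lamL: "((\<lambda>z. lam z w) has_derivative L w) (at z0)" for w
  proof -
    have d3: "((\<lambda>z. a3 (f z) u) has_derivative (\<lambda>w'. A3 u (D z0 w'))) (at z0)" for u
      by (rule has_derivative_compose[OF hf[OF z0] hA3])
    have "((\<lambda>z. a3 (f z) (D z w)) has_derivative (\<lambda>w'. a3 (f z0) (D2 w w') + A3 (D z0 w) (D z0 w'))) (at z0)"
      by (rule has_derivative_linear_family[OF d3 hD oU z0 l3])
    moreover have "((\<lambda>z. a1 (fst z) (fst w)) has_derivative (\<lambda>w'. A1 (fst w) (fst w'))) (at z0)"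
      by (rule has_derivative_compose[OF has_derivative_fst[OF has_derivative_ident] hA1])
    moreover have "((\<lambda>z. exp (sg z) * a2 (snd z) (snd w)) has_derivative
        (\<lambda>w'. exp (sg z0) * A2 (snd w) (snd w') + exp (sg z0) * ds w' * a2 (snd z0) (snd w))) (at z0)"
    proof -
      have "((\<lambda>z. a2 (snd z) (snd w)) has_derivative (\<lambda>w'. A2 (snd w) (snd w'))) (at z0)"
        by (rule has_derivative_compose[OF has_derivative_snd[OF has_derivative_ident] hA2])
      moreover have "((\<lambda>z. exp (sg z)) has_derivative (\<lambda>w'. exp (sg z0) * ds w')) (at z0)"
        using has_derivative_exp[OF hs] by (simp add: mult.commute)
      ultimately show ?thesis using has_derivative_mult by fastforce
    qed
    ultimately show ?thesis unfolding lam_def L_def by (intro has_derivative_diff)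
  qed
  have lamlin: "linear (lam z)" if "z \<in> U" for z
  proof -
    have D: "linear (D z)" by (rule has_derivative_linear[OF hf[OF that]])
    show ?thesis
      by (rule linearI) (simp_all add: lam_def linear_add[OF D] linear_scale[OF D] linear_add[OF l1[OF that]]
          linear_add[OF l2[OF that]] linear_add[OF l3[OF that]] linear_scale[OF l1[OF that]]
          linear_scale[OF l2[OF that]] linear_scale[OF l3[OF that]] algebra_simps)
  qed
  have \<psi>0: "\<psi> z0 = 0" by (simp add: \<psi>_def \<psi>S_def \<psi>T_def fS_def fT_def cz0 gh)
  \<comment> \<open>On the zero level a vector in the kernel of \<open>\<psi>'\<close> is composable
    and \<open>F\<close> has the tangent map of the multiplication, so the contact equation applies.
    It is needed at all nearby composable pairs, not only at \<open>(g, h)\<close>.\<close>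
  have van: "lam z w = 0" if z: "z \<in> U" "\<psi> z = \<psi> z0" "\<psi>' z w = 0" for z w
  proof -
    define q where "q = cinv C z"
    note Uz' = Uz[OF z(1), folded q_def]
    define Y where "Y = coord_vec (arr2 G) C q w"
    have Y: "Y \<in> tspace (arr2 G) q" "Y C = w" unfolding Y_def by (rule coord_vec_self[OF AA Uz'(5)])+
    have "cmap cM (fS q) = cmap cM (fT q)" using z(2) \<psi>0 by (simp add: \<psi>_def \<psi>S_def \<psi>T_def q_def)
    then have ST: "fS q = fT q" using Uz'(8,9) cinv_cmap[OF M cM_mem] by (metis charts_at_dom)
    then have qc: "q \<in> composable G" "src G (fst q) = tgt G (snd q)"
      by (simp_all add: fS_def fT_def composable_def split_def)
    have "tmap (arr2 G) (obj G) fS q Y cM = tmap (arr2 G) (obj G) fT q Y cM"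
      using \<psi>'_tmap[OF z(1), folded q_def, OF Y(1)] Y(2) z(3) by simp
    then have "tmap (arr2 G) (obj G) fS q Y = tmap (arr2 G) (obj G) fT q Y"
      using tmap_tspace[OF AA M fS UNIV_I Y(1)] tmap_tspace[OF AA M fT UNIV_I Y(1)] Uz'(8)
        tspace_eqI ST by metis
    then have Yc: "Y \<in> tspace_comp G q" using Y(1) by (simp add: tspace_comp_iff[OF G] fS_def fT_def)
    have Fq: "F q = mul G q" using F Uz'(7) qc by blast
    have V: "tmap (arr2 G) (arr G) F q Y \<in> tspace (arr G) (F q)" by (rule tmap_tspace[OF AA A W(2) Uz'(7) Y(1)])
    have "D z w = tmap (arr2 G) (arr G) F q Y c3"
      using tmap_coord[OF AA A W(2) Uz'(7) Y(1) Uz'(5,6)] Uq(3)[OF z(1)] Y(2) by (simp add: D_def f_def q_def)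
    then have e3: "a3 (f z) (D z w) = \<eta> (F q) [tmap (arr2 G) (arr G) F q Y]"
      using form1_coord[OF A V Uz'(6), of \<eta>] by (simp add: a3_def f_def q_def)
    have YC: "w = (tpr1 G q Y c1, tpr2 G q Y c2)"
      using tmap_fst_snd_coord[OF A A Y(1) Uz'(3,4)] Y(2) by (simp add: C_def)
    have e1: "a1 (fst z) (fst w) = \<eta> (fst q) [tpr1 G q Y]"
      using form1_coord[OF A tmap_tspace[OF AA A smooth_map_fst[OF A A] UNIV_I Y(1)] Uz'(3), of \<eta>] Uz'(1) YC
      by (simp add: a1_def)
    have e2: "a2 (snd z) (snd w) = \<eta> (snd q) [tpr2 G q Y]"
      using form1_coord[OF A tmap_tspace[OF AA A smooth_map_snd[OF A A] UNIV_I Y(1)] Uz'(4), of \<eta>] Uz'(2) YC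
      by (simp add: a2_def)
    have "\<eta> (mul G q) [tmul G q Y] =
        \<eta> (fst q) [tpr1 G q Y] + exp (\<sigma> (fst q)) * \<eta> (snd q) [tpr2 G q Y]"
      using contact_groupoidD(5)[OF contact qc(2)] Yc by simp
    moreover have "sg z = \<sigma> (fst q)" by (simp add: sg_def q_def)
    ultimately show ?thesis
      using e1 e2 e3 tmF[OF Uz'(7) qc(1) Yc] Fq by (simp add: lam_def)
  qed
  have "\<exists>w. \<psi>' z0 w = e" for e
  proof -
    obtain Y where Y: "Y \<in> tspace (arr2 G) (g, h)"
      "tmap (arr2 G) (obj G) fS (g, h) Y - tmap (arr2 G) (obj G) fT (g, h) Y = coord_vec (obj G) cM (src G g) e"
      using composable_tangent_onto[OF G gh coord_vec_self(2)[OF M cM]] unfolding fS_def fT_def by blast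
    have "tmap (arr2 G) (obj G) fS (g, h) Y cM - tmap (arr2 G) (obj G) fT (g, h) Y cM = e"
      using fun_cong[OF Y(2), of cM] coord_vec_self(1)[OF M cM] by simp
    then show ?thesis using \<psi>'_tmap[OF z0, unfolded cz0, OF Y(1)] by metis
  qed
  then have sj: "surj (\<psi>' z0)" by (metis surjI)
  have ker: "\<psi>' z0 (Y C) = 0" if "Y \<in> tspace_comp G (g, h)" for Y
    using \<psi>'_tmap[OF z0, unfolded cz0, of Y] that by (simp add: tspace_comp_iff[OF G] fS_def fT_def)
  have LL: "L (Z' C) (Z C) = L (Z C) (Z' C)"
    by (rule closed_on_level_set[OF oU z0 h\<psi> c\<psi>' sj h\<psi>' lamlin lamL van ker[OF Z] ker[OF Z']])
  \<comment> \<open>The second derivatives of the multiplication cancel, as always when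
    \<open>d\<close> is compared with a pullback.\<close>
  have sym: "D2 (Z C) (Z' C) = D2 (Z' C) (Z C)"
    by (rule second_derivative_symmetric[OF oU z0 hf hD hD])
  have *: "D z0 (Y C) = tmul G (g, h) Y c3"
    "fst (Y C) = tpr1 G (g, h) Y c1" "snd (Y C) = tpr2 G (g, h) Y c2"
    "a2 (snd z0) (snd (Y C)) = \<eta> h [tpr2 G (g, h) Y]"
    "velocity (arr G) k g (tpr1 G (g, h) Y) \<Longrightarrow> ((\<lambda>s. \<sigma> (k s)) has_real_derivative \<rho>) (at 0) \<Longrightarrow> ds (Y C) = \<rho>"
    if Yc: "Y \<in> tspace_comp G (g, h)" for Y k \<rho>
  proof -
    have Y: "Y \<in> tspace (arr2 G) (g, h)" using Yc by (simp add: tspace_comp_def)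
    have c3': "c3 \<in> charts_at (arr G) (F (g, h))" using c3 Fm by simp
    show "D z0 (Y C) = tmul G (g, h) Y c3"
      using tmap_coord[OF AA A W(2,1) Y C c3'] tmF[OF W(1) p Yc] by (simp add: D_def f_def z0_def)
    have YC: "Y C = (tpr1 G (g, h) Y c1, tpr2 G (g, h) Y c2)"
      using tmap_fst_snd_coord[OF A A Y, of c1 c2] c1 c2 by (simp add: C_def)
    show f: "fst (Y C) = tpr1 G (g, h) Y c1" and s: "snd (Y C) = tpr2 G (g, h) Y c2"
      unfolding YC by simp_all
    have "snd z0 = cmap c2 h" by (simp add: z0_def C_def)
    then show "a2 (snd z0) (snd (Y C)) = \<eta> h [tpr2 G (g, h) Y]"
      using form1_coord[OF A tmap_tspace[OF AA A smooth_map_snd[OF A A] UNIV_I Y], of c2 \<eta>] c2 s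
        by (simp add: a2_def)
    assume k: "velocity (arr G) k g (tpr1 G (g, h) Y)" "((\<lambda>s. \<sigma> (k s)) has_real_derivative \<rho>) (at 0)"
    have "ds (Y C) = tmap (arr2 G) real_atlas (\<lambda>q. \<sigma> (fst q)) (g, h) Y rchart"
      using tmap_coord[OF AA smooth_atlas_real s2 UNIV_I Y C, of rchart] by (simp add: ds_def sg_def z0_def)
    also have "\<dots> = tmap (arr G) real_atlas \<sigma> g (tpr1 G (g, h) Y) rchart"
      using tmap_compose[OF AA A smooth_atlas_real smooth_map_fst[OF A A] contact_groupoidD(4)[OF
        contact] s2 Y] by simp
    also have "\<dots> = \<rho>"
      using velocity_map[OF A smooth_atlas_real contact_groupoidD(4)[OF contact] UNIV_I k(1)]
        DERIV_unique[OF k(2)]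
      by (auto simp: velocity_real)
    finally show "ds (Y C) = \<rho>" .
  qed
  have "fst z0 = cmap c1 g" "snd z0 = cmap c2 h" by (simp_all add: z0_def C_def)
  moreover have "f z0 = cmap c3 m" "sg z0 = \<sigma> g" by (simp_all add: f_def sg_def cz0 Fm)
  ultimately have pts: "fst z0 = cmap c1 g" "snd z0 = cmap c2 h" "f z0 = cmap c3 m" "sg z0 = \<sigma> g" .
  have e1: "ext_deriv (arr G) \<eta> g [V, V'] = A1 (V' c1) (V c1) - A1 (V c1) (V' c1)" for V V'
    unfolding ext_deriv_1form A1_def a1_def pts c1_def by simp
  have e2: "ext_deriv (arr G) \<eta> h [V, V'] = A2 (V' c2) (V c2) - A2 (V c2) (V' c2)" for V V'
    unfolding ext_deriv_1form A2_def a2_def pts c2_def by simp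
  have e3: "ext_deriv (arr G) \<eta> m [V, V'] = A3 (V' c3) (V c3) - A3 (V c3) (V' c3)" for V V'
    unfolding ext_deriv_1form A3_def a3_def pts c3_def by simp
  show ?thesis
    using LL unfolding m_def[symmetric] e1 e2 e3 L_def sym pts(4) *(4)[OF Z] *(4)[OF Z']
      *(5)[OF Z \<gamma>] *(5)[OF Z' \<gamma>']
    unfolding *(1-3)[OF Z] *(1-3)[OF Z']
    by (simp add: algebra_simps)
qed

section \<open>The twisted forms and their non-degeneracy\<close>

private abbreviation (input) "H \<equiv> twisted_product G \<sigma>"
private abbreviation (input) "dt \<equiv> twisted_dt G \<sigma>"
private abbreviation (input) "\<Omega> \<equiv> twisted_Omega G \<eta> \<sigma>"
private abbreviation (input) "\<theta> \<equiv> twisted_theta G \<sigma>"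

private lemmas \<sigma> = contact_groupoidD(4)[OF contact]
private lemmas R = smooth_atlas_real
private lemmas AR = smooth_atlas_prod[OF A R] and MR = smooth_atlas_prod[OF M R]

lemma twisted_product_contact: "lie_groupoid H"
  by (rule twisted_product_lie_groupoid[OF G \<sigma> sigma_mult])

private lemmas H = twisted_product_contact
private lemmas B = lie_groupoidD(1)[OF H] and N = lie_groupoidD(2)[OF H]
private lemmas BB = smooth_atlas_prod[OF B B]

private lemma arrH: "arr H = prod_atlas (arr G) real_atlas" and objH: "obj H = prod_atlas (obj G) real_atlas"
  by simp_all

private lemma fst_arr: "smooth_map (arr H) (arr G) fst" and snd_arr: "smooth_map (arr H) real_atlas snd"
  and snd_obj: "smooth_map (obj H) real_atlas snd"
  unfolding arrH objH by (rule smooth_map_fst[OF A R], rule smooth_map_snd[OF A R], rule smooth_map_snd[OF M R])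

lemma base_dt_zero: "base_dt G \<sigma> x (\<lambda>_. 0) = 0"
  unfolding base_dt_def tmap_zero[OF N R snd_obj UNIV_I] by simp

lemma base_dt_diff: "base_dt G \<sigma> x (v - w) = base_dt G \<sigma> x v - base_dt G \<sigma> x w"
  unfolding base_dt_def tmap_diff[OF N R snd_obj UNIV_I] by simp

lemma dt_tgt: 
  assumes Z: "Z \<in> tspace (arr H) p"
  shows "dt p [Z] = base_dt G \<sigma> (tgt H p) (ttgt H p Z)"
proof -
  have *: "(\<lambda>q. snd (tgt H q)) = snd" by (auto simp: fun_eq_iff)
  have "tmap (arr H) real_atlas (\<lambda>q. snd (tgt H q)) p Z =
      tmap (obj H) real_atlas snd (tgt H p) (ttgt H p Z)"
    by (rule tmap_compose[OF B N R lie_groupoidD(6)[OF H] snd_obj _ Z]) (unfold *, rule snd_arr)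
  then show ?thesis unfolding twisted_dt_eq base_dt_def * by simp
qed

text \<open>The real component of the source is \<open>\<sigma> + t\<close>, with differential
  \<open>d\<sigma> + dt\<close>.\<close>

lemma theta_src:
  assumes Z: "Z \<in> tspace (arr H) p"
  shows "\<theta> p [Z] = exp (\<sigma> (fst p)) * base_dt G \<sigma> (src H p) (tsrc H p Z)"
proof -
  have s: "smooth_map (arr H) real_atlas (\<sigma> \<circ> fst)"
    using smooth_map_comp_fst[OF A R R \<sigma>] unfolding arrH comp_def .
  obtain k where k: "velocity (arr H) k p Z" using tspace_velocity[OF B Z] .
  have "((\<lambda>s. (\<sigma> \<circ> fst) (k s)) has_real_derivative ext_deriv (arr H) (zero_form (\<sigma> \<circ> fst)) p [Z]) (at 0)"
    by (rule ext_deriv_0form[OF B s k])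
  moreover have "((\<lambda>s. snd (k s)) has_real_derivative dt p [Z]) (at 0)"
    using velocity_map[OF B R snd_arr UNIV_I k] unfolding twisted_dt_eq velocity_real by blast
  ultimately have "((\<lambda>s. (\<sigma> \<circ> fst) (k s) + snd (k s)) has_real_derivative
      ext_deriv (arr H) (zero_form (\<sigma> \<circ> fst)) p [Z] + dt p [Z]) (at 0)"
    by (rule DERIV_add)
  moreover have "((\<lambda>s. snd (src H (k s))) has_real_derivative
      base_dt G \<sigma> (src H p) (tsrc H p Z)) (at 0)"
    using velocity_map[OF N R snd_obj UNIV_I velocity_map[OF B N lie_groupoidD(5)[OF H] UNIV_I k]]
    unfolding base_dt_def velocity_real by blast
  ultimately have "ext_deriv (arr H) (zero_form (\<sigma> \<circ> fst)) p [Z] + dt p [Z] =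
      base_dt G \<sigma> (src H p) (tsrc H p Z)"
    by (intro DERIV_unique) simp_all
  then show ?thesis by (simp add: twisted_theta_def del: twisted_product_simps)
qed

lemma Omega_antisym: "\<Omega> p [Z, W] = - \<Omega> p [W, Z]"
  unfolding twisted_Omega_eq ext_deriv_1form by simp

lemma Omega_zero: "\<Omega> p [\<lambda>_. 0, W] = 0" "\<Omega> p [W, \<lambda>_. 0] = 0"
proof -
  have z: "tmap (arr H) (arr G) fst p (\<lambda>_. 0) = (\<lambda>_. 0)" by (rule tmap_zero[OF B A fst_arr UNIV_I])
  have d: "dt p [\<lambda>_. 0] = 0" unfolding twisted_dt_eq tmap_zero[OF B R snd_arr UNIV_I] by simp
  have "ext_deriv (arr G) \<eta> (fst p) [\<lambda>_. 0, V] = 0" for V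
    using ext_deriv_diff_left[OF A form, of "fst p" "\<lambda>_. 0" "\<lambda>_. 0" V] by (simp add: fun_diff_def)
  then show "\<Omega> p [\<lambda>_. 0, W] = 0"
    unfolding twisted_Omega_eq z d form1_zero[OF A form] by simp
  then show "\<Omega> p [W, \<lambda>_. 0] = 0" using Omega_antisym[of p W "\<lambda>_. 0"] by simp
qed

lemma Omega_diff:
  assumes "V \<in> tspace (arr H) p" "W \<in> tspace (arr H) p"
  shows "\<Omega> p [Z, V - W] = \<Omega> p [Z, V] - \<Omega> p [Z, W]"
proof -
  have "tmap (arr H) (arr G) fst p V \<in> tspace (arr G) (fst p)"
    "tmap (arr H) (arr G) fst p W \<in> tspace (arr G) (fst p)"
    using tmap_tspace[OF B A fst_arr UNIV_I] assms by blast+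
  then show ?thesis
    unfolding twisted_Omega_eq twisted_dt_eq tmap_diff[OF B A fst_arr UNIV_I] tmap_diff[OF B R snd_arr UNIV_I]
    by (simp add: ext_deriv_diff_right[OF A form] form1_diff[OF A form] algebra_simps)
qed

text \<open>Testing against vectors \<open>(0, r)\<close> gives \<open>\<eta> X = 0\<close>, and
  against \<open>(Y, 0)\<close> it shows that \<open>d\<eta>\<close> pairs \<open>X\<close> with
  \<open>Y\<close> to a multiple of \<open>\<eta> Y\<close>, with factor minus the \<open>dt\<close>
  component of \<open>Z\<close>. The contact condition then kills both components of
  \<open>Z\<close>.\<close>

lemma Omega_nondegenerate:
  assumes Z: "Z \<in> tspace (arr H) p" and 0: "\<And>W. W \<in> tspace (arr H) p \<Longrightarrow> \<Omega> p [Z, W] = 0"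
  shows "Z = (\<lambda>_. 0)"
proof -
  define X where "X = tmap (arr H) (arr G) fst p Z"
  have X: "X \<in> tspace (arr G) (fst p)" unfolding X_def by (rule tmap_tspace[OF B A fst_arr UNIV_I Z])
  have *: "ext_deriv (arr G) \<eta> (fst p) [X, Y] + (dt p [Z] * \<eta> (fst p) [Y] - r * \<eta> (fst p) [X]) = 0"
    if Y: "Y \<in> tspace (arr G) (fst p)" for Y r
  proof -
    obtain k where k: "velocity (arr G) k (fst p) Y" using tspace_velocity[OF A Y] .
    have "((\<lambda>s. snd p + s * r) has_real_derivative r) (at 0)" by (auto intro!: derivative_eq_intros)
    from velocity_realI[OF this] have l: "velocity real_atlas (\<lambda>s. snd p + s * r) (snd p) (rvec r)" by simp
    obtain W where W: "W \<in> tspace (prod_atlas (arr G) real_atlas) (fst p, snd p)"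
      "tfst (arr G) real_atlas (fst p, snd p) W = Y"
      "tsnd (arr G) real_atlas (fst p, snd p) W = rvec r"
      using velocity_Pair[OF A R k l] by blast
    have "\<Omega> p [Z, W] = 0" using 0 W(1) by simp
    moreover have "tmap (arr H) (arr G) fst p W = Y" "dt p [W] = r" using W(2,3)
      by (simp_all add: twisted_dt_eq)
    ultimately show ?thesis unfolding twisted_Omega_eq X_def by simp
  qed
  \<comment> \<open>At \<open>Y = 0\<close> the instances \<open>r = 1\<close> and
    \<open>r = 0\<close> differ exactly by this term.\<close>
  have "\<eta> (fst p) [X] = 0"
    using *[OF tspace_zero[OF A], of 1] *[OF tspace_zero[OF A], of 0] by simp
  moreover have "ext_deriv (arr G) \<eta> (fst p) [X, Y] = (- dt p [Z]) * \<eta> (fst p) [Y]" if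
    "Y \<in> tspace (arr G) (fst p)" for Y
    using *[OF that, of 0] by simp
  ultimately have X0: "X = (\<lambda>_. 0)" "dt p [Z] = 0"
    using contact_form_nondegenerate(2)[OF A form contact_groupoidD(2)[OF contact] X] by fastforce+
  obtain l where l: "velocity (arr H) l p Z" using tspace_velocity[OF B Z] .
  have "tmap (arr H) real_atlas snd p Z = rvec 0"
    using tspace_real[OF tmap_tspace[OF B R snd_arr UNIV_I Z]] X0(2) by (simp add: twisted_dt_eq)
  also have "rvec 0 = (\<lambda>_. 0)" by (simp add: rvec_def)
  finally have "tmap (arr H) real_atlas snd p Z = (\<lambda>_. 0)" .
  then show ?thesis
    using X0(1) Z tspace_zero[OF AR] unfolding X_def arrH
    by (intro prod_tspace_eqI[OF A R, of Z p])
      (simp_all add: tmap_zero[OF AR A fst_arr[unfolded arrH] UNIV_I] tmap_zero[OF AR R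
        snd_arr[unfolded arrH] UNIV_I])
qed

lemma Omega_coord:
  obtains c b where "c \<in> charts_at (arr H) p" "\<And>w. linear (\<lambda>u. b u w)" "\<And>u. linear (b u)"
    "\<And>Z W. Z \<in> tspace (arr H) p \<Longrightarrow> W \<in> tspace (arr H) p \<Longrightarrow> \<Omega> p [Z, W] = b (Z c) (W c)"
proof -
  let ?c1 = "chart_of (arr G) (fst p)"
  have c1: "?c1 \<in> charts_at (arr G) (fst p)" by (rule chart_of_mem[OF A])
  obtain b' where b': "\<And>w. linear (\<lambda>u. b' u w)" "\<And>u. linear (b' u)"
    "\<And>V W. ext_deriv (arr G) \<eta> (fst p) [V, W] = b' (V ?c1) (W ?c1)"
    using ext_deriv_bilinear[OF A form, of "fst p"] by blast
  obtain a' where a': "linear a'" "\<And>V. V \<in> tspace (arr G) (fst p) \<Longrightarrow> \<eta> (fst p) [V] = a' (V ?c1)"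
    using form1_linear[OF A form, of "fst p"] by blast
  define b where "b u w = - (b' (fst u) (fst w) + (snd u * a' (fst w) - snd w * a' (fst u)))"
    for u w :: "'d \<times> real"
  show thesis
  proof
    show "cprod ?c1 rchart \<in> charts_at (arr H) p"
      using cprod_charts_at[OF c1, of rchart real_atlas "snd p"] by simp
    show "linear (\<lambda>u. b u w)" for w
      by (rule linearI) (simp_all add: b_def linear_add[OF b'(1)] linear_scale[OF b'(1)] linear_add[OF a'(1)]
          linear_scale[OF a'(1)] algebra_simps)
    show "linear (b u)" for u
      by (rule linearI) (simp_all add: b_def linear_add[OF b'(2)] linear_scale[OF b'(2)] linear_add[OF a'(1)]
          linear_scale[OF a'(1)] algebra_simps)
    fix Z W assume Z: "Z \<in> tspace (arr H) p" and W: "W \<in> tspace (arr H) p"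
    have *: "V (cprod ?c1 rchart) = (tmap (arr H) (arr G) fst p V ?c1, dt p [V])" if
      "V \<in> tspace (arr H) p" for V
      using tmap_fst_snd_coord[OF A R that[unfolded arrH] c1, of rchart] by (simp add: twisted_dt_eq)
    show "\<Omega> p [Z, W] = b (Z (cprod ?c1 rchart)) (W (cprod ?c1 rchart))"
      using tmap_tspace[OF B A fst_arr UNIV_I Z] tmap_tspace[OF B A fst_arr UNIV_I W]
      unfolding twisted_Omega_eq *[OF Z] *[OF W] by (simp add: b_def b'(3) a'(2) del: twisted_product_simps)
  qed
qed

text \<open>Non-degeneracy gives uniqueness, and existence follows by counting dimensions. Linearity
  of \<open>\<mu>\<close> is asked for in every chart because the chart in which \<Omega> is
  expressed is picked inside the proof.\<close>

lemma flat_inv_Omega: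
  assumes \<mu>: "\<And>c. c \<in> charts_at (arr H) p \<Longrightarrow> \<exists>l. linear l \<and> (\<forall>Y\<in>tspace (arr H) p. \<mu> [Y] = l (Y c))"
  shows "flat_inv (arr H) \<Omega> p \<mu> \<in> tspace (arr H) p"
    and "Y \<in> tspace (arr H) p \<Longrightarrow> \<Omega> p [flat_inv (arr H) \<Omega> p \<mu>, Y] = \<mu> [Y]"
proof -
  obtain c b where c: "c \<in> charts_at (arr H) p" and b: "\<And>w. linear (\<lambda>u. b u w)" "\<And>u. linear (b u)"
    "\<And>Z W. Z \<in> tspace (arr H) p \<Longrightarrow> W \<in> tspace (arr H) p \<Longrightarrow> \<Omega> p [Z, W] = b (Z c) (W c)"
    using Omega_coord[of p] by blast
  obtain l where l: "linear l" "\<And>Y. Y \<in> tspace (arr H) p \<Longrightarrow> \<mu> [Y] = l (Y c)" using \<mu>[OF c] by blast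
  \<comment> \<open>Turns \<open>u \<mapsto> b u\<close> into an endomorphism of the coordinate
    space, for which injective implies surjective.\<close>
  define T where "T u = (\<Sum>e\<in>Basis. b u e *\<^sub>R e)" for u
  have inner: "(\<Sum>e\<in>Basis. k e *\<^sub>R e) \<bullet> e' = k e'" if "e' \<in> Basis" for k and e' :: "'d \<times> real"
    using that by simp
  have lT: "linear T"
    by (rule linearI) (simp_all add: T_def linear_add[OF b(1)] linear_scale[OF b(1)]
      scaleR_add_left sum.distrib scaleR_sum_right)
  have nd: "u = 0" if u: "\<And>w. b u w = 0" for u
  proof -
    have "coord_vec (arr H) c p u = (\<lambda>_. 0)"
      by (rule Omega_nondegenerate[OF coord_vec_self(2)[OF B c]])
        (simp only: b(3)[OF coord_vec_self(2)[OF B c]] coord_vec_self(1)[OF B c] u)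
    then show ?thesis using coord_vec_self(1)[OF B c, of u] by simp
  qed
  have expand: "k w = (\<Sum>e\<in>Basis. (w \<bullet> e) *\<^sub>R k e)" if "linear k" for k :: "'d \<times> real \<Rightarrow> real" and w
    using that by (rule linear_euclidean_expand)
  have agree: "k w = m w" if k: "linear k" "linear m" "\<And>e. e \<in> Basis \<Longrightarrow> k e = m e" for k m ::
    "'d \<times> real \<Rightarrow> real" and w
    unfolding expand[OF k(1), of w] expand[OF k(2), of w] using k(3) by simp
  have z: "linear (\<lambda>w::'d \<times> real. 0::real)" by (rule linearI) simp_all
  have "u = 0" if "T u = 0" for u
  proof (rule nd)
    have "b u e = 0" if "e \<in> Basis" for e
      using inner[OF that, of "b u"] \<open>T u = 0\<close> by (simp add: T_def)
    then show "b u w = 0" for w using agree[OF b(2) z] by blast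
  qed
  then have "inj T" using linear_injective_0[OF lT] by blast
  then have "surj T" using linear_injective_imp_surjective[OF lT] by blast
  then obtain u where u: "T u = (\<Sum>e\<in>Basis. l e *\<^sub>R e)" by (metis surjD)
  have bu: "b u w = l w" for w
  proof (rule agree[OF b(2) l(1)])
    show "b u e = l e" if "e \<in> Basis" for e
      using inner[OF that, of "b u"] inner[OF that, of l] u by (simp add: T_def)
  qed
  define X where "X = coord_vec (arr H) c p u"
  have X: "X \<in> tspace (arr H) p" "X c = u" unfolding X_def by (rule coord_vec_self[OF B c])+
  have XY: "\<Omega> p [X, Y] = \<mu> [Y]" if "Y \<in> tspace (arr H) p" for Y
    using b(3)[OF X(1) that] l(2)[OF that] bu X(2) by simp
  have "flat_inv (arr H) \<Omega> p \<mu> = X"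
    unfolding flat_inv_def
  proof (rule the_equality)
    show "X \<in> tspace (arr H) p \<and> (\<forall>Y\<in>tspace (arr H) p. \<Omega> p [X, Y] = \<mu> [Y])" using X(1) XY by blast
    fix X' assume X': "X' \<in> tspace (arr H) p \<and> (\<forall>Y\<in>tspace (arr H) p. \<Omega> p [X', Y] = \<mu> [Y])"
    have "b (X' c - u) w = 0" for w
    proof -
      have Y: "coord_vec (arr H) c p w \<in> tspace (arr H) p" "coord_vec (arr H) c p w c = w"
        by (rule coord_vec_self[OF B c])+
      have "b (X' c) w = b u w"
        using X' XY[OF Y(1)] b(3)[OF _ Y(1), of X'] b(3)[OF X(1) Y(1)] X(2) Y by simp
      then show ?thesis by (simp add: linear_diff[OF b(1)])
    qed
    then have "X' c = u" using nd[of "X' c - u"] by simp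
    then show "X' = X" using tspace_eqI[OF _ X(1) c] X' X(2) by simp
  qed
  then show "flat_inv (arr H) \<Omega> p \<mu> \<in> tspace (arr H) p"
    and "Y \<in> tspace (arr H) p \<Longrightarrow> \<Omega> p [flat_inv (arr H) \<Omega> p \<mu>, Y] = \<mu> [Y]"
    using X(1) XY by simp_all
qed

section \<open>Multiplicativity of the twisted forms\<close>

text \<open>A product has the target of its first factor, and \<open>dt\<close> is pulled back along
  the target.\<close>

lemma dt_mul:
  assumes p: "src H p = tgt H q" and Z: "Z \<in> tspace_comp H (p, q)"
  shows "dt (mul H (p, q)) [tmul H (p, q) Z]
      = dt p [tpr1 H (p, q) Z]"
proof -
  obtain k where k: "velocity (arr2 H) k (p, q) Z" "\<forall>\<^sub>F s in nhds 0. k s \<in> composable H"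
    using composable_curve[OF H p Z] .
  show ?thesis
    using dt_tgt[OF velocity_tspace[OF B velocity_mul[OF H k]]]
      dt_tgt[OF velocity_tspace[OF B velocity_fst[OF B B k(1)]]]
      tmap_tgt_mul[OF H p Z] lie_groupoidD(12)[OF H p]
    by (simp del: twisted_product_simps)
qed

text \<open>A product has the source of its second factor; of \<open>e^\<sigma>\<close> at the
  product, one exponential belongs to \<theta> at \<open>q\<close> and the other is left
  over.\<close>

lemma theta_mul:
  assumes p: "src H p = tgt H q" and Z: "Z \<in> tspace_comp H (p, q)"
  shows "\<theta> (mul H (p, q)) [tmul H (p, q) Z]
      = exp (\<sigma> (fst p)) * \<theta> q [tpr2 H (p, q) Z]"
proof -
  obtain k where k: "velocity (arr2 H) k (p, q) Z" "\<forall>\<^sub>F s in nhds 0. k s \<in> composable H"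
    using composable_curve[OF H p Z] .
  have "\<sigma> (fst (mul H (p, q))) = \<sigma> (fst p) + \<sigma> (fst q)"
    using p sigma_mult by simp
  then show ?thesis
    using theta_src[OF velocity_tspace[OF B velocity_mul[OF H k]]]
      theta_src[OF velocity_tspace[OF B velocity_snd[OF B B k(1)]]]
      tmap_src_mul[OF H p Z] lie_groupoidD(11)[OF H p]
    by (simp add: exp_add del: twisted_product_simps)
qed

text \<open>Projects a composable pair of tangent vectors to \<open>G\<close>. The last clause is
  the composability condition on the real components, differentiated; \<open>r\<close> is the value
  of \<open>d\<sigma>\<close> on the first vector.\<close>

lemma twisted_comp_split:
  assumes p: "src H p = tgt H q" and Z: "Z \<in> tspace_comp H (p, q)"
  obtains Y \<gamma> r where "Y \<in> tspace_comp G (fst p, fst q)"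
    "velocity (arr G) \<gamma> (fst p) (tpr1 G (fst p, fst q) Y)"
    "((\<lambda>s. \<sigma> (\<gamma> s)) has_real_derivative r) (at 0)"
    "tmap (arr H) (arr G) fst p (tpr1 H (p, q) Z) = tpr1 G (fst p, fst q) Y"
    "tmap (arr H) (arr G) fst q (tpr2 H (p, q) Z) = tpr2 G (fst p, fst q) Y"
    "tmap (arr H) (arr G) fst (mul H (p, q)) (tmul H (p, q) Z)
       = tmul G (fst p, fst q) Y"
    "dt q [tpr2 H (p, q) Z] = r + dt p [tpr1 H (p, q) Z]"
proof -
  obtain k where k: "velocity (arr2 H) k (p, q) Z" "\<forall>\<^sub>F s in nhds 0. k s \<in> composable H"
    using composable_curve[OF H p Z] .
  let ?Z1 = "tpr1 H (p, q) Z" and ?Z2 = "tpr2 H (p, q) Z"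
  have k1: "velocity (arr H) (\<lambda>s. fst (k s)) p ?Z1" using velocity_fst[OF B B k(1)] by simp
  have k2: "velocity (arr H) (\<lambda>s. snd (k s)) q ?Z2" using velocity_snd[OF B B k(1)] by simp
  have a: "velocity (arr G) (\<lambda>s. fst (fst (k s))) (fst p) (tmap (arr H) (arr G) fst p ?Z1)"
    by (rule velocity_map[OF B A fst_arr UNIV_I k1])
  have b: "velocity (arr G) (\<lambda>s. fst (snd (k s))) (fst q) (tmap (arr H) (arr G) fst q ?Z2)"
    by (rule velocity_map[OF B A fst_arr UNIV_I k2])
  have "\<forall>\<^sub>F s in nhds 0. src G (fst (fst (k s))) = tgt G (fst (snd (k s)))"
    using k(2) by eventually_elim (simp add: twisted_product_composable)
  from mul_curveE[OF G a b this] obtain Y where Y: "Y \<in> tspace_comp G (fst p, fst q)"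
    "tpr1 G (fst p, fst q) Y = tmap (arr H) (arr G) fst p ?Z1"
    "tpr2 G (fst p, fst q) Y = tmap (arr H) (arr G) fst q ?Z2"
    "velocity (arr G) (\<lambda>s. mul G (fst (fst (k s)), fst (snd (k s)))) (mul G (fst p, fst q))
       (tmul G (fst p, fst q) Y)" .
  have "velocity (arr G) (\<lambda>s. mul G (fst (fst (k s)), fst (snd (k s)))) (mul G (fst p, fst q))
     (tmap (arr H) (arr G) fst (mul H (p, q)) (tmul H (p, q) Z))"
    using velocity_map[OF B A fst_arr UNIV_I velocity_mul[OF H k]] by simp
  note V = velocity_eq[OF this Y(4)]
  obtain r where r: "((\<lambda>s. \<sigma> (fst (fst (k s)))) has_real_derivative r) (at 0)"
    using velocity_map[OF A R \<sigma> UNIV_I a] by (auto simp: velocity_real)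
  have "((\<lambda>s. snd (fst (k s))) has_real_derivative dt p [?Z1]) (at 0)"
    using velocity_map[OF B R snd_arr UNIV_I k1] unfolding twisted_dt_eq velocity_real by blast
  with r have 1: "((\<lambda>s. \<sigma> (fst (fst (k s))) + snd (fst (k s))) has_real_derivative r + dt p [?Z1]) (at 0)"
    by (rule DERIV_add)
  have 2: "((\<lambda>s. snd (snd (k s))) has_real_derivative dt q [?Z2]) (at 0)"
    using velocity_map[OF B R snd_arr UNIV_I k2] unfolding twisted_dt_eq velocity_real by blast
  have 3: "\<forall>\<^sub>F s in nhds 0. \<sigma> (fst (fst (k s))) + snd (fst (k s)) = snd (snd (k s))"
    using k(2) by eventually_elim (simp add: twisted_product_composable)
  have "dt q [?Z2] = r + dt p [?Z1]"
    by (rule DERIV_unique[OF 2 DERIV_cong_ev[THEN iffD1, OF refl 3 refl 1]])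
  then show thesis
    by (intro that[OF Y(1) a[folded Y(2)] r]) (simp_all add: Y(2,3) V del: twisted_product_simps)
qed

text \<open>The terms \<open>e^\<sigma> d\<sigma> \<and> \<eta>\<close> in the multiplicativity of
  \<open>d\<eta>\<close> are exactly what \<open>dt \<and> \<eta>\<close> at the second arrow
  supplies, since there \<open>dt\<close> exceeds its value at the first arrow by
  \<open>d\<sigma>\<close>. This is why the source is twisted by \<sigma>.\<close>

lemma Omega_mul:
  assumes p: "src H p = tgt H q" and Z: "Z \<in> tspace_comp H (p, q)" and W: "W \<in> tspace_comp H (p, q)"
  shows "\<Omega> (mul H (p, q)) [tmul H (p, q) Z,
       tmul H (p, q) W]
     = \<Omega> p [tpr1 H (p, q) Z, tpr1 H (p, q) W]
     + exp (\<sigma> (fst p)) * \<Omega> q [tpr2 H (p, q) Z, tpr2 H (p, q) W]"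
proof -
  have gh: "src G (fst p) = tgt G (fst q)" using p by simp
  obtain Y k r where Y: "Y \<in> tspace_comp G (fst p, fst q)"
    "velocity (arr G) k (fst p) (tpr1 G (fst p, fst q) Y)"
    "((\<lambda>s. \<sigma> (k s)) has_real_derivative r) (at 0)"
    "tmap (arr H) (arr G) fst p (tpr1 H (p, q) Z) = tpr1 G (fst p, fst q) Y"
    "tmap (arr H) (arr G) fst q (tpr2 H (p, q) Z) = tpr2 G (fst p, fst q) Y"
    "tmap (arr H) (arr G) fst (mul H (p, q)) (tmul H (p, q) Z)
       = tmul G (fst p, fst q) Y"
    "dt q [tpr2 H (p, q) Z] = r + dt p [tpr1 H (p, q) Z]"
    using twisted_comp_split[OF p Z] .
  obtain X l t where X: "X \<in> tspace_comp G (fst p, fst q)"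
    "velocity (arr G) l (fst p) (tpr1 G (fst p, fst q) X)"
    "((\<lambda>s. \<sigma> (l s)) has_real_derivative t) (at 0)"
    "tmap (arr H) (arr G) fst p (tpr1 H (p, q) W) = tpr1 G (fst p, fst q) X"
    "tmap (arr H) (arr G) fst q (tpr2 H (p, q) W) = tpr2 G (fst p, fst q) X"
    "tmap (arr H) (arr G) fst (mul H (p, q)) (tmul H (p, q) W)
       = tmul G (fst p, fst q) X"
    "dt q [tpr2 H (p, q) W] = t + dt p [tpr1 H (p, q) W]"
    using twisted_comp_split[OF p W] .
  have m: "fst (mul H (p, q)) = mul G (fst p, fst q)" by simp
  show ?thesis
    unfolding twisted_Omega_eq dt_mul[OF p Z] dt_mul[OF p W] Y(4-7) X(4-7) m
      ext_deriv_contact_mul[OF gh Y(1) X(1) Y(2,3) X(2,3)]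
      contact_groupoidD(5)[OF contact gh Y(1)] contact_groupoidD(5)[OF contact gh X(1)]
    by (simp add: algebra_simps)
qed

section \<open>The Jacobi structure and the cotangent groupoid\<close>

lemma omega_dual_src_zero:
  assumes Z: "Z \<in> tspace (arr H) p" and dual: "\<And>Y. Y \<in> tspace (arr H) p \<Longrightarrow> \<Omega> p [Z, Y] = - dt p [Y]"
  shows "tsrc H p Z = (\<lambda>_. 0)"
proof -
  define x where "x = src H p"
  define e where "e = idt H x"
  define v where "v = tsrc H p Z"
  define U where "U = tidt H x v"
  have pe: "src H p = tgt H e" unfolding e_def x_def by (simp only: lie_groupoidD(10)[OF H])
  have ee: "src H e = tgt H e" unfolding e_def by (simp only: lie_groupoidD(9,10)[OF H])
  have mpe: "mul H (p, e) = p" unfolding e_def x_def by (rule lie_groupoidD(14)[OF H])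
  have midt: "mul H (idt H y, idt H y) = idt H y" for y
    using lie_groupoidD(14)[OF H, of "idt H y"] by (simp only: lie_groupoidD(9)[OF H])
  have v: "v \<in> tspace (obj H) x"
    unfolding v_def x_def by (rule tmap_tspace[OF B N lie_groupoidD(5)[OF H] UNIV_I Z])
  have U: "U \<in> tspace (arr H) e"
    unfolding U_def e_def by (rule tmap_tspace[OF N B lie_groupoidD(7)[OF H] UNIV_I v])
  \<comment> \<open>Compare \<open>Z \<oplus> U = Z\<close> with the left translate
    \<open>V = 0 \<oplus> Y\<close>. Multiplicativity gives
    \<open>\<Omega> (Z, V) = e^\<sigma> \<Omega> (U, Y)\<close>, and the left side is
    \<open>- dt V\<close>, which is 0 because \<open>V\<close> is tangent to a target fibre.\<close>
  have alg: "\<Omega> e [U, Y] = 0" if Y: "Y \<in> algebroid_fibre H x" for Y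
  proof -
    obtain k where k: "velocity (arr H) k p Z" using tspace_velocity[OF B Z] .
    have kU: "velocity (arr H) (\<lambda>s. idt H (src H (k s))) e U"
      unfolding U_def e_def x_def v_def
      by (rule velocity_map[OF N B lie_groupoidD(7)[OF H] UNIV_I velocity_map[OF B N
        lie_groupoidD(5)[OF H] UNIV_I k]])
    have ev: "\<forall>\<^sub>F s in nhds 0. src H (k s) = tgt H (idt H (src H (k s)))"
      by (rule always_eventually) (simp only: lie_groupoidD(10)[OF H], simp)
    obtain Za where Za: "Za \<in> tspace_comp H (p, e)" "tpr1 H (p, e) Za = Z"
      "tpr2 H (p, e) Za = U"
      "velocity (arr H) (\<lambda>s. mul H (k s, idt H (src H (k s)))) (mul H (p, e))
         (tmul H (p, e) Za)"
      using mul_curveE[OF H k kU ev] .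
    have VZ: "tmul H (p, e) Za = Z"
      using velocity_eq[OF Za(4)[unfolded mpe lie_groupoidD(14)[OF H]] k] .
    obtain l where l: "velocity (arr H) l e Y" "\<forall>\<^sub>F s in nhds 0. tgt H (l s) = x"
      using algebroid_curve[OF H Y] unfolding e_def .
    have evl: "\<forall>\<^sub>F s in nhds 0. src H p = tgt H (l s)"
      using l(2) by eventually_elim (simp only: x_def)
    obtain Zb where Zb: "Zb \<in> tspace_comp H (p, e)" "tpr1 H (p, e) Zb = (\<lambda>_. 0)"
      "tpr2 H (p, e) Zb = Y"
      "velocity (arr H) (\<lambda>s. mul H (p, l s)) (mul H (p, e))
         (tmul H (p, e) Zb)"
      using mul_curveE[OF H velocity_const l(1) evl] .
    define V where "V = tmul H (p, e) Zb"
    have V: "V \<in> tspace (arr H) p" using velocity_tspace[OF B Zb(4)] unfolding mpe V_def .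
    have "dt p [V] = dt p [\<lambda>_. 0]" using dt_mul[OF pe Zb(1)] unfolding mpe Zb(2) V_def .
    also have "\<dots> = 0" unfolding twisted_dt_eq tmap_zero[OF B R snd_arr UNIV_I] by simp
    finally have "\<Omega> p [Z, V] = 0" using dual[OF V] by simp
    moreover have "\<Omega> p [Z, V] = \<Omega> p [Z, \<lambda>_. 0] + exp (\<sigma> (fst p)) * \<Omega> e [U, Y]"
      using Omega_mul[OF pe Za(1) Zb(1)] unfolding VZ V_def[symmetric] Za(2,3) Zb(2,3) mpe .
    ultimately show ?thesis by (simp add: Omega_zero)
  qed
  \<comment> \<open>Unit vectors reproduce themselves under \<open>\<oplus>\<close>, so the value
    reappears on the right side with an additional nonzero multiple of itself.\<close>
  have unit: "\<Omega> e [U, tidt H x w] = 0" if w: "w \<in> tspace (obj H) x" for w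
  proof -
    have *: "\<exists>Za\<in>tspace_comp H (e, e). tpr1 H (e, e) Za = tidt H x u \<and>
      tpr2 H (e, e) Za = tidt H x u \<and>
      tmul H (e, e) Za = tidt H x u"
      if u: "u \<in> tspace (obj H) x" for u
    proof -
      obtain k where k: "velocity (obj H) k x u" using tspace_velocity[OF N u] .
      have i: "velocity (arr H) (\<lambda>s. idt H (k s)) e (tidt H x u)"
        unfolding e_def by (rule velocity_map[OF N B lie_groupoidD(7)[OF H] UNIV_I k])
      have ev: "\<forall>\<^sub>F s in nhds 0. src H (idt H (k s)) = tgt H (idt H (k s))"
        by (rule always_eventually) (simp only: lie_groupoidD(9,10)[OF H], simp)
      obtain Za where Za: "Za \<in> tspace_comp H (e, e)"
        "tpr1 H (e, e) Za = tidt H x u"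
        "tpr2 H (e, e) Za = tidt H x u"
        "velocity (arr H) (\<lambda>s. mul H (idt H (k s), idt H (k s))) (mul H (e, e))
           (tmul H (e, e) Za)"
        using mul_curveE[OF H i i ev] .
      have "mul H (e, e) = e" unfolding e_def by (rule midt)
      then show ?thesis
        using Za velocity_eq[OF Za(4)[unfolded midt] , of "tidt H x u"] i by auto
    qed
    obtain Za where Za: "Za \<in> tspace_comp H (e, e)" "tpr1 H (e, e) Za = U"
      "tpr2 H (e, e) Za = U" "tmul H (e, e) Za = U"
      using *[OF v] unfolding U_def by blast
    obtain Zb where Zb: "Zb \<in> tspace_comp H (e, e)" "tpr1 H (e, e) Zb = tidt H x w"
      "tpr2 H (e, e) Zb = tidt H x w"
      "tmul H (e, e) Zb = tidt H x w"
      using *[OF w] by blast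
    have "mul H (e, e) = e" unfolding e_def by (rule midt)
    then have "\<Omega> e [U, tidt H x w] = \<Omega> e [U, tidt H x w]
      + exp (\<sigma> (fst e)) * \<Omega> e [U, tidt H x w]"
      using Omega_mul[OF ee Za(1) Zb(1)] unfolding Za(2-4) Zb(2-4) by metis
    then show ?thesis by simp
  qed
  \<comment> \<open>At a unit every vector is the sum of a Lie algebroid vector and a unit
    vector.\<close>
  have "\<Omega> e [U, Y] = 0" if Y: "Y \<in> tspace (arr H) e" for Y
  proof -
    let ?w = "ttgt H e Y"
    note pr = idt_tgt_projection[OF H Y[unfolded e_def], folded e_def]
    have "\<Omega> e [U, Y - tidt H x ?w] = 0" by (rule alg[OF pr(3)])
    then show ?thesis using Omega_diff[OF Y pr(2), of U] unit[OF pr(1)] by simp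
  qed
  then have "U = (\<lambda>_. 0)" by (rule Omega_nondegenerate[OF U])
  then have "v = tsrc H (idt H x) (\<lambda>_. 0)"
    using tmap_src_idt[OF H v] unfolding U_def by metis
  also have "\<dots> = (\<lambda>_. 0)" by (rule tmap_zero[OF B N lie_groupoidD(5)[OF H] UNIV_I])
  finally show ?thesis unfolding v_def .
qed

text \<open>With \<open>Z\<close> and \<open>W\<close> dual to \<omega> and \<theta>, the value is
  \<open>\<Omega> (Z, W) = - \<theta> Z\<close>, and \<theta> sees only the source component of
  \<open>Z\<close>, which is 0.\<close>

lemma lcs_jacobi_orthogonal: "fst (lcs_jacobi (arr H) \<Omega> \<omega>) (\<lambda>p vs. - dt p vs) \<theta> p = 0"
proof -
  have d: "\<exists>l. linear l \<and> (\<forall>Y\<in>tspace (arr H) p. - dt p [Y] = l (Y c))" if c: "c \<in> charts_at (arr H) p" for c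
  proof -
    define l where "l = frechet_derivative (cmap rchart \<circ> snd \<circ> cinv c) (at (cmap c p))"
    have l: "linear l" unfolding l_def
      by (rule has_derivative_linear[OF smooth_map_open_derivative[OF B R snd_arr UNIV_I c]]) simp
    have "- dt p [Y] = - l (Y c)" if "Y \<in> tspace (arr H) p" for Y
      using tmap_coord[OF B R snd_arr UNIV_I that c, of rchart] unfolding twisted_dt_eq l_def by simp
    then show ?thesis using linear_compose_neg[OF l] by blast
  qed
  have th: "\<exists>l. linear l \<and> (\<forall>Y\<in>tspace (arr H) p. \<theta> p [Y] = l (Y c))" if c: "c \<in> charts_at (arr H) p" for c
  proof -
    have "smooth_map (arr H) real_atlas (\<lambda>q. \<sigma> (fst q) + snd q)"
      using smooth_map_add[OF B smooth_map_comp_fst[OF A R R \<sigma>, folded arrH] snd_arr] .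
    then have s: "smooth_map (arr H) real_atlas (\<lambda>q. snd (src H q))" by simp
    define l where "l = frechet_derivative (cmap rchart \<circ> (\<lambda>q. snd (src H q)) \<circ> cinv c) (at (cmap c p))"
    have l: "linear l" unfolding l_def
      by (rule has_derivative_linear[OF smooth_map_open_derivative[OF B R s UNIV_I c]]) simp
    have "\<theta> p [Y] = exp (\<sigma> (fst p)) *\<^sub>R l (Y c)" if Y: "Y \<in> tspace (arr H) p" for Y
      using tmap_coord[OF B R s UNIV_I Y c, of rchart] theta_src[OF Y]
        tmap_compose[OF B N R lie_groupoidD(5)[OF H] snd_obj s Y]
      unfolding base_dt_def l_def by (simp del: twisted_product_simps)
    then show ?thesis using linear_compose_scale_right[OF l, of "exp (\<sigma> (fst p))"] by blast
  qed
  define Z where "Z = flat_inv (arr H) \<Omega> p (\<lambda>vs. - dt p vs)"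
  define W where "W = flat_inv (arr H) \<Omega> p (\<theta> p)"
  have Z: "Z \<in> tspace (arr H) p" "\<And>Y. Y \<in> tspace (arr H) p \<Longrightarrow> \<Omega> p [Z, Y] = - dt p [Y]"
    unfolding Z_def using flat_inv_Omega[OF d] by blast+
  have W: "W \<in> tspace (arr H) p" "\<And>Y. Y \<in> tspace (arr H) p \<Longrightarrow> \<Omega> p [W, Y] = \<theta> p [Y]"
    unfolding W_def using flat_inv_Omega[OF th] by blast+
  have "\<theta> p [Z] = 0"
    by (simp only: theta_src[OF Z(1)] omega_dual_src_zero[OF Z] base_dt_zero mult_zero_right)
  then have "\<Omega> p [Z, W] = 0" using Omega_antisym[of p Z W] W(2)[OF Z(1)] by simp
  then show ?thesis by (simp add: lcs_jacobi_def Z_def W_def)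
qed

text \<open>On units \<sigma> is 0, so \<open>\<theta> + \<omega>\<close> is the difference of the
  pullbacks of \<open>dt\<close> along source and target. The covector subtracted gives the same:
  removing the unit vectors over \<open>v\<close> and \<open>w\<close> from \<open>Z\<close> leaves
  a vector \<open>U\<close> whose target component is \<open>- w\<close>, where \<open>w\<close> is
  the source component of \<open>Z\<close> minus \<open>v\<close>.\<close>

lemma unit_identity:
  assumes Z: "Z \<in> tspace (arr H) (idt H x)"
  shows "\<theta> (idt H x) [Z] - dt (idt H x) [Z]
     - cot_idt H x (cot_tgt H (idt H x) (\<lambda>vs. - dt (idt H x) vs)) [Z] = 0"
proof -
  define e where "e = idt H x"
  have te: "tgt H e = x" and se: "src H e = x" unfolding e_def by (simp_all only: lie_groupoidD(9,10)[OF H])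
  define v where "v = ttgt H e Z"
  define W where "W = Z - tidt H x v"
  define w where "w = tsrc H e W"
  define U where "U = W - tidt H x w"
  note pr = idt_tgt_projection[OF H Z, folded e_def, folded v_def, folded W_def]
  have W: "W \<in> tspace (arr H) e" "ttgt H e W = (\<lambda>_. 0)"
    using pr(3) unfolding algebroid_fibre_def e_def by blast+
  note qr = idt_src_projection[OF H W(1)[unfolded e_def], folded e_def, folded w_def, folded U_def]
  \<comment> \<open>The right translation in \<open>cot_tgt\<close> is by the unit \<open>e\<close>,
    hence has no effect on \<open>U\<close>.\<close>
  have tU: "tmap_on (arr H) (arr H) {g. src H g = tgt H e} (\<lambda>g. mul H (g, e)) (idt H (tgt H e)) U = U"
    by (rule tmap_on_right_translation(3)[OF H]) (simp_all only: te e_def[symmetric] qr(3,4))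
  have "cot_idt H x (cot_tgt H e (\<lambda>vs. - dt e vs)) [Z] = - dt e [U]"
    unfolding cot_idt_def cot_tgt_def Let_def list.sel
    using tU by (simp only: te e_def[symmetric] v_def[symmetric] W_def[symmetric] w_def[symmetric]
      U_def[symmetric])
  also have "\<dots> = base_dt G \<sigma> x w"
  proof -
    have "dt e [U] = base_dt G \<sigma> x (ttgt H e U)" using dt_tgt[OF qr(3)] by (simp only: te)
    also have "ttgt H e U = (\<lambda>_. 0) - w"
      unfolding U_def tmap_diff[OF B N lie_groupoidD(6)[OF H] UNIV_I] W(2)
      using tmap_tgt_idt[OF H qr(1)] by (simp only: e_def)
    finally show ?thesis by (simp only: base_dt_diff base_dt_zero diff_0 minus_minus)
  qed
  also have "w = tsrc H e Z - v"
    unfolding w_def W_def tmap_diff[OF B N lie_groupoidD(5)[OF H] UNIV_I]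
    using tmap_src_idt[OF H pr(1)] by (simp only: e_def)
  also have "base_dt G \<sigma> x (tsrc H e Z - v) = \<theta> e [Z] - dt e [Z]"
  proof -
    have "\<sigma> (fst e) = 0" by (simp add: e_def sigma_idt)
    then have "\<theta> e [Z] = base_dt G \<sigma> x (tsrc H e Z)"
      using theta_src[OF Z[folded e_def]] by (simp only: se exp_zero mult_1)
    moreover have "dt e [Z] = base_dt G \<sigma> x v" using dt_tgt[OF Z[folded e_def]] by (simp only: te v_def)
    ultimately show ?thesis by (simp only: base_dt_diff)
  qed
  finally show ?thesis unfolding e_def by simp
qed

lemma cot_src_omega:
  assumes "X \<in> algebroid_fibre H (src H p)"
  shows "cot_src H p (\<lambda>vs. - dt p vs) X = 0"
  using dt_tgt[OF tmap_on_left_translation(1)[OF H assms]]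
  unfolding cot_src_def tmap_on_left_translation(2)[OF H assms] base_dt_zero by simp

lemma cot_tgt_theta:
  assumes X: "X \<in> algebroid_fibre H (tgt H p)"
  shows "cot_tgt H p (\<theta> p) X = 0"
proof -
  have "X \<in> tspace (arr H) (idt H (tgt H p))" using X unfolding algebroid_fibre_def by blast
  note qr = idt_src_projection(3,4)[OF H this]
  show ?thesis
    unfolding cot_tgt_def Let_def theta_src[OF tmap_on_right_translation(1)[OF H qr]]
      tmap_on_right_translation(2)[OF H qr] base_dt_zero by simp
qed

end

theorem proposition3p1:
  fixes G :: "('g::{t2_space,second_countable_topology}, 'd::euclidean_space,
               'm::{t2_space,second_countable_topology}, 'e::real_normed_vector) groupoid"
    and \<eta> :: "('g, 'd) form" and \<sigma> :: "'g \<Rightarrow> real"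
    and H :: "('g \<times> real, 'd \<times> real, 'm \<times> real, 'e \<times> real) groupoid"
    and dt :: "(real, real) form"
    and \<Omega> \<omega> \<theta> :: "('g \<times> real, 'd \<times> real) form" and \<sigma>b :: "'g \<times> real \<Rightarrow> real"
    and \<Lambda> :: "('g \<times> real, 'd \<times> real) form \<Rightarrow> ('g \<times> real, 'd \<times> real) form \<Rightarrow> 'g \<times> real \<Rightarrow> real"
    and E :: "'g \<times> real \<Rightarrow> ('g \<times> real, 'd \<times> real) tvec"
  assumes contact: "contact_groupoid G \<eta> \<sigma>"
  defines "H \<equiv> twisted_product G \<sigma>"
    and "dt \<equiv> ext_deriv real_atlas (zero_form (\<lambda>t. t))"
  defines "\<Omega> \<equiv> (\<lambda>p vs. - (pullback (arr H) (arr G) fst (ext_deriv (arr G) \<eta>) p vs +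
      wedge 1 1 (pullback (arr H) real_atlas snd dt) (pullback (arr H) (arr G) fst \<eta>) p vs))"
    and "\<omega> \<equiv> (\<lambda>p vs. - pullback (arr H) real_atlas snd dt p vs)"
    and "\<sigma>b \<equiv> \<sigma> \<circ> fst"
  defines "\<theta> \<equiv> (\<lambda>p vs. exp (\<sigma>b p) * (ext_deriv (arr H) (zero_form \<sigma>b) p vs - \<omega> p vs))"
  assumes jacobi: "(\<Lambda>, E) = lcs_jacobi (arr H) \<Omega> \<omega>"
  shows "(form_eq_comp H 2 (mul_pullback H \<Omega>)
           (\<lambda>p Zs. pr1_pullback H \<Omega> p Zs + exp (\<sigma>b (fst p)) * pr2_pullback H \<Omega> p Zs))
    \<and> ((\<forall>p. \<forall>X\<in>algebroid_fibre H (src H p). cot_src H p (\<omega> p) X = 0) \<and>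
       (\<forall>p. \<forall>X\<in>algebroid_fibre H (tgt H p). cot_tgt H p (\<theta> p) X = 0))
    \<and> (form_eq_comp H 1 (mul_pullback H \<omega>) (pr1_pullback H \<omega>) \<and>
       form_eq_comp H 1 (mul_pullback H \<theta>)
         (\<lambda>p Zs. exp (\<sigma>b (fst p)) * pr2_pullback H \<theta> p Zs))
    \<and> ((\<forall>p. \<Lambda> \<omega> \<theta> p = 0) \<and>
       (\<forall>x. \<forall>Z\<in>tspace (arr H) (idt H x).
          \<theta> (idt H x) [Z] + \<omega> (idt H x) [Z]
            - cot_idt H (tgt H (idt H x)) (cot_tgt H (idt H x) (\<omega> (idt H x))) [Z] = 0))"
proof -
  have \<Omega>: "\<Omega> = twisted_Omega G \<eta> \<sigma>"
    unfolding \<Omega>_def twisted_Omega_def twisted_dt_def H_def dt_def ..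
  have \<omega>: "\<omega> = (\<lambda>p vs. - twisted_dt G \<sigma> p vs)"
    unfolding \<omega>_def twisted_dt_def H_def dt_def ..
  have \<theta>: "\<theta> = twisted_theta G \<sigma>"
    unfolding \<theta>_def twisted_theta_def \<omega> H_def \<sigma>b_def ..
  have \<sigma>b: "\<sigma>b p = \<sigma> (fst p)" for p by (simp add: \<sigma>b_def)
  have \<Lambda>: "\<Lambda> = fst (lcs_jacobi (arr H) \<Omega> \<omega>)" using jacobi by (metis fst_conv)
  have HL: "lie_groupoid H" unfolding H_def by (rule twisted_product_contact[OF contact])
  have proj: "tmap_on (arr2 H) (arr H) (composable H) fst p Z = tpr1 H p Z"
    "tmap_on (arr2 H) (arr H) (composable H) snd p Z = tpr2 H p Z"
    if p: "p \<in> composable H" and Z: "Z \<in> tspace_comp H p" for p Z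
  proof -
    have "src H (fst p) = tgt H (snd p)" "Z \<in> tspace_comp H (fst p, snd p)"
      using p Z by (auto simp: composable_def)
    from composable_curve[OF HL this]
    obtain k where k: "velocity (arr2 H) k p Z" "\<forall>\<^sub>F s in nhds 0. k s \<in> composable H"
      unfolding prod.collapse .
    show "tmap_on (arr2 H) (arr H) (composable H) fst p Z = tpr1 H p Z"
      "tmap_on (arr2 H) (arr H) (composable H) snd p Z = tpr2 H p Z"
      using velocity_proj[OF HL k] by blast+
  qed
  have "form_eq_comp H 2 (mul_pullback H \<Omega>)
           (\<lambda>p Zs. pr1_pullback H \<Omega> p Zs + exp (\<sigma>b (fst p)) * pr2_pullback H \<Omega> p Zs)"
    unfolding form_eq_comp_def
  proof (intro ballI allI impI)
    fix p Zs assume p: "p \<in> composable H" and Zs: "length Zs = 2 \<and> set Zs \<subseteq> tspace_comp H p"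
    obtain g h where gh: "p = (g, h)" by (cases p)
    obtain Z W where ZW: "Zs = [Z, W]" using Zs by (auto simp: length_Suc_conv numeral_2_eq_2)
    have s: "src H g = tgt H h" and Z: "Z \<in> tspace_comp H (g, h)" and W: "W \<in> tspace_comp H (g, h)"
      using p Zs by (auto simp: gh ZW composable_def)
    show "mul_pullback H \<Omega> p Zs = pr1_pullback H \<Omega> p Zs + exp (\<sigma>b (fst p)) * pr2_pullback H \<Omega> p Zs"
      using Omega_mul[OF contact s[unfolded H_def] Z[unfolded H_def] W[unfolded H_def], folded H_def]
        proj[OF p[unfolded gh] Z] proj[OF p[unfolded gh] W]
      by (simp add: pullback_on_def ZW gh \<Omega> \<sigma>b)
  qed
  moreover have "form_eq_comp H 1 (mul_pullback H \<omega>) (pr1_pullback H \<omega>) \<and>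
       form_eq_comp H 1 (mul_pullback H \<theta>) (\<lambda>p Zs. exp (\<sigma>b (fst p)) * pr2_pullback H \<theta> p Zs)"
    unfolding form_eq_comp_def
  proof (intro conjI ballI allI impI)
    fix p Zs assume p: "p \<in> composable H" and Zs: "length Zs = 1 \<and> set Zs \<subseteq> tspace_comp H p"
    obtain g h where gh: "p = (g, h)" by (cases p)
    obtain Z where ZW: "Zs = [Z]" using Zs by (auto simp: length_Suc_conv)
    have s: "src H g = tgt H h" and Z: "Z \<in> tspace_comp H (g, h)"
      using p Zs by (auto simp: gh ZW composable_def)
    show "mul_pullback H \<omega> p Zs = pr1_pullback H \<omega> p Zs"
      using dt_mul[OF contact s[unfolded H_def] Z[unfolded H_def], folded H_def] proj[OF p[unfolded gh] Z]
      by (simp add: pullback_on_def ZW gh \<omega>)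
    show "mul_pullback H \<theta> p Zs = exp (\<sigma>b (fst p)) * pr2_pullback H \<theta> p Zs"
      using theta_mul[OF contact s[unfolded H_def] Z[unfolded H_def], folded H_def] proj[OF p[unfolded gh] Z]
      by (simp add: pullback_on_def ZW gh \<theta> \<sigma>b)
  qed
  moreover have "\<forall>p. \<forall>X\<in>algebroid_fibre H (src H p). cot_src H p (\<omega> p) X = 0"
    unfolding \<omega> H_def using cot_src_omega[OF contact] by blast
  moreover have "\<forall>p. \<forall>X\<in>algebroid_fibre H (tgt H p). cot_tgt H p (\<theta> p) X = 0"
    unfolding \<theta> H_def using cot_tgt_theta[OF contact] by blast
  moreover have "\<forall>p. \<Lambda> \<omega> \<theta> p = 0"
    unfolding \<Lambda> \<Omega> \<theta> H_def using lcs_jacobi_orthogonal[OF contact] unfolding \<omega> by blast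
  moreover have "\<theta> (idt H x) [Z] + \<omega> (idt H x) [Z]
            - cot_idt H (tgt H (idt H x)) (cot_tgt H (idt H x) (\<omega> (idt H x))) [Z] = 0"
    if "Z \<in> tspace (arr H) (idt H x)" for x Z
    using unit_identity[OF contact that[unfolded H_def], folded H_def]
    unfolding lie_groupoidD(10)[OF HL] \<theta> \<omega> by simp
  ultimately show ?thesis by blast
qed

end
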